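(* Let $(n_k)_{k\ge 0}$ be a strictly increasing sequence of positive integers with $n_0=1$. The following assertions are equivalent: (i) $(n_k)_{k\ge 0}$ is NSS for the class of all (real or complex, finite-dimensional) Lie groups; (ii) $(\mathbb{T},(n_k)_{k\ge 0})$ is NSS, where $\mathbb{T}=\{\lambda\in\mathbb{C}:|\lambda|=1\}$ is the circle group; (iii) $(n_k)_{k\ge 0}$ is a Jamison sequence.
   Context: Let $(n_k)_{k\ge 0}$ be a strictly increasing sequence of positive integers with $n_0=1$. NSS: for a topological group $G$, one says that $(G,(n_k)_{k\ge 0})$ is NSS if there exists a neighborhood $U$ of the identity $e$ of $G$ such that, for $g\in G$, if $g^{n_k}\in U$ for every $k\ge 0$, then $g=e$. The sequence $(n_k)_{k\ge 0}$ is NSS for a class $\mathcal{C}$ of topological groups if $(G,(n_k)_{k\ge 0})$ is NSS for each group $G$ in $\mathcal{C}$ (the neighborhood $U$ may depend on $G$). Jamison sequence: $(n_k)_{k\ge 0}$ is a Jamison sequence if for every bounded linear operator $T$ on a complex separable Banach space such that $\sup_{k\ge 0}\|T^{n_k}\|<+\infty$, the set of eigenvalues of $T$ of modulus $1$ is (at most) countable. *)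

theory Defs
  imports "HOL-Analysis.Analysis" "HOL-Algebra.Module"
begin

section \<open>Topological groups and the NSS property\<close>

record 'a topgroup = "'a monoid" +
  gtop :: "'a topology"

locale topological_group = group G for G :: "'a topgroup" (structure) +
  assumes topspace_gtop: "topspace (gtop G) = carrier G"
    and continuous_mult:
      "continuous_map (prod_topology (gtop G) (gtop G)) (gtop G) (\<lambda>(x, y). x \<otimes> y)"
    and continuous_inv: "continuous_map (gtop G) (gtop G) (\<lambda>x. inv x)"

definition neighborhood_of :: "'a topology \<Rightarrow> 'a \<Rightarrow> 'a set \<Rightarrow> bool" where
  "neighborhood_of X x U \<longleftrightarrow> U \<subseteq> topspace X \<and> (\<exists>V. openin X V \<and> x \<in> V \<and> V \<subseteq> U)"

definition nss :: "'a topgroup \<Rightarrow> (nat \<Rightarrow> nat) \<Rightarrow> bool" where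
  "nss G n \<longleftrightarrow>
     (\<exists>U. neighborhood_of (gtop G) \<one>\<^bsub>G\<^esub> U \<and>
        (\<forall>g\<in>carrier G. (\<forall>k. g [^]\<^bsub>G\<^esub> n k \<in> U) \<longrightarrow> g = \<one>\<^bsub>G\<^esub>))"

definition nss_for_class :: "'a topgroup set \<Rightarrow> (nat \<Rightarrow> nat) \<Rightarrow> bool" where
  "nss_for_class C n \<longleftrightarrow> (\<forall>G\<in>C. nss G n)"

definition circle_group :: "complex topgroup" where
  "circle_group = \<lparr>carrier = sphere 0 1, monoid.mult = (*), one = 1,
                   gtop = top_of_set (sphere 0 1)\<rparr>"


section \<open>Lie groups\<close>

text \<open>The dimension of a Lie group is bound inside the statement, so it cannot be a type
  parameter. The space \<open>k^d\<close> (\<open>k\<close> the reals or the complex numbers) is the set of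
  functions \<open>nat \<Rightarrow> k\<close> supported on the first \<open>d\<close> coordinates; the topology of the function
  type is the product topology, so the subspace topology is the usual one. For \<open>k = real\<close> this
  is \<^const>\<open>Euclidean_space\<close>.\<close>

definition coord_space :: "nat \<Rightarrow> (nat \<Rightarrow> 'k::real_normed_field) set" where
  "coord_space d = {x. \<forall>i\<ge>d. x i = 0}"

definition partial_deriv ::
  "nat \<Rightarrow> ((nat \<Rightarrow> 'k::real_normed_field) \<Rightarrow> 'k) \<Rightarrow> (nat \<Rightarrow> 'k) \<Rightarrow> 'k" where
  "partial_deriv i f x = deriv (\<lambda>t. f (x(i := t))) (x i)"

text \<open>\<open>C_diff d m U f\<close>: the function \<open>f\<close> is \<open>m\<close> times continuously differentiable over the
  scalar field on \<open>U\<close>, an open subset of \<open>k^d\<close>. Over the complex numbers the partial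
  derivatives are complex ones, so already \<open>m = 1\<close> means holomorphic.\<close>

primrec C_diff ::
  "nat \<Rightarrow> nat \<Rightarrow> (nat \<Rightarrow> 'k::real_normed_field) set \<Rightarrow> ((nat \<Rightarrow> 'k) \<Rightarrow> 'k) \<Rightarrow> bool" where
  "C_diff d 0 U f \<longleftrightarrow> continuous_on U f"
| "C_diff d (Suc m) U f \<longleftrightarrow> continuous_on U f \<and>
     (\<forall>i<d. (\<forall>x\<in>U. (\<lambda>t. f (x(i := t))) field_differentiable at (x i)) \<and>
            C_diff d m U (partial_deriv i f))"

definition smooth_on_coords ::
  "nat \<Rightarrow> nat \<Rightarrow> (nat \<Rightarrow> 'k::real_normed_field) set \<Rightarrow> ((nat \<Rightarrow> 'k) \<Rightarrow> nat \<Rightarrow> 'k) \<Rightarrow> bool" where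
  "smooth_on_coords d e U F \<longleftrightarrow> (\<forall>j<e. \<forall>m. C_diff d m U (\<lambda>x. F x j))"

type_synonym ('a, 'k) chart = "'a set \<times> ('a \<Rightarrow> nat \<Rightarrow> 'k)"

definition smooth_atlas ::
  "nat \<Rightarrow> 'a topology \<Rightarrow> ('a, 'k::real_normed_field) chart set \<Rightarrow> bool" where
  "smooth_atlas d X A \<longleftrightarrow>
     (\<forall>(V, \<phi>)\<in>A. openin X V \<and> openin (top_of_set (coord_space d)) (\<phi> ` V) \<and>
        homeomorphic_map (subtopology X V) (top_of_set (\<phi> ` V)) \<phi>) \<and>
     (\<Union>(V, \<phi>)\<in>A. V) = topspace X \<and>
     (\<forall>(V, \<phi>)\<in>A. \<forall>(W, \<psi>)\<in>A.
        smooth_on_coords d d (\<phi> ` (V \<inter> W)) (\<psi> \<circ> inv_into V \<phi>))"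

definition smooth_map ::
  "nat \<Rightarrow> ('a, 'k::real_normed_field) chart set \<Rightarrow> nat \<Rightarrow> ('b, 'k) chart set \<Rightarrow> ('a \<Rightarrow> 'b) \<Rightarrow> bool"
  where
  "smooth_map d A e B f \<longleftrightarrow>
     (\<forall>(V, \<phi>)\<in>A. \<forall>(W, \<psi>)\<in>B.
        smooth_on_coords d e (\<phi> ` {x \<in> V. f x \<in> W}) (\<psi> \<circ> f \<circ> inv_into V \<phi>))"

definition append_coords :: "nat \<Rightarrow> (nat \<Rightarrow> 'k) \<Rightarrow> (nat \<Rightarrow> 'k) \<Rightarrow> nat \<Rightarrow> 'k" where
  "append_coords d x y = (\<lambda>i. if i < d then x i else y (i - d))"

definition product_atlas ::
  "nat \<Rightarrow> ('a, 'k::real_normed_field) chart set \<Rightarrow> ('b, 'k) chart set \<Rightarrow> ('a \<times> 'b, 'k) chart set"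
  where
  "product_atlas d A B =
     {(V \<times> W, \<lambda>(x, y). append_coords d (\<phi> x) (\<psi> y)) | V \<phi> W \<psi>. (V, \<phi>) \<in> A \<and> (W, \<psi>) \<in> B}"

text \<open>Continuity of the group operations, which \<^const>\<open>smooth_map\<close> does not include, comes from
  \<^const>\<open>topological_group\<close>. Second countability is not imposed: a locally Euclidean Hausdorff
  group is automatically paracompact, but it may have uncountably many components.\<close>

definition lie_group :: "'k::real_normed_field itself \<Rightarrow> 'a topgroup \<Rightarrow> bool" where
  "lie_group _ G \<longleftrightarrow> topological_group G \<and> Hausdorff_space (gtop G) \<and>
     (\<exists>d. \<exists>A :: ('a, 'k) chart set. smooth_atlas d (gtop G) A \<and>
        smooth_map (d + d) (product_atlas d A A) d A (\<lambda>(x, y). x \<otimes>\<^bsub>G\<^esub> y) \<and>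
        smooth_map d A d A (\<lambda>x. inv\<^bsub>G\<^esub> x))"

definition lie_groups :: "'a topgroup set" where
  "lie_groups = {G. lie_group TYPE(real) G \<or> lie_group TYPE(complex) G}"


section \<open>Separable complex Banach spaces and Jamison sequences\<close>

text \<open>Banach spaces are bound inside the definition of a Jamison sequence, so they are given by
  a carrier set rather than by a type class. The multiplication and unit inherited by the record
  \<^typ>\<open>('c, 'b) module\<close> play no role.\<close>

definition complex_ring :: "complex ring" where
  "complex_ring = \<lparr>carrier = UNIV, monoid.mult = (*), one = 1, ring.zero = 0, ring.add = (+)\<rparr>"

record 'b normed_module = "(complex, 'b) module" +
  nrm :: "'b \<Rightarrow> real"

locale complex_normed_space =
  Module.module complex_ring X for X :: "'b normed_module" (structure) +
  assumes nrm_nonneg: "x \<in> carrier X \<Longrightarrow> 0 \<le> nrm X x"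
    and nrm_eq_0_iff: "x \<in> carrier X \<Longrightarrow> nrm X x = 0 \<longleftrightarrow> x = \<zero>"
    and nrm_smult: "x \<in> carrier X \<Longrightarrow> nrm X (c \<odot> x) = cmod c * nrm X x"
    and nrm_triangle:
      "x \<in> carrier X \<Longrightarrow> y \<in> carrier X \<Longrightarrow> nrm X (x \<oplus> y) \<le> nrm X x + nrm X y"

text \<open>The locale \<^locale>\<open>Metric_space\<close> wants symmetry and nonnegativity also off the carrier, hence
  the totalisation.\<close>

definition nrm_dist :: "'b normed_module \<Rightarrow> 'b \<Rightarrow> 'b \<Rightarrow> real" where
  "nrm_dist X x y = (if x \<in> carrier X \<and> y \<in> carrier X then nrm X (x \<ominus>\<^bsub>X\<^esub> y) else 0)"

definition separable_complex_banach :: "'b normed_module \<Rightarrow> bool" where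
  "separable_complex_banach X \<longleftrightarrow> complex_normed_space X \<and>
     Metric_space.mcomplete (carrier X) (nrm_dist X) \<and>
     separable_space (Metric_space.mtopology (carrier X) (nrm_dist X))"

definition bounded_operator :: "'b normed_module \<Rightarrow> ('b \<Rightarrow> 'b) \<Rightarrow> bool" where
  "bounded_operator X T \<longleftrightarrow> T \<in> carrier X \<rightarrow> carrier X \<and>
     (\<forall>x\<in>carrier X. \<forall>y\<in>carrier X. T (x \<oplus>\<^bsub>X\<^esub> y) = T x \<oplus>\<^bsub>X\<^esub> T y) \<and>
     (\<forall>c. \<forall>x\<in>carrier X. T (c \<odot>\<^bsub>X\<^esub> x) = c \<odot>\<^bsub>X\<^esub> T x) \<and>
     (\<exists>K. \<forall>x\<in>carrier X. nrm X (T x) \<le> K * nrm X x)"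

definition operator_norm :: "'b normed_module \<Rightarrow> ('b \<Rightarrow> 'b) \<Rightarrow> real" where
  "operator_norm X T = (SUP x\<in>{x \<in> carrier X. nrm X x \<le> 1}. nrm X (T x))"

definition eigenvalues :: "'b normed_module \<Rightarrow> ('b \<Rightarrow> 'b) \<Rightarrow> complex set" where
  "eigenvalues X T = {c. \<exists>x\<in>carrier X. x \<noteq> \<zero>\<^bsub>X\<^esub> \<and> T x = c \<odot>\<^bsub>X\<^esub> x}"

definition jamison_sequence :: "'b itself \<Rightarrow> (nat \<Rightarrow> nat) \<Rightarrow> bool" where
  "jamison_sequence _ n \<longleftrightarrow>
     (\<forall>(X :: 'b normed_module) T. separable_complex_banach X \<longrightarrow> bounded_operator X T \<longrightarrow>
        bdd_above (range (\<lambda>k. operator_norm X (T ^^ n k))) \<longrightarrow>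
        countable {c \<in> eigenvalues X T. cmod c = 1})"

text \<open>HOL cannot quantify over types inside a formula, so \<^const>\<open>lie_groups\<close> and
  \<^const>\<open>jamison_sequence\<close> range over the structures carried by subsets of one type. That type
  has to contain a copy of the continuum; every separable Banach space and every second countable
  Lie group then has an isomorphic copy on it.\<close>

definition has_continuum :: "'a itself \<Rightarrow> bool" where
  "has_continuum _ \<longleftrightarrow> (\<exists>f :: real \<Rightarrow> 'a. inj f)"

end

theory Submission
  imports Defs "HOL-Complex_Analysis.Complex_Analysis"
    "HOL-Computational_Algebra.Computational_Algebra"
begin

text \<open>Fix the sequence \<open>n\<close>. The circle group is NSS iff for some \<open>\<epsilon> >
  0\<close> the only point \<open>z\<close> of the circle with \<open>\<bar>z ^ n k - 1\<bar>
  \<le> \<epsilon>\<close> for all \<open>k\<close> is \<open>z = 1\<close>; this is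
  \<open>circle_separated n \<epsilon>\<close>, and all implications pass through it.

  From Lie groups to the circle: the nonzero complex numbers form a complex Lie group with one
  chart (\<open>lie_group_G\<close>), and the circle is a subgroup of it.

  From the circle to Lie groups (\<open>lie_group_nss\<close>, \<open>chart_nss\<close>): the
  neighbourhood has to work for all elements \<open>g\<close> at once, although the powers of
  \<open>g\<close> may leave it between consecutive exponents. Suppose that all \<open>g ^ n
  k\<close> are close to the unit. The operators \<open>Ad g ^ n k\<close> are then close to
  the identity. Their eigenvalues are on the circle, so they are 1 by hypothesis, and
  boundedness of the powers excludes Jordan blocks (\<open>linear_nss\<close>); so \<open>Ad g
  = 1\<close> and \<open>g\<close> commutes with all elements near the unit. In the abelian
  group of such elements the logarithm is additive, and the vector \<open>n k log g\<close> is
  small up to an element of the kernel of the exponential map. That kernel is a discrete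
  subgroup of a finite-dimensional space, so its quotient is a product of a torus and a vector
  space; coordinates reduce the claim to the circle (\<open>lattice_nss\<close>), and
  \<open>log g = 0\<close>. By a mean value argument the product \<open>x y\<close> in a chart
  is \<open>x + y\<close> up to an error bounded by the product of the norms
  (\<open>smooth_mult_estimate\<close>). From this estimate alone one obtains unique square
  roots near the unit, the logarithm as the limit of \<open>2 ^ j\<close> times the \<open>2 ^
  j\<close>-th root, and the adjoint representation as a limit along sequences that tend to
  the unit.

  From the circle to Jamison sequences (\<open>jamison_of_circle_separated\<close>): if the
  powers \<open>T ^ n k\<close> are bounded, unit eigenvectors for distinct unimodular
  eigenvalues have a distance bounded below, and a separable space contains only countably
  many such vectors.

  From Jamison sequences to the circle (\<open>not_jamison\<close>): if the circle is not NSS,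
  there are points \<open>\<mu> q \<noteq> 1\<close> of the circle whose powers \<open>n
  k\<close> are uniformly as close to 1 as desired. Products of these points along the
  infinite branches of a binary tree form an uncountable set of unimodular numbers. On a
  closed subspace of the bounded sequences indexed by the nodes there is an operator that has
  all these products as eigenvalues: its matrix consists of increments of the node values from
  parent to child, the matrix of its power \<open>n k\<close> consists of the increments of
  the powers \<open>n k\<close>, and these are summable uniformly in \<open>k\<close>.
  Separable spaces embed into any type with at least the cardinality of the continuum.\<close>

section \<open>Escape from a neighbourhood of 1 on the circle\<close>

definition circle_separated :: "(nat \<Rightarrow> nat) \<Rightarrow> real \<Rightarrow> bool" where
  "circle_separated n \<epsilon> \<longleftrightarrow> (\<forall>z. cmod z = 1 \<longrightarrow> (\<forall>k. cmod (z ^ n k - 1) \<le> \<epsilon>) \<longrightarrow> z = 1)"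

lemma circle_separated_mono: "circle_separated n \<epsilon> \<Longrightarrow> \<delta> \<le> \<epsilon> \<Longrightarrow> circle_separated n \<delta>"
  unfolding circle_separated_def by (meson order_trans)

lemma circle_group_pow: "z [^]\<^bsub>circle_group\<^esub> (m::nat) = z ^ m"
  by (induction m) (auto simp: circle_group_def nat_pow_def mult.commute)

text \<open>The neighbourhood of the identity can be taken to be a disc intersected with the circle, so
  the condition becomes a statement about one positive number, which every later argument
  uses.\<close>

lemma nss_circle_iff: "nss circle_group n \<longleftrightarrow> (\<exists>\<epsilon>>0. circle_separated n \<epsilon>)"
proof
  assume "nss circle_group n"
  then obtain U where U: "neighborhood_of (gtop circle_group) 1 U"
    and small: "\<And>z. cmod z = 1 \<Longrightarrow> (\<And>k. z ^ n k \<in> U) \<Longrightarrow> z = 1"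
    unfolding nss_def circle_group_pow by (auto simp: circle_group_def)
  then obtain V where "openin (top_of_set (sphere 0 1)) V" "(1::complex) \<in> V" "V \<subseteq> U"
    by (auto simp: neighborhood_of_def circle_group_def)
  then obtain e where e: "e > 0" "ball 1 e \<inter> sphere 0 1 \<subseteq> U"
    by (metis (no_types, lifting) openin_contains_ball order_trans)
  have "circle_separated n (e/2)"
    unfolding circle_separated_def
  proof (intro allI impI)
    fix z :: complex
    assume z: "cmod z = 1" and le: "\<forall>k. cmod (z ^ n k - 1) \<le> e/2"
    have "cmod (1 - z ^ n k) < e" for k
      using le[rule_format, of k] \<open>e > 0\<close> by (simp add: norm_minus_commute)
    then have "z ^ n k \<in> ball 1 e \<inter> sphere 0 1" for k
      using z by (auto simp: dist_norm norm_power)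
    then show "z = 1" using small z e(2) by blast
  qed
  then show "\<exists>\<epsilon>>0. circle_separated n \<epsilon>" using \<open>e > 0\<close> half_gt_zero by blast
next
  assume "\<exists>\<epsilon>>0. circle_separated n \<epsilon>"
  then obtain e where e: "e > 0" "circle_separated n e" by blast
  define U where "U = sphere 0 1 \<inter> ball (1::complex) e"
  have "neighborhood_of (gtop circle_group) \<one>\<^bsub>circle_group\<^esub> U"
    unfolding neighborhood_of_def
    using \<open>e > 0\<close> by (auto simp: circle_group_def U_def intro!: exI[of _ U] openin_open_Int)
  moreover have "z = 1" if "cmod z = 1" "\<And>k. z ^ n k \<in> U" for z
    using e(2) that unfolding circle_separated_def U_def
    by (auto simp: dist_norm norm_minus_commute less_imp_le)
  ultimately show "nss circle_group n"
    unfolding nss_def circle_group_pow by (auto simp: circle_group_def)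
qed

section \<open>Linear operators whose selected powers stay near the identity\<close>

text \<open>In a finite-dimensional space the iterates of \<open>y\<close> under \<open>M\<close> are
  linearly dependent, so some nonzero polynomial in \<open>M\<close> annihilates
  \<open>y\<close>. Take one of least degree and split off a linear factor: the remaining
  factor, applied to \<open>y\<close>, is not zero by minimality, and it is an eigenvector.\<close>

lemma eigenvector_exists:
  fixes scale :: "complex \<Rightarrow> 'b::ab_group_add \<Rightarrow> 'b"
  assumes vs: "vector_space scale"
    and R: "module.subspace scale R" "finite S" "R \<subseteq> module.span scale S"
    and y: "y \<in> R" "y \<noteq> 0"
    and M: "M \<in> R \<rightarrow> R" "\<And>x z. x \<in> R \<Longrightarrow> z \<in> R \<Longrightarrow> M (x + z) = M x + M z"
      "\<And>c x. x \<in> R \<Longrightarrow> M (scale c x) = scale c (M x)"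
  obtains x c where "x \<in> R" "x \<noteq> 0" "M x = scale c x"
proof -
  interpret vector_space scale by (fact vs)
  define ev where "ev p = (\<Sum>i\<le>degree p. scale (coeff p i) ((M ^^ i) y))" for p
  have ev_n: "ev p = (\<Sum>i\<le>m. scale (coeff p i) ((M ^^ i) y))" if "degree p \<le> m" for p m
    unfolding ev_def using that
    by (intro sum.mono_neutral_left) (auto simp: coeff_eq_0)
  have MR: "(M ^^ i) y \<in> R" for i
    by (induction i) (use y M(1) in auto)
  have ev_add: "ev (p + q) = ev p + ev q" for p q
  proof -
    have "degree (p + q) \<le> max (degree p) (degree q)" by (rule degree_add_le_max)
    then show ?thesis
      by (simp add: ev_n[of _ "max (degree p) (degree q)"] scale_left_distrib sum.distrib)
  qed
  have ev_smult: "ev (Polynomial.smult c p) = scale c (ev p)" for c p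
    by (simp add: ev_n[of _ "degree p"] degree_smult_le scale_sum_right)
  have M0: "M 0 = 0"
    using M(3)[of y 0] y by simp
  have MS: "M (\<Sum>i\<le>m. scale (c i) ((M ^^ i) y)) = (\<Sum>i\<le>m. scale (c i) ((M ^^ Suc i) y))" for c and m :: nat
  proof (induction m)
    case 0
    then show ?case using M(3)[OF MR, of _ 0] by simp
  next
    case (Suc m)
    have "(\<Sum>i\<le>m. scale (c i) ((M ^^ i) y)) \<in> R"
      by (intro subspace_sum R(1)) (auto intro: subspace_scale R(1) MR)
    moreover have "scale (c (Suc m)) ((M ^^ Suc m) y) \<in> R"
      by (intro subspace_scale R(1) MR)
    ultimately show ?case
      using Suc M(2) M(3)[OF MR, of _ "Suc m"] by simp
  qed
  have ev_pCons: "ev (pCons 0 p) = M (ev p)" for p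
  proof -
    have "ev (pCons 0 p) = (\<Sum>i\<le>Suc (degree p). scale (coeff (pCons 0 p) i) ((M ^^ i) y))"
      by (rule ev_n) (rule degree_pCons_le)
    also have "\<dots> = (\<Sum>i\<le>degree p. scale (coeff p i) ((M ^^ Suc i) y))"
      by (subst sum.atMost_Suc_shift) (simp del: funpow.simps)
    finally show ?thesis unfolding ev_def[of p] MS .
  qed
  have "\<exists>p. p \<noteq> 0 \<and> ev p = 0"
  proof (cases "inj_on (\<lambda>i. (M ^^ i) y) {..card S}")
    case True
    define T where "T = (\<lambda>i. (M ^^ i) y) ` {..card S}"
    have "finite T" "card T = Suc (card S)"
      unfolding T_def using True by (auto simp: card_image)
    moreover have "T \<subseteq> span S" unfolding T_def using MR R(3) by auto
    ultimately have "dependent T"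
      using independent_span_bound[OF R(2), of T] by auto
    then obtain u v where uv: "v \<in> T" "u v \<noteq> 0" and us: "(\<Sum>v\<in>T. scale (u v) v) = 0"
      using dependent_finite[OF \<open>finite T\<close>] by auto
    \<comment> \<open>A linear relation between the iterates, read as a polynomial.\<close>
    define p where "p = (\<Sum>i\<le>card S. monom (u ((M ^^ i) y)) i)"
    have cp: "coeff p i = (if i \<le> card S then u ((M ^^ i) y) else 0)" for i
      unfolding p_def by (simp add: coeff_sum coeff_monom if_distrib sum.delta cong: if_cong)
    then have "degree p \<le> card S" by (intro degree_le) auto
    then have "ev p = (\<Sum>i\<le>card S. scale (u ((M ^^ i) y)) ((M ^^ i) y))"
      by (simp add: ev_n[of p "card S"] cp)
    also have "\<dots> = (\<Sum>v\<in>T. scale (u v) v)"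
      unfolding T_def using True by (subst sum.reindex) auto
    finally have "ev p = 0" using us by simp
    moreover have "p \<noteq> 0"
      using uv cp unfolding T_def by (metis (no_types, lifting) atMost_iff coeff_0 imageE)
    ultimately show ?thesis by blast
  next
    case False
    then obtain i j where ij: "i < j" "(M ^^ i) y = (M ^^ j) y"
      unfolding inj_on_def by (metis linorder_neqE_nat)
    have ev_monom: "ev (monom c m) = scale c ((M ^^ m) y)" for c m
    proof -
      have "ev (monom c m) = (\<Sum>i\<le>m. scale (coeff (monom c m) i) ((M ^^ i) y))"
        by (rule ev_n) (rule degree_monom_le)
      also have "\<dots> = (\<Sum>i\<le>m. if i = m then scale c ((M ^^ m) y) else 0)"
        by (rule sum.cong) (auto simp: coeff_monom)
      finally show ?thesis by (simp add: sum.delta)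
    qed
    have "ev (monom 1 j + Polynomial.smult (-1) (monom 1 i)) = 0"
      unfolding ev_add ev_smult ev_monom using ij by simp
    moreover have "coeff (monom 1 j + Polynomial.smult (-1) (monom (1::complex) i)) j = 1"
      using ij by (simp add: coeff_monom)
    then have "monom 1 j + Polynomial.smult (-1) (monom (1::complex) i) \<noteq> 0" by (metis coeff_0 zero_neq_one)
    ultimately show ?thesis by blast
  qed
  then obtain p where p: "p \<noteq> 0" "ev p = 0" and
    min: "\<And>q. q \<noteq> 0 \<Longrightarrow> ev q = 0 \<Longrightarrow> degree p \<le> degree q"
    using ex_has_least_nat[of "\<lambda>p. p \<noteq> 0 \<and> ev p = 0" _ degree] by blast
  have "degree p \<noteq> 0"
  proof
    assume d: "degree p = 0"
    then have "ev p = scale (coeff p 0) y" by (simp add: ev_def)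
    moreover have "coeff p 0 \<noteq> 0" using p d by (metis leading_coeff_0_iff)
    ultimately show False using p y by simp
  qed
  then obtain c where "poly p c = 0"
    using fundamental_theorem_of_algebra[of p] constant_degree[of p] by auto
  then obtain q where q: "p = [:- c, 1:] * q" by (metis dvdE poly_eq_0_iff_dvd)
  have "q \<noteq> 0" using p q by auto
  then have "degree p = Suc (degree q)"
    unfolding q by (subst degree_mult_eq) auto
  then have "ev q \<noteq> 0" using min \<open>q \<noteq> 0\<close> by fastforce
  moreover have "ev q \<in> R"
    unfolding ev_def by (intro subspace_sum R(1)) (auto intro: subspace_scale R(1) MR)
  moreover have "M (ev q) = scale c (ev q)"
  proof -
    have "p = Polynomial.smult (-c) q + pCons 0 q" unfolding q by simp
    then have "ev p = scale (- c) (ev q) + M (ev q)" by (simp only: ev_add ev_smult ev_pCons)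
    then show ?thesis using p(2) by simp
  qed
  ultimately show thesis using that by blast
qed

text \<open>The exponents are unbounded, so the powers of a number off the circle either blow up or tend
  to zero, and in both cases they leave the disc of radius one half around 1.\<close>

lemma cmod_eq_1_of_power_bounds:
  fixes n :: "nat \<Rightarrow> nat"
  assumes "strict_mono n" "\<And>k. cmod (c ^ n k - 1) \<le> 1/2"
  shows "cmod c = 1"
proof (rule ccontr)
  assume "cmod c \<noteq> 1"
  have nk: "k \<le> n k" for k using assms(1) by (rule strict_mono_imp_increasing)
  have b: "cmod c ^ n k \<le> 3/2" "1/2 \<le> cmod c ^ n k" for k
    using assms(2)[of k] norm_triangle_ineq2[of "c ^ n k" 1] norm_triangle_ineq3[of 1 "c ^ n k"]
    by (auto simp: norm_power norm_minus_commute)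
  show False
  proof (cases "cmod c > 1")
    case True
    then obtain k where "3/2 < cmod c ^ k" using real_arch_pow by blast
    also have "\<dots> \<le> cmod c ^ n k" using True nk by (intro power_increasing) auto
    finally show False using b(1)[of k] by simp
  next
    case False
    then have "cmod c < 1" using \<open>cmod c \<noteq> 1\<close> by simp
    then obtain k where k: "cmod c ^ k < 1/2" using real_arch_pow_inv[of "1/2"] by auto
    have "cmod c ^ n k \<le> cmod c ^ k" using \<open>cmod c < 1\<close> nk by (intro power_decreasing) auto
    then show False using b(2)[of k] k by simp
  qed
qed

text \<open>The complexification of a real vector space: the pair \<open>(u, v)\<close> stands for
  \<open>u + \<i> v\<close>.\<close>

definition cscale :: "complex \<Rightarrow> 'v::real_vector \<times> 'v \<Rightarrow> 'v \<times> 'v" where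
  "cscale c p = (Re c *\<^sub>R fst p - Im c *\<^sub>R snd p, Re c *\<^sub>R snd p + Im c *\<^sub>R fst p)"

lemma vector_space_cscale: "vector_space cscale"
  by unfold_locales (auto simp: cscale_def algebra_simps prod_eq_iff)

text \<open>This is the claim for the general linear group. An eigenvalue \<open>c\<close> of the
  complexified operator satisfies \<open>\<bar>c ^ n k - 1\<bar> \<le> \<epsilon>\<close> for
  all \<open>k\<close>; hence it lies on the circle, and then it is 1. If \<open>A\<close>
  were not the identity, the range of \<open>A - 1\<close> would contain an eigenvector
  \<open>x = A p - p\<close> with eigenvalue 1, and \<open>A ^ m p = p + m x\<close> grows
  linearly, against the bound on the powers \<open>n k\<close>.\<close>

lemma linear_nss:
  fixes A :: "'v::real_normed_vector \<Rightarrow> 'v"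
  assumes W: "subspace W" "finite S" "W \<subseteq> span S"
    and A: "A \<in> W \<rightarrow> W" "\<And>x y. x \<in> W \<Longrightarrow> y \<in> W \<Longrightarrow> A (x + y) = A x + A y"
      "\<And>c x. x \<in> W \<Longrightarrow> A (c *\<^sub>R x) = c *\<^sub>R A x"
    and n: "strict_mono n" "circle_separated n \<epsilon>" "\<epsilon> \<le> 1/2"
    and close: "\<And>k u. u \<in> W \<Longrightarrow> norm ((A ^^ n k) u - u) \<le> \<epsilon> / 2 * norm u"
    and "w \<in> W"
  shows "A w = w"
proof (rule ccontr)
  assume "A w \<noteq> w"
  interpret c: vector_space "cscale :: complex \<Rightarrow> 'v \<times> 'v \<Rightarrow> _" by (rule vector_space_cscale)
  define M where "M p = (A (fst p), A (snd p))" for p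
  define N where "N p = norm (fst p) + norm (snd p)" for p :: "'v \<times> 'v"
  have A_diff: "A (x - y) = A x - A y" if "x \<in> W" "y \<in> W" for x y
    using A(2)[of x "- y"] A(3)[of y "-1"] that subspace_neg[OF W(1)] by simp
  have cW: "cscale c p \<in> W \<times> W" if "p \<in> W \<times> W" for c p
    using that W(1) by (auto simp: cscale_def intro!: subspace_add subspace_diff subspace_scale)
  have M_in: "M p \<in> W \<times> W" if "p \<in> W \<times> W" for p using that A(1) by (auto simp: M_def)
  have M_add: "M (p + q) = M p + M q" if "p \<in> W \<times> W" "q \<in> W \<times> W" for p q
    using that A(2) by (auto simp: M_def)
  have M_scale: "M (cscale c p) = cscale c (M p)" if "p \<in> W \<times> W" for c p
    using that W(1) by (auto simp: M_def cscale_def A(2,3) A_diff subspace_scale)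
  have M_pow: "(M ^^ i) p = ((A ^^ i) (fst p), (A ^^ i) (snd p))" for i p
    by (induction i) (auto simp: M_def)
  have M_close: "N ((M ^^ n k) p - p) \<le> \<epsilon>/2 * N p" if "p \<in> W \<times> W" for k p
    using close[of "fst p" k] close[of "snd p" k] that
    unfolding N_def M_pow by (auto simp: distrib_left mem_Times_iff)
  have subW: "c.subspace (W \<times> W)"
    unfolding c.subspace_def using cW W(1)
    by (auto simp: zero_prod_def subspace_0 subspace_add)
  \<comment> \<open>The range of \<open>M - 1\<close>, which \<open>M\<close> leaves invariant.\<close>
  define R where "R = (\<lambda>p. M p - p) ` (W \<times> W)"
  have R_sub: "R \<subseteq> W \<times> W"
    unfolding R_def using M_in subW c.subspace_diff by blast
  have subR: "c.subspace R"
    unfolding c.subspace_def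
  proof (intro conjI ballI allI)
    have z: "0 \<in> W \<times> W" using subW c.subspace_0 by blast
    show "0 \<in> R" unfolding R_def
      using M_scale[OF z, of 0] by (intro image_eqI[OF _ z]) simp
  next
    fix x y assume "x \<in> R" "y \<in> R"
    then obtain p q where "p \<in> W \<times> W" "q \<in> W \<times> W" "x = M p - p" "y = M q - q"
      unfolding R_def by blast
    then show "x + y \<in> R" unfolding R_def
      using M_add subW by (intro image_eqI[of _ _ "p + q"]) (auto intro: c.subspace_add)
  next
    fix c x assume "x \<in> R"
    then obtain p where "p \<in> W \<times> W" "x = M p - p" unfolding R_def by blast
    then show "cscale c x \<in> R" unfolding R_def
      using M_scale cW by (intro image_eqI[of _ _ "cscale c p"]) (auto simp: c.scale_right_diff_distrib)
  qed
  have fin: "finite (((\<lambda>b. (b, 0)) ` S) :: ('v \<times> 'v) set)" using W(2) by simp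
  have span: "R \<subseteq> c.span ((\<lambda>b. (b, 0)) ` S)"
  proof
    fix p assume "p \<in> R"
    then have "p \<in> W \<times> W" using R_sub by blast
    then have p: "fst p \<in> span S" "snd p \<in> span S" using W(3) by (auto simp: mem_Times_iff)
    have s: "(u, 0) \<in> c.span ((\<lambda>b. (b, 0)) ` S)" if "u \<in> span S" for u
      using that
    proof (induction rule: span_induct_alt)
      case base
      then show ?case using c.span_zero by (simp add: zero_prod_def)
    next
      case (step r x y)
      have "(r *\<^sub>R x + y, 0) = cscale (of_real r) (x, 0) + (y, 0)" by (simp add: cscale_def)
      then show ?case using step by (metis c.span_add c.span_base c.span_scale image_eqI)
    qed
    have "p = (fst p, 0) + cscale \<i> (snd p, 0)" by (simp add: cscale_def prod_eq_iff)
    then show "p \<in> c.span ((\<lambda>b. (b, 0)) ` S)"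
      using s p by (metis c.span_add c.span_scale)
  qed
  have w: "M (w, 0) - (w, 0) \<in> R"
    unfolding R_def using \<open>w \<in> W\<close> subspace_0[OF W(1)] by blast
  have w0: "M (w, 0) - (w, 0) \<noteq> 0" using \<open>A w \<noteq> w\<close> by (auto simp: M_def zero_prod_def)
  have MR: "M \<in> R \<rightarrow> R"
  proof
    fix x assume "x \<in> R"
    then obtain p where p: "p \<in> W \<times> W" "x = M p - p" unfolding R_def by blast
    then have "M x = M (M p) - M p"
      using M_in[of p] by (auto simp: M_def A_diff)
    then show "M x \<in> R" unfolding R_def using M_in p by blast
  qed
  have "M (x + z) = M x + M z" if "x \<in> R" "z \<in> R" for x z
    using M_add subsetD[OF R_sub] that by blast
  moreover have "M (cscale c x) = cscale c (M x)" if "x \<in> R" for c x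
    using M_scale subsetD[OF R_sub] that by blast
  ultimately obtain x c where x: "x \<in> R" "x \<noteq> 0" and Mx: "M x = cscale c x"
    using eigenvector_exists[OF vector_space_cscale subR fin span w w0 MR] by metis
  have xW: "x \<in> W \<times> W" using x R_sub by blast
  have Npos: "N x > 0" using x(2) unfolding N_def
    by (metis add_nonneg_pos add_pos_nonneg norm_ge_zero prod_eq_iff zero_less_norm_iff fst_zero snd_zero)
  have N_scale: "N (cscale a p) \<le> 2 * cmod a * N p" for a p
  proof -
    have "N (cscale a p) \<le> (\<bar>Re a\<bar> + \<bar>Im a\<bar>) * N p"
      unfolding N_def cscale_def
      using norm_triangle_ineq4[of "Re a *\<^sub>R fst p" "Im a *\<^sub>R snd p"]
        norm_triangle_ineq[of "Re a *\<^sub>R snd p" "Im a *\<^sub>R fst p"]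
      by (simp add: algebra_simps)
    also have "\<dots> \<le> (2 * cmod a) * N p"
      using abs_Re_le_cmod[of a] abs_Im_le_cmod[of a]
      by (intro mult_right_mono) (auto simp: N_def)
    finally show ?thesis .
  qed
  have powx: "(M ^^ i) x = cscale (c ^ i) x" for i
    by (induction i) (use xW in \<open>auto simp: M_scale Mx cW mult.commute\<close>)
  have bound: "cmod (c ^ n k - 1) \<le> \<epsilon>" for k
  proof (cases "c ^ n k = 1")
    case True
    then show ?thesis using M_close[OF xW, of k] Npos
      by (simp add: powx) (simp add: N_def zero_le_mult_iff)
  next
    case False
    define a where "a = c ^ n k - 1"
    have "a \<noteq> 0" using False by (simp add: a_def)
    have "cscale a x = (M ^^ n k) x - x"
      unfolding powx a_def by (simp add: c.scale_left_diff_distrib)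
    then have "N (cscale a x) \<le> \<epsilon>/2 * N x" using M_close[OF xW] by simp
    moreover have "N x \<le> 2 * cmod (inverse a) * N (cscale a x)"
      using N_scale[of "inverse a" "cscale a x"] \<open>a \<noteq> 0\<close> by simp
    then have "cmod a * N x \<le> cmod a * (2 * cmod (inverse a) * N (cscale a x))"
      by (intro mult_left_mono) auto
    moreover have "\<dots> = 2 * (cmod a * inverse (cmod a)) * N (cscale a x)"
      by (simp add: norm_inverse)
    ultimately have "cmod a * N x \<le> \<epsilon> * N x" using \<open>a \<noteq> 0\<close> by simp
    then show ?thesis using Npos by (simp add: a_def)
  qed
  then have "cmod c = 1"
    using n(1,3) by (intro cmod_eq_1_of_power_bounds[of n]) (auto simp del: le_divide_eq_numeral1 intro: order_trans)
  then have "c = 1" using n(2) bound unfolding circle_separated_def by blast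
  obtain p where p: "p \<in> W \<times> W" "x = M p - p" using x unfolding R_def by blast
  have Mxx: "(M ^^ i) x = x" for i using powx \<open>c = 1\<close> by simp
  have pW: "(M ^^ i) p \<in> W \<times> W" for i by (induction i) (use p M_in in auto)
  have "(M ^^ i) p = p + cscale (of_nat i) x" for i
  proof (induction i)
    case (Suc i)
    have "(M ^^ Suc i) p = M p + M (cscale (of_nat i) x)"
      using Suc M_add[OF p(1) cW[OF xW]] by simp
    also have "\<dots> = M p + cscale (of_nat i) x" using M_scale[OF xW] Mxx[of 1] by simp
    also have "\<dots> = p + cscale (of_nat (Suc i)) x" unfolding p(2) by (simp add: c.scale_left_distrib)
    finally show ?case .
  qed simp
  then have "N (cscale (of_nat (n k)) x) \<le> \<epsilon>/2 * N p" for k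
    using M_close[OF p(1), of k] by simp
  moreover have "N (cscale (of_nat i) x) = of_nat i * N x" for i
    unfolding N_def cscale_def by (simp add: distrib_left)
  ultimately have b: "of_nat (n k) * N x \<le> \<epsilon>/2 * N p" for k by simp
  obtain k :: nat where k: "\<epsilon>/2 * N p < of_nat k * N x"
    using Npos reals_Archimedean3 by blast
  have "of_nat k * N x \<le> of_nat (n k) * N x"
    using strict_mono_imp_increasing[OF n(1), of k] Npos by (intro mult_right_mono) auto
  then show False using b[of k] k by linarith
qed

section \<open>Discrete subgroups of finite-dimensional spaces\<close>

text \<open>A finite-dimensional real subspace of a normed space, given with bounded coordinate
  functionals \<open>co\<close> for a spanning family \<open>bv\<close>. The dimension is a
  number and not a type, because the dimension of a Lie group is only known to exist.\<close>

locale coord_subspace =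
  fixes W :: "'v::real_normed_vector set" and I :: "'i set"
    and co :: "'i \<Rightarrow> 'v \<Rightarrow> real" and bv :: "'i \<Rightarrow> 'v"
  assumes subspace_W: "subspace W"
    and finite_I: "finite I"
    and co: "\<And>i. i \<in> I \<Longrightarrow> bounded_linear (co i)"
    and bv: "\<And>i. i \<in> I \<Longrightarrow> bv i \<in> W"
    and expand: "\<And>w. w \<in> W \<Longrightarrow> w = (\<Sum>i\<in>I. co i w *\<^sub>R bv i)"
begin

lemma W_subset_span: "W \<subseteq> span (bv ` I)"
proof
  fix w assume "w \<in> W"
  then have "w = (\<Sum>i\<in>I. co i w *\<^sub>R bv i)" by (rule expand)
  also have "\<dots> \<in> span (bv ` I)" by (intro span_sum span_scale span_base) auto
  finally show "w \<in> span (bv ` I)" .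
qed

lemma closed_W: "closed W"
proof -
  have "W = {w. w = (\<Sum>i\<in>I. co i w *\<^sub>R bv i)}"
  proof (intro equalityI subsetI)
    fix w assume "w \<in> W"
    from expand[OF this] show "w \<in> {w. w = (\<Sum>i\<in>I. co i w *\<^sub>R bv i)}" by (rule CollectI)
  next
    fix w assume "w \<in> {w. w = (\<Sum>i\<in>I. co i w *\<^sub>R bv i)}"
    then have w: "w = (\<Sum>i\<in>I. co i w *\<^sub>R bv i)" by (rule CollectD)
    show "w \<in> W"
      by (subst w) (intro subspace_sum[OF subspace_W] subspace_scale[OF subspace_W] bv)
  qed
  moreover have "closed {w. w = (\<Sum>i\<in>I. co i w *\<^sub>R bv i)}"
    by (intro closed_Collect_eq continuous_intros linear_continuous_on co)
  ultimately show ?thesis by (rule ssubst)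
qed

text \<open>Applied to the coordinates with respect to a basis that is adapted to a lattice, which are
  unrelated to the given coordinate functionals.\<close>

lemma coords_bounded:
  assumes f: "\<And>x y. x \<in> W \<Longrightarrow> y \<in> W \<Longrightarrow> f (x + y) = f x + f y"
    "\<And>c x. x \<in> W \<Longrightarrow> f (c *\<^sub>R x) = c *\<^sub>R f x"
  obtains K where "K > 0" "\<And>w. w \<in> W \<Longrightarrow> norm (f w) \<le> K * norm w"
proof -
  obtain k where k: "\<And>i x. i \<in> I \<Longrightarrow> \<bar>co i x\<bar> \<le> norm x * k i"
    using bounded_linear.bounded[OF co] by (metis real_norm_def)
  have sum: "(\<Sum>i\<in>J. co i w *\<^sub>R bv i) \<in> W \<and> f (\<Sum>i\<in>J. co i w *\<^sub>R bv i) = (\<Sum>i\<in>J. co i w *\<^sub>R f (bv i))"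
    if "J \<subseteq> I" for J w
    using finite_subset[OF that finite_I] that
  proof (induction J rule: finite_induct)
    case empty
    have "f 0 = 0" using f(2)[of 0 0] subspace_0[OF subspace_W] by simp
    then show ?case using subspace_0[OF subspace_W] by simp
  next
    case (insert j J)
    then show ?case
      using f bv by (simp add: subspace_add[OF subspace_W] subspace_scale[OF subspace_W])
  qed
  define K where "K = (\<Sum>i\<in>I. \<bar>k i\<bar> * norm (f (bv i)))"
  have "norm (f w) \<le> K * norm w" if "w \<in> W" for w
  proof -
    have "f w = (\<Sum>i\<in>I. co i w *\<^sub>R f (bv i))"
      using sum[of I w] expand[OF that] by simp
    also have "norm \<dots> \<le> (\<Sum>i\<in>I. norm w * \<bar>k i\<bar> * norm (f (bv i)))"
    proof (intro sum_norm_le)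
      fix i assume "i \<in> I"
      then have "\<bar>co i w\<bar> \<le> norm w * \<bar>k i\<bar>"
        using k[of i w] by (smt (verit) mult_left_mono norm_ge_zero)
      then show "norm (co i w *\<^sub>R f (bv i)) \<le> norm w * \<bar>k i\<bar> * norm (f (bv i))"
        by (simp add: mult_right_mono)
    qed
    also have "\<dots> = K * norm w"
      unfolding K_def sum_distrib_right by (intro sum.cong) auto
    finally show ?thesis .
  qed
  moreover have "K \<ge> 0" unfolding K_def by (intro sum_nonneg) auto
  ultimately show ?thesis
    using that[of "K + 1"] by (smt (verit) mult_right_mono norm_ge_zero)
qed

text \<open>Cut a box in coordinate space into cells so small that two points of one cell have distance
  less than \<open>s\<close>. There are finitely many cells, and each holds at most one point
  of the set.\<close>

lemma finite_discrete_bounded: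
  assumes "S \<subseteq> W" "s > 0" and sep: "\<And>x y. x \<in> S \<Longrightarrow> y \<in> S \<Longrightarrow> norm (x - y) < s \<Longrightarrow> x = y"
    and bd: "\<And>x. x \<in> S \<Longrightarrow> norm x \<le> B"
  shows "finite S"
proof -
  obtain k where k: "\<And>i x. i \<in> I \<Longrightarrow> \<bar>co i x\<bar> \<le> norm x * k i"
    using bounded_linear.bounded[OF co] by (metis real_norm_def)
  define c where "c = (\<Sum>i\<in>I. norm (bv i)) + 1"
  have "c > 0" unfolding c_def by (simp add: add_nonneg_pos sum_nonneg)
  \<comment> \<open>Cells of side \<open>s / c\<close>: the distance in a cell is at most \<open>(c - 1) / m < s\<close>.\<close>
  define m where "m = c / s"
  have "m > 0" unfolding m_def using \<open>c > 0\<close> \<open>s > 0\<close> by simp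
  define q where "q x = (\<lambda>i\<in>I. \<lfloor>m * co i x\<rfloor>)" for x
  have "q x \<in> (\<Pi>\<^sub>E i\<in>I. {\<lfloor>- (m * (\<bar>B\<bar> * \<bar>k i\<bar>))\<rfloor>..\<lfloor>m * (\<bar>B\<bar> * \<bar>k i\<bar>)\<rfloor>})" if "x \<in> S" for x
  proof
    fix i assume "i \<in> I"
    have "norm x * k i \<le> \<bar>B\<bar> * \<bar>k i\<bar>"
      using bd[OF that] by (smt (verit) mult_mono norm_ge_zero mult_left_mono)
    then have "\<bar>co i x\<bar> \<le> \<bar>B\<bar> * \<bar>k i\<bar>" using k[OF \<open>i \<in> I\<close>, of x] by simp
    then have "\<bar>m * co i x\<bar> \<le> m * (\<bar>B\<bar> * \<bar>k i\<bar>)" using \<open>m > 0\<close> by (simp add: abs_mult)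
    then have "- (m * (\<bar>B\<bar> * \<bar>k i\<bar>)) \<le> m * co i x" "m * co i x \<le> m * (\<bar>B\<bar> * \<bar>k i\<bar>)" by linarith+
    then show "q x i \<in> {\<lfloor>- (m * (\<bar>B\<bar> * \<bar>k i\<bar>))\<rfloor>..\<lfloor>m * (\<bar>B\<bar> * \<bar>k i\<bar>)\<rfloor>}"
      using \<open>i \<in> I\<close> unfolding q_def by (simp add: floor_mono)
  qed (auto simp: q_def)
  then have "finite (q ` S)"
    using finite_subset[OF _ finite_PiE[OF finite_I]] by (metis (no_types, lifting) finite_atLeastAtMost_int image_subsetI)
  moreover have "inj_on q S"
  proof
    fix x y assume xy: "x \<in> S" "y \<in> S" "q x = q y"
    have "\<bar>co i x - co i y\<bar> \<le> 1 / m" if "i \<in> I" for i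
    proof -
      have "\<lfloor>m * co i x\<rfloor> = \<lfloor>m * co i y\<rfloor>" using fun_cong[OF xy(3), of i] that by (simp add: q_def)
      then have "\<bar>m * co i x - m * co i y\<bar> \<le> 1" by linarith
      then have "m * \<bar>co i x - co i y\<bar> \<le> 1" using \<open>m > 0\<close> by (simp add: abs_mult flip: right_diff_distrib)
      then show ?thesis using \<open>m > 0\<close> by (simp add: field_simps)
    qed
    then have *: "norm (co i (x - y) *\<^sub>R bv i) \<le> 1 / m * norm (bv i)" if "i \<in> I" for i
      unfolding norm_scaleR using that
      by (intro mult_right_mono) (simp_all add: linear_diff bounded_linear.linear[OF co])
    have "x - y \<in> W" using xy \<open>S \<subseteq> W\<close> subspace_diff[OF subspace_W] by blast
    then have "norm (x - y) = norm (\<Sum>i\<in>I. co i (x - y) *\<^sub>R bv i)" using expand by metis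
    also have "\<dots> \<le> (\<Sum>i\<in>I. 1 / m * norm (bv i))" by (intro sum_norm_le *)
    also have "\<dots> = (c - 1) / m" unfolding c_def by (simp add: sum_divide_distrib)
    also have "\<dots> < c / m" using \<open>m > 0\<close> by (intro divide_strict_right_mono) auto
    also have "\<dots> = s" unfolding m_def using \<open>c > 0\<close> by simp
    finally show "x = y" using sep xy by blast
  qed
  ultimately show "finite S" using finite_imageD by blast
qed

end

lemma int_combination_mem:
  fixes L :: "'v::real_vector set"
  assumes L: "0 \<in> L" "\<And>x y. x \<in> L \<Longrightarrow> y \<in> L \<Longrightarrow> x - y \<in> L"
  shows "x \<in> L \<Longrightarrow> y \<in> L \<Longrightarrow> x + y \<in> L"
    and "x \<in> L \<Longrightarrow> of_int j *\<^sub>R x \<in> L"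
    and "finite M \<Longrightarrow> M \<subseteq> L \<Longrightarrow> (\<Sum>b\<in>M. of_int (h b) *\<^sub>R b) \<in> L"
proof -
  have neg: "- x \<in> L" if "x \<in> L" for x using L(2)[OF L(1) that] by simp
  show add: "x + y \<in> L" if "x \<in> L" "y \<in> L" for x y using L(2)[OF that(1) neg[OF that(2)]] by simp
  have nat: "of_nat j *\<^sub>R x \<in> L" if "x \<in> L" for j x
    by (induction j) (use L(1) add that in \<open>auto simp: scaleR_left_distrib\<close>)
  show int: "of_int j *\<^sub>R x \<in> L" if "x \<in> L" for j x
    using nat[OF that, of "nat \<bar>j\<bar>"] neg[OF nat[OF that, of "nat \<bar>j\<bar>"]]
    by (cases "j \<ge> 0") auto
  show "finite M \<Longrightarrow> M \<subseteq> L \<Longrightarrow> (\<Sum>b\<in>M. of_int (h b) *\<^sub>R b) \<in> L" for M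
    by (induction M rule: finite_induct) (use L(1) add int in auto)
qed

lemma cis_2pi_close:
  assumes "\<bar>x - of_int j\<bar> \<le> d" shows "cmod (cis (2 * pi * x) - 1) \<le> 2 * pi * d"
proof -
  have "cis (2 * pi * x) = cis (2 * pi * (x - of_int j)) * cis (2 * pi * of_int j)"
    by (simp add: cis_mult algebra_simps)
  also have "cis (2 * pi * of_int j) = 1" by (simp add: cis_multiple_2pi)
  finally have "cmod (cis (2 * pi * x) - 1) = cmod (cis (2 * pi * (x - of_int j)) - 1)" by simp
  also have "\<dots> = 2 * \<bar>sin (2 * pi * (x - of_int j) / 2)\<bar>"
    using dist_exp_i_1[of "2 * pi * (x - of_int j)"] unfolding cis_conv_exp by (simp only:)
  also have "\<dots> \<le> \<bar>2 * pi * (x - of_int j)\<bar>"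
    using abs_sin_x_le_abs_x[of "2 * pi * (x - of_int j) / 2"] by linarith
  also have "\<dots> \<le> 2 * pi * d" using assms by (simp add: abs_mult)
  finally show ?thesis .
qed

text \<open>Additivity gives homogeneity for rational scalars; boundedness extends it to real ones.\<close>

lemma additive_bounded_scale:
  fixes f :: "'v::real_normed_vector \<Rightarrow> 'v"
  assumes W: "subspace W"
    and add: "\<And>x y. x \<in> W \<Longrightarrow> y \<in> W \<Longrightarrow> f (x + y) = f x + f y"
    and bd: "\<And>x. x \<in> W \<Longrightarrow> norm (f x) \<le> K * norm x"
    and w: "w \<in> W"
  shows "f (c *\<^sub>R w) = c *\<^sub>R f w"
proof -
  have f0: "f 0 = 0" using add[of 0 0] subspace_0[OF W] by simp
  have sc: "a *\<^sub>R w \<in> W" for a by (rule subspace_scale[OF W w])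
  have neg: "f (- x) = - f x" if "x \<in> W" for x
    using add[OF that subspace_neg[OF W that]] f0 by (simp add: eq_neg_iff_add_eq_0 add.commute)
  have nat: "f (of_nat m *\<^sub>R x) = of_nat m *\<^sub>R f x" if "x \<in> W" for m x
  proof (induction m)
    case (Suc m)
    have "f (of_nat (Suc m) *\<^sub>R x) = f (x + of_nat m *\<^sub>R x)" by (simp add: scaleR_left_distrib)
    also have "\<dots> = f x + f (of_nat m *\<^sub>R x)" by (intro add that subspace_scale[OF W])
    finally show ?case by (simp add: Suc scaleR_left_distrib)
  qed (simp add: f0)
  have int: "f (of_int m *\<^sub>R x) = of_int m *\<^sub>R f x" if "x \<in> W" for m x
  proof (cases "m \<ge> 0")
    case True
    then show ?thesis using nat[OF that, of "nat m"] by simp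
  next
    case False
    then have "f (of_int m *\<^sub>R x) = f (- (of_nat (nat (- m)) *\<^sub>R x))" by simp
    also have "\<dots> = - (of_nat (nat (- m)) *\<^sub>R f x)"
      by (simp only: neg[OF subspace_scale[OF W that]] nat[OF that])
    finally show ?thesis using False by simp
  qed
  define K' where "K' = \<bar>K\<bar> * norm w + norm (f w)"
  have approx: "norm (f (c *\<^sub>R w) - c *\<^sub>R f w) \<le> K' / of_nat m" if m: "m > 0" for m :: nat
  proof -
    define q :: real where "q = of_int \<lfloor>of_nat m * c\<rfloor> / of_nat m"
    have "\<bar>of_nat m * c - of_int \<lfloor>of_nat m * c\<rfloor>\<bar> \<le> 1" by linarith
    then have "\<bar>of_nat m * (c - q)\<bar> \<le> 1" unfolding q_def using m by (simp add: right_diff_distrib)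
    then have "of_nat m * \<bar>c - q\<bar> \<le> 1" by (simp only: abs_mult abs_of_nat)
    then have cq: "\<bar>c - q\<bar> \<le> 1 / of_nat m" using m by (simp add: pos_le_divide_eq mult.commute)
    have "of_nat m *\<^sub>R f ((1 / of_nat m) *\<^sub>R w) = f w"
      using nat[OF sc[of "1 / of_nat m"], of m] m by simp
    then have "f ((1 / of_nat m) *\<^sub>R w) = (1 / of_nat m) *\<^sub>R f w"
      using m by (simp add: eq_vector_fraction_iff)
    then have fq: "f (q *\<^sub>R w) = q *\<^sub>R f w"
      using int[OF sc[of "1 / of_nat m"], of "\<lfloor>of_nat m * c\<rfloor>"] by (simp add: q_def)
    have "c *\<^sub>R w = (c - q) *\<^sub>R w + q *\<^sub>R w" by (simp add: scaleR_left_diff_distrib)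
    then have "f (c *\<^sub>R w) = f ((c - q) *\<^sub>R w) + q *\<^sub>R f w" using add[OF sc sc] fq by metis
    then have "f (c *\<^sub>R w) - c *\<^sub>R f w = f ((c - q) *\<^sub>R w) - (c - q) *\<^sub>R f w"
      by (simp add: scaleR_left_diff_distrib)
    then have "norm (f (c *\<^sub>R w) - c *\<^sub>R f w) \<le> norm (f ((c - q) *\<^sub>R w)) + \<bar>c - q\<bar> * norm (f w)"
      using norm_triangle_ineq4[of "f ((c - q) *\<^sub>R w)" "(c - q) *\<^sub>R f w"] by simp
    also have "norm (f ((c - q) *\<^sub>R w)) \<le> K * norm ((c - q) *\<^sub>R w)" by (rule bd[OF sc])
    also have "\<dots> \<le> \<bar>c - q\<bar> * (\<bar>K\<bar> * norm w)"
    proof -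
      have "K * norm ((c - q) *\<^sub>R w) \<le> \<bar>K\<bar> * norm ((c - q) *\<^sub>R w)" by (intro mult_right_mono) auto
      then show ?thesis by (simp add: mult_ac)
    qed
    finally have "norm (f (c *\<^sub>R w) - c *\<^sub>R f w) \<le> \<bar>c - q\<bar> * K'" unfolding K'_def by (simp add: distrib_left)
    also have "\<dots> \<le> 1 / of_nat m * K'"
      by (intro mult_right_mono cq) (simp add: K'_def)
    finally show ?thesis by simp
  qed
  have "(\<lambda>m. K' / of_nat (Suc m)) \<longlonglongrightarrow> 0"
    using LIMSEQ_Suc[OF lim_const_over_n[of K']] by simp
  then have "norm (f (c *\<^sub>R w) - c *\<^sub>R f w) \<le> 0"
    by (rule LIMSEQ_le_const) (use approx in blast)
  then show ?thesis by simp
qed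

lemma geometric_convergent:
  fixes X :: "nat \<Rightarrow> 'v::banach"
  assumes d: "\<And>j. norm (X (Suc j) - X j) \<le> c * q ^ j" and q: "0 \<le> q" "q < 1"
  obtains l where "X \<longlonglongrightarrow> l" "norm (l - X 0) \<le> c / (1 - q)"
proof -
  have g: "(\<lambda>j. c * q ^ j) sums (c * (1 / (1 - q)))"
    using q by (intro sums_mult geometric_sums) simp
  have s: "summable (\<lambda>j. norm (X (Suc j) - X j))"
    by (rule summable_comparison_test'[OF sums_summable[OF g], of 0]) (simp add: d)
  have "(\<lambda>n. \<Sum>j<n. X (Suc j) - X j) \<longlonglongrightarrow> (\<Sum>j. X (Suc j) - X j)"
    by (rule summable_LIMSEQ[OF summable_norm_cancel[OF s]])
  then have "(\<lambda>n. X n - X 0) \<longlonglongrightarrow> (\<Sum>j. X (Suc j) - X j)" by (simp add: sum_lessThan_telescope)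
  from tendsto_add[OF this tendsto_const[of "X 0"]]
  have "X \<longlonglongrightarrow> (\<Sum>j. X (Suc j) - X j) + X 0" by simp
  moreover have "norm (\<Sum>j. X (Suc j) - X j) \<le> (\<Sum>j. norm (X (Suc j) - X j))"
    by (rule summable_norm[OF s])
  moreover have "\<dots> \<le> c * (1 / (1 - q))"
    using suminf_le[OF d s sums_summable[OF g]] sums_unique[OF g] by simp
  ultimately show thesis using that[of "(\<Sum>j. X (Suc j) - X j) + X 0"] by simp
qed

context coord_subspace
begin

text \<open>The claim for \<open>W / L\<close>, a product of a torus and a vector space. Choose a maximal
  linearly independent \<open>M \<subseteq> L\<close> and extend it to a basis
  \<open>E\<close> of \<open>W\<close>. Only finitely many points of \<open>L\<close> have
  coordinates in \<open>[0, 1)\<close>, so by the pigeonhole principle the coordinates of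
  points of \<open>L\<close> along \<open>M\<close> are rational with a common denominator
  \<open>Q\<close>. For \<open>b \<in> M\<close> the number \<open>Q\<close> times the
  coordinate of \<open>x\<close> is therefore an angle whose multiples by \<open>n k\<close>
  are nearly integers, and the hypothesis on the circle makes it an integer; being small, it
  is 0. The coordinates outside \<open>M\<close> vanish on \<open>L\<close>, so for
  \<open>x\<close> they have bounded multiples by \<open>n k\<close> and are 0 as well.\<close>

lemma lattice_nss:
  assumes L: "L \<subseteq> W" "0 \<in> L" "\<And>x y. x \<in> L \<Longrightarrow> y \<in> L \<Longrightarrow> x - y \<in> L"
    and s: "s > 0" "\<And>v. v \<in> L \<Longrightarrow> norm v < s \<Longrightarrow> v = 0"
    and n: "strict_mono n" "circle_separated n \<epsilon>" "\<epsilon> > 0"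
  shows "\<exists>\<delta>>0. \<forall>x\<in>W. norm x < \<delta> \<longrightarrow>
    (\<forall>k. \<exists>y\<in>W. norm y < \<delta> \<and> of_nat (n k) *\<^sub>R x - y \<in> L) \<longrightarrow> x = 0"
proof -
  obtain M where M: "M \<subseteq> L" "independent M" "L \<subseteq> span M"
    using maximal_independent_subset by blast
  then obtain E where E: "M \<subseteq> E" "E \<subseteq> W" "independent E" "W \<subseteq> span E"
    using maximal_independent_subset_extend[of M W] L(1) by blast
  have finE: "finite E"
    using independent_span_bound[of "bv ` I" E] finite_I E W_subset_span by auto
  then have finM: "finite M" using E(1) finite_subset by blast
  define r where "r b x = representation E x b" for b x
  have r_add: "r b (x + y) = r b x + r b y" if "x \<in> W" "y \<in> W" for b x y
    unfolding r_def by (simp add: representation_add[OF E(3) subsetD[OF E(4) that(2)] subsetD[OF E(4) that(1)]])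
  have r_scale: "r b (c *\<^sub>R x) = c *\<^sub>R r b x" if "x \<in> W" for b c x
    unfolding r_def using representation_scale[OF E(3) subsetD[OF E(4) that(1)], THEN fun_cong] by simp
  have r_diff: "r b (x - y) = r b x - r b y" if "x \<in> W" "y \<in> W" for b x y
    unfolding r_def by (simp add: representation_diff[OF E(3) subsetD[OF E(4) that(2)] subsetD[OF E(4) that(1)]])
  have r_expand: "x = (\<Sum>b\<in>E. r b x *\<^sub>R b)" if "x \<in> W" for x
    unfolding r_def using sum_representation_eq[OF E(3), of x E] that E(4) finE by auto
  have r_sum: "r b (\<Sum>c\<in>M. g c *\<^sub>R c) = (if b \<in> M then g b else 0)" for b g
  proof -
    have "M \<subseteq> span E" using E(1) span_superset by blast
    then have "r b (\<Sum>c\<in>M. g c *\<^sub>R c) = (\<Sum>c\<in>M. g c * r b c)"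
      unfolding r_def
      by (subst representation_sum[OF E(3)])
        (auto intro!: span_scale sum.cong simp: representation_scale[OF E(3)] subset_iff)
    also have "\<dots> = (\<Sum>c\<in>M. if c = b then g c else 0)"
      using E(1) by (intro sum.cong) (auto simp: r_def representation_basis[OF E(3)] subset_iff)
    finally show ?thesis using finM by simp
  qed
  have r_L: "r b v = 0" if "v \<in> L" "b \<notin> M" for b v
  proof -
    have "v \<in> range (\<lambda>u. \<Sum>c\<in>M. u c *\<^sub>R c)"
      using subsetD[OF M(3) that(1)] unfolding span_finite[OF finM] .
    then obtain g where "v = (\<Sum>c\<in>M. g c *\<^sub>R c)" by (rule rangeE)
    then show ?thesis using r_sum that(2) by simp
  qed
  have L_expand: "v = (\<Sum>b\<in>M. r b v *\<^sub>R b)" if "v \<in> L" for v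
  proof -
    have "v = (\<Sum>b\<in>E. r b v *\<^sub>R b)" using r_expand that L(1) by blast
    also have "\<dots> = (\<Sum>b\<in>M. r b v *\<^sub>R b)"
      using r_L[OF that] E(1) finE by (intro sum.mono_neutral_right) auto
    finally show ?thesis .
  qed
  have "\<exists>K>0. \<forall>w\<in>W. norm (r b w) \<le> K * norm w" for b
    using coords_bounded[of "r b"] r_add r_scale by metis
  then obtain K where K: "\<And>b. K b > 0" "\<And>b w. w \<in> W \<Longrightarrow> \<bar>r b w\<bar> \<le> K b * norm w"
    by (metis real_norm_def)
  define K0 where "K0 = 1 + (\<Sum>b\<in>E. K b)"
  have "K b \<le> K0" if "b \<in> E" for b
    unfolding K0_def using member_le_sum[OF that, of K] K(1) finE by (smt (verit))
  then have K0: "\<bar>r b w\<bar> \<le> K0 * norm w" if "w \<in> W" "b \<in> E" for b w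
    using K(2)[OF that(1), of b] that(2) by (smt (verit) mult_right_mono norm_ge_zero)
  have "K0 > 0" unfolding K0_def using K(1) by (simp add: add_pos_nonneg less_imp_le sum_nonneg)
  define P where "P = {v \<in> L. \<forall>b\<in>M. 0 \<le> r b v \<and> r b v < 1}"
  have "finite P"
  proof (rule finite_discrete_bounded[of _ s])
    show "P \<subseteq> W" using L(1) by (auto simp: P_def)
    show "x = y" if "x \<in> P" "y \<in> P" "norm (x - y) < s" for x y
      using s(2)[of "x - y"] L(3) that by (auto simp: P_def)
    show "norm x \<le> (\<Sum>b\<in>M. norm b)" if "x \<in> P" for x
    proof -
      have "norm x = norm (\<Sum>b\<in>M. r b x *\<^sub>R b)" using that unfolding P_def by (intro arg_cong[of _ _ norm] L_expand) simp
      also have "\<dots> \<le> (\<Sum>b\<in>M. norm b)"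
        using that by (intro sum_norm_le) (auto simp: P_def intro!: mult_left_le_one_le)
      finally show ?thesis .
    qed
  qed (rule s(1))
  \<comment> \<open>Every multiple \<open>j - i\<close> found by the pigeonhole principle is at most \<open>card P\<close> and divides \<open>Q\<close>.\<close>
  define Q where "Q = (fact (card P) :: nat)"
  have rat: "of_nat Q * r b v \<in> \<int>" if v: "v \<in> L" and "b \<in> M" for v b
  proof -
    \<comment> \<open>The \<open>j\<close>-th multiple of \<open>v\<close>, reduced modulo the integer combinations of \<open>M\<close>.\<close>
    define f where "f j = of_int (int j) *\<^sub>R v - (\<Sum>b\<in>M. of_int \<lfloor>of_nat j * r b v\<rfloor> *\<^sub>R b)" for j
    have fL: "f j \<in> L" for j
      unfolding f_def
      by (rule L(3)[OF int_combination_mem(2)[OF L(2,3) v] int_combination_mem(3)[OF L(2,3) finM M(1)]])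
    have rf: "r c (f j) = of_nat j * r c v - of_int \<lfloor>of_nat j * r c v\<rfloor>" if "c \<in> M" for c j
    proof -
      have "(\<Sum>b\<in>M. of_int \<lfloor>of_nat j * r b v\<rfloor> *\<^sub>R b) \<in> W"
        by (rule subsetD[OF L(1) int_combination_mem(3)[OF L(2,3) finM M(1)]])
      moreover have "v \<in> W" using v L(1) by blast
      ultimately show ?thesis
        unfolding f_def using that
        by (simp add: r_diff r_scale r_sum subspace_scale subspace_W)
    qed
    have "f j \<in> P" for j
      unfolding P_def using fL rf by (auto simp: of_int_floor_le) linarith
    then have "\<not> inj_on f {0..card P}"
      using card_inj_on_le[of f "{0..card P}" P] \<open>finite P\<close> by auto
    then obtain i j where ij: "i < j" "j \<le> card P" "f i = f j"
      unfolding inj_on_def by (metis atLeastAtMost_iff linorder_neqE_nat)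
    have "of_nat (j - i) * r b v = of_int (\<lfloor>of_nat j * r b v\<rfloor> - \<lfloor>of_nat i * r b v\<rfloor>)"
      using rf[OF \<open>b \<in> M\<close>, of i] rf[OF \<open>b \<in> M\<close>, of j] ij by (simp add: of_nat_diff algebra_simps)
    then have int: "of_nat (j - i) * r b v \<in> \<int>" by (metis Ints_of_int)
    have "(j - i) dvd Q" unfolding Q_def using ij by (intro dvd_fact) auto
    then obtain l where "Q = l * (j - i)" by (metis dvdE mult.commute)
    then have "of_nat Q * r b v = of_nat l * (of_nat (j - i) * r b v)" by simp
    then show ?thesis using int by (metis Ints_mult Ints_of_nat)
  qed
  have "Q > 0" unfolding Q_def by simp
  \<comment> \<open>Below \<open>\<epsilon> / (2 \<pi>)\<close> an angle stays within \<open>\<epsilon>\<close> of 1; below \<open>1/2\<close> the only integer is 0.\<close>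
  define \<delta> where "\<delta> = min (\<epsilon> / (2 * pi)) (1/2) / (of_nat Q * K0)"
  have QK: "of_nat Q * K0 > 0" using \<open>Q > 0\<close> \<open>K0 > 0\<close> by simp
  then have \<delta>: "of_nat Q * K0 * \<delta> = min (\<epsilon> / (2 * pi)) (1/2)"
    unfolding \<delta>_def by (metis less_numeral_extra(3) nonzero_mult_div_cancel_left times_divide_eq_right)
  have "\<delta> > 0" unfolding \<delta>_def using QK n(3) by simp
  moreover have "x = 0" if x: "x \<in> W" "norm x < \<delta>"
    and y: "\<And>k. \<exists>y\<in>W. norm y < \<delta> \<and> of_nat (n k) *\<^sub>R x - y \<in> L" for x
  proof -
    obtain y where y: "\<And>k. y k \<in> W" "\<And>k. norm (y k) < \<delta>" "\<And>k. of_nat (n k) *\<^sub>R x - y k \<in> L"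
      using y by metis
    have nr: "of_nat (n k) * r b x = r b (of_nat (n k) *\<^sub>R x - y k) + r b (y k)" for k b
      using x(1) y(1)[of k] by (simp add: r_diff r_scale subspace_scale subspace_W)
    have small: "\<bar>of_nat Q * r b z\<bar> \<le> min (\<epsilon> / (2 * pi)) (1/2)"
      if "z \<in> W" "norm z < \<delta>" "b \<in> E" for z b
    proof -
      have "\<bar>of_nat Q * r b z\<bar> \<le> of_nat Q * (K0 * norm z)"
        using K0[OF that(1,3)] by (simp add: abs_mult mult_left_mono)
      also have "\<dots> \<le> of_nat Q * (K0 * \<delta>)"
        using that(2) \<open>K0 > 0\<close> by (intro mult_left_mono) auto
      finally show ?thesis using \<delta> by (simp add: mult.assoc)
    qed
    have "r b x = 0" if "b \<in> E" for b
    proof (cases "b \<in> M")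
      case True
      define \<theta> where "\<theta> = of_nat Q * r b x"
      define z where "z = cis (2 * pi * \<theta>)"
      have "cmod (z ^ n k - 1) \<le> \<epsilon>" for k
      proof -
        obtain j where j: "of_nat Q * r b (of_nat (n k) *\<^sub>R x - y k) = of_int j"
          using rat[OF y(3) True] Ints_cases by metis
        have "of_nat (n k) * \<theta> = of_int j + of_nat Q * r b (y k)"
          unfolding \<theta>_def using nr[of k b] j by (simp add: algebra_simps)
        then have "\<bar>of_nat (n k) * \<theta> - of_int j\<bar> \<le> \<epsilon> / (2 * pi)"
          using small[OF y(1,2) that, of k] by simp
        from cis_2pi_close[OF this] show ?thesis
          unfolding z_def Complex.DeMoivre by (simp add: mult_ac)
      qed
      then have "z = 1" using n(2) unfolding circle_separated_def z_def by simp
      then have "cos (2 * pi * \<theta>) = 1" unfolding z_def by (metis cis.sel(1) one_complex.sel(1))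
      then obtain j :: int where "2 * pi * \<theta> = of_int j * 2 * pi" using cos_one_2pi_int by blast
      then have "\<theta> = of_int j" by simp
      moreover have "\<bar>\<theta>\<bar> \<le> 1/2" using small[OF x that] by (simp add: \<theta>_def)
      ultimately have "\<theta> = 0" by simp
      then show ?thesis using \<open>Q > 0\<close> by (simp add: \<theta>_def)
    next
      case False
      have "of_nat k * \<bar>r b x\<bar> \<le> K0 * \<delta>" for k :: nat
      proof -
        have "of_nat k * \<bar>r b x\<bar> \<le> of_nat (n k) * \<bar>r b x\<bar>"
          using strict_mono_imp_increasing[OF n(1), of k] by (intro mult_right_mono) auto
        also have "\<dots> = \<bar>r b (y k)\<bar>" using nr[of k b] r_L[OF y(3) False]
          by (metis abs_mult abs_of_nat add_0)
        also have "\<dots> \<le> K0 * norm (y k)" by (rule K0[OF y(1) that])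
        also have "\<dots> \<le> K0 * \<delta>" using y(2)[of k] \<open>K0 > 0\<close> by (intro mult_left_mono) auto
        finally show ?thesis .
      qed
      then have "\<not> 0 < \<bar>r b x\<bar>" using reals_Archimedean3 by (meson not_le)
      then show ?thesis by simp
    qed
    then show "x = 0" using r_expand[OF x(1)] by simp
  qed
  ultimately show ?thesis by blast
qed

end

section \<open>Groups with a chart that is additive up to a bilinear error\<close>

text \<open>This is all that is used of a Lie group. The chart \<open>\<phi>\<close> maps the
  neighbourhood \<open>V\<close> of the unit into the finite-dimensional space
  \<open>W\<close> and covers a ball, and near the unit the product is the sum up to an error
  bounded by the product of the norms. A twice differentiable product has this property with
  some constant in front of the product of norms; rescaling the chart makes the constant 1.
  The radius is at most \<open>1/100\<close> so that error terms can be absorbed, and the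
  radii \<open>r/32\<close>, \<open>r/64\<close>, ... below only leave room for products and
  inverses.\<close>

locale chart_group = group G + coord_subspace W I co bv
  for G :: "('a, 'm) monoid_scheme" (structure) and W :: "'v::banach set"
    and I :: "'i set" and co bv +
  fixes V :: "'a set" and \<phi> :: "'a \<Rightarrow> 'v" and r :: real
  assumes V_carrier: "V \<subseteq> carrier G"
    and inj: "inj_on \<phi> V"
    and \<phi>_W: "\<And>x. x \<in> V \<Longrightarrow> \<phi> x \<in> W"
    and onto: "\<And>w. w \<in> W \<Longrightarrow> norm w < r \<Longrightarrow> \<exists>x\<in>V. \<phi> x = w"
    and one_V: "\<one> \<in> V" and \<phi>_one: "\<phi> \<one> = 0"
    and r: "0 < r" "r \<le> 1/100"
    and chart_mult: "\<And>x y. x \<in> V \<Longrightarrow> y \<in> V \<Longrightarrow> norm (\<phi> x) < r \<Longrightarrow> norm (\<phi> y) < r \<Longrightarrow>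
      x \<otimes> y \<in> V \<and> norm (\<phi> (x \<otimes> y) - \<phi> x - \<phi> y) \<le> norm (\<phi> x) * norm (\<phi> y)"
    and chart_inv: "\<And>x. x \<in> V \<Longrightarrow> norm (\<phi> x) < r \<Longrightarrow>
      inv x \<in> V \<and> norm (\<phi> (inv x)) \<le> 2 * norm (\<phi> x)"
begin

abbreviation N :: "'a \<Rightarrow> real" where "N x \<equiv> norm (\<phi> x)"

definition B :: "real \<Rightarrow> 'a set" where "B \<rho> = {x \<in> V. N x < \<rho>}"

lemma B_mono: "x \<in> B \<rho> \<Longrightarrow> \<rho> \<le> \<sigma> \<Longrightarrow> x \<in> B \<sigma>"
  by (auto simp: B_def)

lemma B_V: "x \<in> B \<rho> \<Longrightarrow> x \<in> V" and B_N: "x \<in> B \<rho> \<Longrightarrow> N x < \<rho>"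
  and B_carrier: "x \<in> B \<rho> \<Longrightarrow> x \<in> carrier G"
  using V_carrier by (auto simp: B_def)

lemma B_I: "x \<in> V \<Longrightarrow> N x < \<rho> \<Longrightarrow> x \<in> B \<rho>" by (simp add: B_def)

lemma B_one: "0 < \<rho> \<Longrightarrow> \<one> \<in> B \<rho>" by (simp add: B_def one_V \<phi>_one)

lemma small: "x \<in> B r \<Longrightarrow> N x \<le> 1/100" using B_N[of x r] r by linarith

lemma mult_V: "x \<in> B r \<Longrightarrow> y \<in> B r \<Longrightarrow> x \<otimes> y \<in> V"
  and mult_approx: "x \<in> B r \<Longrightarrow> y \<in> B r \<Longrightarrow> norm (\<phi> (x \<otimes> y) - \<phi> x - \<phi> y) \<le> N x * N y"
  using chart_mult[of x y] by (auto simp: B_def)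

lemma inv_V: "x \<in> B r \<Longrightarrow> inv x \<in> V" and inv_N: "x \<in> B r \<Longrightarrow> N (inv x) \<le> 2 * N x"
  using chart_inv[of x] by (auto simp: B_def)

lemma mult_N:
  assumes "x \<in> B r" "y \<in> B r" shows "N (x \<otimes> y) \<le> 101/100 * (N x + N y)"
proof -
  have "\<phi> (x \<otimes> y) = (\<phi> (x \<otimes> y) - \<phi> x - \<phi> y) + (\<phi> x + \<phi> y)" by simp
  then have "N (x \<otimes> y) \<le> norm (\<phi> (x \<otimes> y) - \<phi> x - \<phi> y) + norm (\<phi> x + \<phi> y)"
    by (metis norm_triangle_ineq)
  moreover have "norm (\<phi> x + \<phi> y) \<le> N x + N y" by (rule norm_triangle_ineq)
  moreover have "N x * N y \<le> 1/100 * N y"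
    by (intro mult_right_mono small assms) simp
  ultimately show ?thesis using mult_approx[OF assms] norm_ge_zero[of "\<phi> x"] by argo
qed

lemma mult_B:
  assumes "x \<in> B \<rho>" "y \<in> B \<sigma>" "\<rho> \<le> r" "\<sigma> \<le> r" "101/100 * (\<rho> + \<sigma>) \<le> \<tau>"
  shows "x \<otimes> y \<in> B \<tau>"
proof (rule B_I)
  have x: "x \<in> B r" and y: "y \<in> B r" using assms B_mono by blast+
  show "x \<otimes> y \<in> V" by (rule mult_V[OF x y])
  show "N (x \<otimes> y) < \<tau>"
    using mult_N[OF x y] B_N[OF assms(1)] B_N[OF assms(2)] assms(5) by argo
qed

lemma inv_B: "x \<in> B \<rho> \<Longrightarrow> \<rho> \<le> r \<Longrightarrow> inv x \<in> B (2 * \<rho>)"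
  using inv_V[of x] inv_N[of x] B_N[of x \<rho>] B_mono[of x \<rho> r] by (auto intro!: B_I)

text \<open>If \<open>w\<close> is the quotient of two elements, the estimate for \<open>y = z w\<close>
  says that \<open>\<phi> w\<close> is \<open>\<phi> y - \<phi> z\<close> up to a small
  relative error. So the estimate for products controls differences in the chart.\<close>

lemma quotient:
  assumes y: "y \<in> B (r/8)" and z: "z \<in> B (r/8)"
  shows left_quotient_B: "inv z \<otimes> y \<in> B r"
    and left_quotient_N: "N (inv z \<otimes> y) \<le> 2 * norm (\<phi> y - \<phi> z)"
    and left_quotient_approx: "norm (\<phi> y - \<phi> z - \<phi> (inv z \<otimes> y)) \<le> N z * N (inv z \<otimes> y)"
    and right_quotient_B: "y \<otimes> inv z \<in> B r"
    and right_quotient_N: "N (y \<otimes> inv z) \<le> 2 * norm (\<phi> y - \<phi> z)"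
    and right_quotient_approx: "norm (\<phi> y - \<phi> z - \<phi> (y \<otimes> inv z)) \<le> N z * N (y \<otimes> inv z)"
proof -
  have yr: "y \<in> B r" and zr: "z \<in> B r" using y z B_mono r(1) by (auto simp: field_simps)
  have yc: "y \<in> carrier G" and zc: "z \<in> carrier G" using y z B_carrier by auto
  have iz: "inv z \<in> B (2 * (r/8))" by (rule inv_B[OF z]) (use r in simp)
  show l: "inv z \<otimes> y \<in> B r" by (rule mult_B[OF iz y]) (use r(1) in simp_all)
  show r': "y \<otimes> inv z \<in> B r" by (rule mult_B[OF y iz]) (use r(1) in simp_all)
  have "z \<otimes> (inv z \<otimes> y) = y" using yc zc by (simp flip: m_assoc)
  then show la: "norm (\<phi> y - \<phi> z - \<phi> (inv z \<otimes> y)) \<le> N z * N (inv z \<otimes> y)"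
    using mult_approx[OF zr l] by simp
  have "(y \<otimes> inv z) \<otimes> z = y" using yc zc by (simp add: m_assoc)
  then show ra: "norm (\<phi> y - \<phi> z - \<phi> (y \<otimes> inv z)) \<le> N z * N (y \<otimes> inv z)"
    using mult_approx[OF r' zr] by (simp add: algebra_simps)
  have *: "norm w \<le> 2 * norm (\<phi> y - \<phi> z)" if "norm (\<phi> y - \<phi> z - w) \<le> N z * norm w" for w
  proof -
    have "norm w \<le> norm (\<phi> y - \<phi> z) + norm (\<phi> y - \<phi> z - w)"
      using norm_triangle_ineq4[of "\<phi> y - \<phi> z" "\<phi> y - \<phi> z - w"] by simp
    moreover have "N z * norm w \<le> 1/100 * norm w"
      by (intro mult_right_mono small zr) simp
    ultimately show ?thesis using that norm_ge_zero[of w] by argo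
  qed
  show "N (inv z \<otimes> y) \<le> 2 * norm (\<phi> y - \<phi> z)" by (rule *[OF la])
  show "N (y \<otimes> inv z) \<le> 2 * norm (\<phi> y - \<phi> z)" by (rule *[OF ra])
qed

text \<open>Write \<open>y = z w\<close>, so that \<open>x y = (x z) w\<close>. Both \<open>\<phi> y -
  \<phi> z\<close> and \<open>\<phi> (x y) - \<phi> (x z)\<close> are close to \<open>\<phi>
  w\<close>. Thus translations are Lipschitz close to the identity in the chart, which
  replaces the derivative of the product.\<close>

lemma translation:
  assumes x: "x \<in> B (r/32)" and y: "y \<in> B (r/32)" and z: "z \<in> B (r/32)"
  shows left_translation:
      "norm ((\<phi> (x \<otimes> y) - \<phi> (x \<otimes> z)) - (\<phi> y - \<phi> z)) \<le> 6 * (N x + N z) * norm (\<phi> y - \<phi> z)"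
    and right_translation:
      "norm ((\<phi> (y \<otimes> x) - \<phi> (z \<otimes> x)) - (\<phi> y - \<phi> z)) \<le> 6 * (N x + N z) * norm (\<phi> y - \<phi> z)"
proof -
  have xr: "x \<in> B r" and yr: "y \<in> B r" and zr: "z \<in> B r"
    and y8: "y \<in> B (r/8)" and z8: "z \<in> B (r/8)"
    using x y z B_mono r(1) by (auto simp: field_simps)
  have c: "x \<in> carrier G" "y \<in> carrier G" "z \<in> carrier G" using x y z B_carrier by auto
  have xz: "x \<otimes> z \<in> B r" and zx: "z \<otimes> x \<in> B r"
    by (rule mult_B[OF x z] mult_B[OF z x]; use r(1) in simp)+
  define D where "D = norm (\<phi> y - \<phi> z)"
  have est: "norm (p - q - (\<phi> y - \<phi> z)) \<le> 6 * (N x + N z) * D"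
    if p: "norm (p - q - w) \<le> norm q * norm w" and q: "norm q \<le> 101/100 * (N x + N z)"
      and w: "norm w \<le> 2 * D" "norm (\<phi> y - \<phi> z - w) \<le> N z * norm w" for p q w
  proof -
    have "p - q - (\<phi> y - \<phi> z) = (p - q - w) - (\<phi> y - \<phi> z - w)" by simp
    then have "norm (p - q - (\<phi> y - \<phi> z)) \<le> norm (p - q - w) + norm (\<phi> y - \<phi> z - w)"
      by (metis norm_triangle_ineq4)
    also have "\<dots> \<le> (norm q + N z) * norm w" using p w(2) by (simp add: distrib_right)
    also have "\<dots> \<le> (3 * (N x + N z)) * (2 * D)"
      by (intro mult_mono w) (use q in \<open>auto simp: add_nonneg_nonneg\<close>, smt (verit) norm_ge_zero)
    also have "\<dots> = 6 * (N x + N z) * D" by simp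
    finally show ?thesis .
  qed
  have "(x \<otimes> z) \<otimes> (inv z \<otimes> y) = x \<otimes> y"
    using c by (simp add: m_assoc) (simp flip: m_assoc)
  then show "norm ((\<phi> (x \<otimes> y) - \<phi> (x \<otimes> z)) - (\<phi> y - \<phi> z)) \<le> 6 * (N x + N z) * norm (\<phi> y - \<phi> z)"
    using mult_approx[OF xz left_quotient_B[OF y8 z8]] mult_N[OF xr zr]
      left_quotient_N[OF y8 z8] left_quotient_approx[OF y8 z8]
    unfolding D_def[symmetric]
    by (intro est[of _ _ "\<phi> (inv z \<otimes> y)"]) simp_all
  have "(y \<otimes> inv z) \<otimes> (z \<otimes> x) = y \<otimes> x"
    using c by (simp add: m_assoc) (simp flip: m_assoc)
  then show "norm ((\<phi> (y \<otimes> x) - \<phi> (z \<otimes> x)) - (\<phi> y - \<phi> z)) \<le> 6 * (N x + N z) * norm (\<phi> y - \<phi> z)"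
    using mult_approx[OF right_quotient_B[OF y8 z8] zx] mult_N[OF zr xr]
      right_quotient_N[OF y8 z8] right_quotient_approx[OF y8 z8]
    unfolding D_def[symmetric]
    by (intro est[of _ _ "\<phi> (y \<otimes> inv z)"]) (simp_all add: algebra_simps)
qed

text \<open>Squaring is Lipschitz close to doubling; this makes it injective and surjective near the unit.\<close>

lemma square_diff:
  assumes x: "x \<in> B (r/32)" and y: "y \<in> B (r/32)"
  shows "norm ((\<phi> (x \<otimes> x) - \<phi> (y \<otimes> y)) - 2 *\<^sub>R (\<phi> x - \<phi> y)) \<le> 18 * (N x + N y) * norm (\<phi> x - \<phi> y)"
proof -
  define p where "p = (\<phi> (x \<otimes> x) - \<phi> (x \<otimes> y)) - (\<phi> x - \<phi> y)"
  define q where "q = (\<phi> (x \<otimes> y) - \<phi> (y \<otimes> y)) - (\<phi> x - \<phi> y)"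
  define D where "D = norm (\<phi> x - \<phi> y)"
  have p: "norm p \<le> 6 * (N x + N y) * D" and q: "norm q \<le> 6 * (N y + N y) * D"
    unfolding p_def q_def D_def
    by (rule left_translation[OF x x y] right_translation[OF y x y])+
  have "(\<phi> (x \<otimes> x) - \<phi> (y \<otimes> y)) - 2 *\<^sub>R (\<phi> x - \<phi> y) = p + q"
    by (simp add: p_def q_def scaleR_2)
  then have "norm ((\<phi> (x \<otimes> x) - \<phi> (y \<otimes> y)) - 2 *\<^sub>R (\<phi> x - \<phi> y)) \<le> norm p + norm q"
    by (metis norm_triangle_ineq)
  also have "\<dots> \<le> 6 * (N x + N y) * D + 6 * (N y + N y) * D" using p q by (rule add_mono)
  also have "\<dots> = (6 * N x + 18 * N y) * D" by (simp add: algebra_simps)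
  also have "\<dots> \<le> (18 * (N x + N y)) * D"
    by (intro mult_right_mono) (auto simp: D_def)
  finally show ?thesis by (simp add: D_def)
qed

lemma square_diff_small:
  assumes x: "x \<in> B (r/32)" and y: "y \<in> B (r/32)"
  shows "norm ((\<phi> (x \<otimes> x) - \<phi> (y \<otimes> y)) - 2 *\<^sub>R (\<phi> x - \<phi> y)) \<le> norm (\<phi> x - \<phi> y)"
proof -
  have "18 * (N x + N y) * norm (\<phi> x - \<phi> y) \<le> 1 * norm (\<phi> x - \<phi> y)"
    using B_N[OF x] B_N[OF y] r by (intro mult_right_mono) auto
  then show ?thesis using square_diff[OF x y] by linarith
qed

lemma square_inj:
  assumes x: "x \<in> B (r/32)" and y: "y \<in> B (r/32)" and "x \<otimes> x = y \<otimes> y"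
  shows "x = y"
proof -
  have "2 * norm (\<phi> x - \<phi> y) \<le> norm (\<phi> x - \<phi> y)"
    using square_diff_small[OF x y] assms(3) by simp
  then have "\<phi> x = \<phi> y" by simp
  then show ?thesis using inj B_V[OF x] B_V[OF y] by (simp add: inj_on_def)
qed

text \<open>The chart value of a square root of \<open>h\<close> is a fixed point of \<open>u \<mapsto> u
  + (\<phi> h - \<phi> (\<psi> u \<psi> u)) / 2\<close>, where \<open>\<psi>\<close> inverts
  the chart. By the comparison of squaring with doubling this map is a contraction of a closed
  ball in \<open>W\<close>.\<close>

lemma sqrt_exists:
  assumes h: "h \<in> B (r/64)"
  shows "\<exists>x. x \<in> B (r/32) \<and> x \<otimes> x = h \<and> N x \<le> 6/10 * N h"
proof -
  define \<psi> where "\<psi> w = (SOME x. x \<in> V \<and> \<phi> x = w)" for w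
  define S where "S = W \<inter> cball 0 (r/40)"
  have \<psi>: "\<psi> w \<in> B (r/32)" "\<phi> (\<psi> w) = w" "norm w \<le> r/40" if "w \<in> S" for w
  proof -
    have w: "w \<in> W" "norm w \<le> r/40" using that by (auto simp: S_def)
    then have "\<exists>x. x \<in> V \<and> \<phi> x = w" using onto[of w] r by auto
    then have "\<psi> w \<in> V \<and> \<phi> (\<psi> w) = w" unfolding \<psi>_def by (rule someI_ex)
    then show "\<psi> w \<in> B (r/32)" "\<phi> (\<psi> w) = w" "norm w \<le> r/40" using w r by (auto simp: B_def)
  qed
  define F where "F u = u + (1/2) *\<^sub>R (\<phi> h - \<phi> (\<psi> u \<otimes> \<psi> u))" for u
  have "\<exists>!u. u \<in> S \<and> F u = u"
  proof (rule Banach_fix[of _ "1/2"])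
    show "complete S" unfolding S_def
      unfolding complete_eq_closed by (intro closed_Int closed_W closed_cball)
    have "0 \<in> S" using r subspace_0[OF subspace_W] by (simp add: S_def)
    then show "S \<noteq> {}" by blast
    show "F ` S \<subseteq> S"
    proof
      fix v assume "v \<in> F ` S"
      then obtain u where u: "u \<in> S" "v = F u" by blast
      have \<psi>r: "\<psi> u \<in> B r" using \<psi>(1)[OF u(1)] by (rule B_mono) (use r in simp)
      have "u \<in> W" using u by (simp add: S_def)
      then have "F u \<in> W" unfolding F_def
        by (intro subspace_add[OF subspace_W] subspace_scale[OF subspace_W] subspace_diff[OF subspace_W]
            \<phi>_W mult_V \<psi>r B_V[OF h])
      moreover have "norm (F u) \<le> r/40"
      proof -
        have "F u = (1/2) *\<^sub>R (\<phi> h - (\<phi> (\<psi> u \<otimes> \<psi> u) - u - u))"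
          unfolding F_def by (simp add: algebra_simps flip: scaleR_2)
        then have "norm (F u) = 1/2 * norm (\<phi> h - (\<phi> (\<psi> u \<otimes> \<psi> u) - u - u))" by simp
        moreover have "norm (\<phi> h - (\<phi> (\<psi> u \<otimes> \<psi> u) - u - u)) \<le> N h + norm (\<phi> (\<psi> u \<otimes> \<psi> u) - u - u)"
          by (rule norm_triangle_ineq4)
        moreover have "norm (\<phi> (\<psi> u \<otimes> \<psi> u) - u - u) \<le> norm u * norm u"
          using mult_approx[OF \<psi>r \<psi>r] \<psi>(2)[OF u(1)] by simp
        moreover have "norm u * norm u \<le> 1/100 * (r/40)"
          using \<psi>(3)[OF u(1)] r by (intro mult_mono) auto
        ultimately show ?thesis using B_N[OF h] r by argo
      qed
      ultimately show "v \<in> S" using u by (simp add: S_def)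
    qed
    show "dist (F u) (F v) \<le> 1/2 * dist u v" if u: "u \<in> S" and v: "v \<in> S" for u v
    proof -
      have "F u - F v = - ((1/2) *\<^sub>R ((\<phi> (\<psi> u \<otimes> \<psi> u) - \<phi> (\<psi> v \<otimes> \<psi> v)) - 2 *\<^sub>R (u - v)))"
        unfolding F_def by (simp add: algebra_simps)
      then have "norm (F u - F v) = 1/2 * norm ((\<phi> (\<psi> u \<otimes> \<psi> u) - \<phi> (\<psi> v \<otimes> \<psi> v)) - 2 *\<^sub>R (u - v))"
        by simp
      also have "\<dots> \<le> 1/2 * norm (u - v)"
        using square_diff_small[OF \<psi>(1)[OF u] \<psi>(1)[OF v]] \<psi>(2)[OF u] \<psi>(2)[OF v] by simp
      finally show ?thesis by (simp add: dist_norm)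
    qed
  qed simp_all
  then obtain u where u: "u \<in> S" "F u = u" by blast
  define x where "x = \<psi> u"
  have x: "x \<in> B (r/32)" "\<phi> x = u" using \<psi>[OF u(1)] by (auto simp: x_def)
  have xr: "x \<in> B r" using x(1) by (rule B_mono) (use r in simp)
  have "\<phi> (x \<otimes> x) = \<phi> h" using u(2) by (simp add: F_def x_def)
  then have sq: "x \<otimes> x = h" using inj mult_V[OF xr xr] B_V[OF h] by (simp add: inj_on_def)
  have "2 *\<^sub>R \<phi> x = \<phi> h - (\<phi> (x \<otimes> x) - \<phi> x - \<phi> x)" by (simp add: sq scaleR_2)
  then have "2 * N x \<le> N h + norm (\<phi> (x \<otimes> x) - \<phi> x - \<phi> x)"
    by (metis norm_triangle_ineq4 norm_scaleR abs_numeral)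
  moreover have "N x * N x \<le> 1/100 * N x" by (intro mult_right_mono small xr) simp
  ultimately have "N x \<le> 6/10 * N h" using mult_approx[OF xr xr] norm_ge_zero[of "\<phi> h"] by argo
  then show ?thesis using x sq by blast
qed

section \<open>Square roots and the logarithm\<close>

definition sqroot :: "'a \<Rightarrow> 'a" where
  "sqroot h = (SOME x. x \<in> B (r/32) \<and> x \<otimes> x = h \<and> N x \<le> 6/10 * N h)"

lemma sqroot:
  assumes h: "h \<in> B \<rho>" and \<rho>: "\<rho> \<le> r/64"
  shows sqroot_square: "sqroot h \<otimes> sqroot h = h" and sqroot_N: "N (sqroot h) \<le> 6/10 * N h" and sqroot_B: "sqroot h \<in> B \<rho>"
proof -
  have "sqroot h \<in> B (r/32) \<and> sqroot h \<otimes> sqroot h = h \<and> N (sqroot h) \<le> 6/10 * N h"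
    unfolding sqroot_def using someI_ex[OF sqrt_exists[OF B_mono[OF h \<rho>]]] .
  then show "sqroot h \<otimes> sqroot h = h" and N: "N (sqroot h) \<le> 6/10 * N h" and "sqroot h \<in> B \<rho>"
    using B_N[OF h] norm_ge_zero[of "\<phi> h"] by (blast, blast, intro B_I) (blast dest: B_V, argo)
qed

lemma sqroot_eqI:
  assumes h: "h \<in> B (r/64)" and x: "x \<in> B (r/32)" "x \<otimes> x = h"
  shows "sqroot h = x"
proof (rule square_inj[OF _ x(1)])
  show "sqroot h \<in> B (r/32)" using sqroot_B[OF h] by (rule B_mono) (use r in simp_all)
  show "sqroot h \<otimes> sqroot h = x \<otimes> x" using sqroot_square[OF h] x(2) by simp
qed

lemma roots_B: "h \<in> B \<rho> \<Longrightarrow> \<rho> \<le> r/64 \<Longrightarrow> (sqroot ^^ j) h \<in> B \<rho>"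
  by (induction j) (auto intro: sqroot_B)

lemma roots_N:
  assumes "h \<in> B (r/64)" shows "N ((sqroot ^^ j) h) \<le> (6/10) ^ j * N h"
proof (induction j)
  case (Suc j)
  have "N ((sqroot ^^ Suc j) h) \<le> 6/10 * N ((sqroot ^^ j) h)"
    using sqroot_N[OF roots_B[OF assms]] by simp
  then show ?case using Suc by simp
qed simp

lemma roots_square: "h \<in> B (r/64) \<Longrightarrow> (sqroot ^^ Suc j) h \<otimes> (sqroot ^^ Suc j) h = (sqroot ^^ j) h"
  using sqroot_square[OF roots_B] by simp

lemma roots_pow:
  assumes h: "h \<in> B (r/64)" shows "(sqroot ^^ j) h [^] (2 ^ j :: nat) = h"
proof (induction j)
  case (Suc j)
  have c: "(sqroot ^^ Suc j) h \<in> carrier G" using roots_B[OF h] B_carrier by blast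
  have "(sqroot ^^ Suc j) h [^] (2 ^ Suc j :: nat) = ((sqroot ^^ Suc j) h [^] (2 :: nat)) [^] (2 ^ j :: nat)"
    using c by (simp add: nat_pow_pow del: funpow.simps)
  also have "(sqroot ^^ Suc j) h [^] (2 :: nat) = (sqroot ^^ j) h"
    using roots_square[OF h, of j] c by (simp add: numeral_2_eq_2 del: funpow.simps)
  finally show ?case using Suc by simp
qed (use B_carrier[OF h] in simp)

text \<open>If \<open>h = exp v\<close> in a Lie group, the iterated square roots of \<open>h\<close> are
  \<open>exp (v / 2 ^ j)\<close>, with chart values \<open>v / 2 ^ j\<close> up to quadratic
  terms. So this limit is \<open>v\<close>.\<close>

definition chart_log :: "'a \<Rightarrow> 'v" where "chart_log h = lim (\<lambda>j. 2 ^ j *\<^sub>R \<phi> ((sqroot ^^ j) h))"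

text \<open>One square root changes \<open>2 ^ j \<phi>\<close> by at most \<open>2 ^ j\<close> times the
  square of the norm of the root. The roots shrink at least like \<open>0.6 ^ j\<close>, and
  \<open>2 * 0.6 ^ 2 = 0.72 < 1\<close>.\<close>

lemma chart_log_tendsto_approx:
  assumes h: "h \<in> B (r/64)"
  shows chart_log_tendsto: "(\<lambda>j. 2 ^ j *\<^sub>R \<phi> ((sqroot ^^ j) h)) \<longlonglongrightarrow> chart_log h"
    and chart_log_approx: "norm (chart_log h - \<phi> h) \<le> 2 * N h * N h"
proof -
  define X where "X j = 2 ^ j *\<^sub>R \<phi> ((sqroot ^^ j) h)" for j
  have "norm (X (Suc j) - X j) \<le> (36/100 * (N h * N h)) * (72/100) ^ j" for j
  proof -
    define x where "x = (sqroot ^^ Suc j) h"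
    have xr: "x \<in> B r" unfolding x_def using roots_B[OF h] by (rule B_mono) (use r in simp_all)
    have xx: "x \<otimes> x = (sqroot ^^ j) h" unfolding x_def by (rule roots_square[OF h])
    have "X (Suc j) - X j = - (2 ^ j *\<^sub>R (\<phi> (x \<otimes> x) - \<phi> x - \<phi> x))"
      unfolding X_def xx x_def[symmetric] by (simp add: algebra_simps flip: scaleR_2)
    then have "norm (X (Suc j) - X j) = 2 ^ j * norm (\<phi> (x \<otimes> x) - \<phi> x - \<phi> x)" by simp
    also have "\<dots> \<le> 2 ^ j * (N x * N x)"
      by (intro mult_left_mono mult_approx xr) simp
    also have "\<dots> \<le> 2 ^ j * (((6/10) ^ Suc j * N h) * ((6/10) ^ Suc j * N h))"
      unfolding x_def by (intro mult_left_mono mult_mono roots_N[OF h]) auto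
    also have "\<dots> = (36/100 * (N h * N h)) * (2 * (6/10) * (6/10)) ^ j"
      unfolding power_mult_distrib by simp
    finally show ?thesis by simp
  qed
  then obtain l where l: "X \<longlonglongrightarrow> l" "norm (l - X 0) \<le> (36/100 * (N h * N h)) / (1 - 72/100)"
    by (rule geometric_convergent) auto
  have "chart_log h = l" unfolding chart_log_def X_def[symmetric] using l(1) by (rule limI)
  then show "(\<lambda>j. 2 ^ j *\<^sub>R \<phi> ((sqroot ^^ j) h)) \<longlonglongrightarrow> chart_log h"
    using l(1) unfolding X_def[abs_def] by simp
  have "norm (l - X 0) \<le> 9/7 * (N h * N h)" using l(2) by simp
  moreover have "0 \<le> N h * N h" by simp
  ultimately have "norm (l - X 0) \<le> 2 * (N h * N h)" by linarith
  then show "norm (chart_log h - \<phi> h) \<le> 2 * N h * N h" using \<open>chart_log h = l\<close> by (simp add: X_def)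
qed

lemma chart_log_bounds:
  assumes h: "h \<in> B (r/64)" shows chart_log_le: "norm (chart_log h) \<le> 2 * N h" and chart_log_ge: "N h \<le> 2 * norm (chart_log h)"
proof -
  have "N h * N h \<le> 1/100 * N h"
    using B_N[OF h] r by (intro mult_right_mono) auto
  then have a: "norm (chart_log h - \<phi> h) \<le> 1/50 * N h" using chart_log_approx[OF h] by linarith
  show "norm (chart_log h) \<le> 2 * N h"
    using a norm_triangle_ineq2[of "chart_log h" "\<phi> h"] norm_ge_zero[of "\<phi> h"] by argo
  show "N h \<le> 2 * norm (chart_log h)"
    using a norm_triangle_ineq2[of "\<phi> h" "chart_log h"] norm_minus_commute[of "\<phi> h" "chart_log h"] norm_ge_zero[of "\<phi> h"]
    by argo
qed

lemma chart_log_one: "chart_log \<one> = 0"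
  using chart_log_le[OF B_one] r \<phi>_one by simp

lemma chart_log_W: "h \<in> B (r/64) \<Longrightarrow> chart_log h \<in> W"
  by (rule Lim_in_closed_set[OF closed_W _ _ chart_log_tendsto])
    (auto intro!: always_eventually subspace_scale[OF subspace_W] \<phi>_W B_V[OF roots_B])

lemma chart_log_eq_0D: "h \<in> B (r/64) \<Longrightarrow> chart_log h = 0 \<Longrightarrow> h = \<one>"
  using chart_log_ge[of h] inj one_V B_V[of h] \<phi>_one by (simp add: inj_on_def)

lemma chart_log_roots:
  assumes h: "h \<in> B (r/64)" shows "chart_log ((sqroot ^^ m) h) = (1/2) ^ m *\<^sub>R chart_log h"
proof -
  have "(\<lambda>j. 2 ^ (j + m) *\<^sub>R \<phi> ((sqroot ^^ (j + m)) h)) \<longlonglongrightarrow> chart_log h"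
    using chart_log_tendsto[OF h] by (rule LIMSEQ_ignore_initial_segment)
  then have "(\<lambda>j. (1/2) ^ m *\<^sub>R (2 ^ (j + m) *\<^sub>R \<phi> ((sqroot ^^ (j + m)) h))) \<longlonglongrightarrow> (1/2) ^ m *\<^sub>R chart_log h"
    by (intro tendsto_intros)
  moreover have "(1/2) ^ m *\<^sub>R (2 ^ (j + m) *\<^sub>R \<phi> ((sqroot ^^ (j + m)) h)) = 2 ^ j *\<^sub>R \<phi> ((sqroot ^^ j) ((sqroot ^^ m) h))" for j
    by (simp add: power_add funpow_add power_divide)
  ultimately have "(\<lambda>j. 2 ^ j *\<^sub>R \<phi> ((sqroot ^^ j) ((sqroot ^^ m) h))) \<longlonglongrightarrow> (1/2) ^ m *\<^sub>R chart_log h" by simp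
  moreover have "(\<lambda>j. 2 ^ j *\<^sub>R \<phi> ((sqroot ^^ j) ((sqroot ^^ m) h))) \<longlonglongrightarrow> chart_log ((sqroot ^^ m) h)"
    by (rule chart_log_tendsto[OF roots_B[OF h]]) simp
  ultimately show ?thesis using LIMSEQ_unique by blast
qed

text \<open>Passing from two elements to their roots halves the distance in the chart up to a relative
  error that decreases geometrically. The infinite product of these factors converges, so the
  rescaled distance of the roots stays bounded below by a multiple of the distance of the
  elements.\<close>

lemma chart_log_inj:
  assumes x: "x \<in> B (r/64)" and y: "y \<in> B (r/64)" and eq: "chart_log x = chart_log y"
  shows "x = y"
proof -
  define d where "d j = 2 ^ j * norm (\<phi> ((sqroot ^^ j) x) - \<phi> ((sqroot ^^ j) y))" for j
  have d0: "d j \<ge> 0" for j by (simp add: d_def)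
  have step: "d j \<le> (1 + 1/200 * (6/10) ^ j) * d (Suc j)" for j
  proof -
    define a where "a = (sqroot ^^ Suc j) x"
    define b where "b = (sqroot ^^ Suc j) y"
    have ab: "a \<in> B (r/32)" "b \<in> B (r/32)" unfolding a_def b_def
      using roots_B[OF x, of "Suc j"] roots_B[OF y, of "Suc j"] r B_mono[of _ "r/64" "r/32"] by auto
    have sq: "a \<otimes> a = (sqroot ^^ j) x" "b \<otimes> b = (sqroot ^^ j) y" unfolding a_def b_def
      by (rule roots_square[OF x] roots_square[OF y])+
    define e where "e = norm (\<phi> a - \<phi> b)"
    have Na: "N a \<le> (6/10) ^ Suc j * (r/64)" "N b \<le> (6/10) ^ Suc j * (r/64)"
      unfolding a_def b_def
      by (rule order_trans[OF roots_N[OF x]] order_trans[OF roots_N[OF y]];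
          intro mult_left_mono less_imp_le[OF B_N[OF x]] less_imp_le[OF B_N[OF y]]; simp)+
    have r': "(6/10) ^ Suc j * (r/64) \<le> (6/10) ^ Suc j * (1/6400)"
      using r by (intro mult_left_mono) auto
    have q: "0 \<le> (6/10 :: real) ^ j" by simp
    have "N a \<le> (6/10) ^ Suc j * (1/6400)" "N b \<le> (6/10) ^ Suc j * (1/6400)"
      using Na r' by (blast intro: order_trans)+
    then have "18 * (N a + N b) \<le> 18 * (2 * (6/10) ^ Suc j * (1/6400))" by argo
    also have "\<dots> \<le> 1/100 * (6/10) ^ j" using q by simp
    finally have "18 * (N a + N b) \<le> 1/100 * (6/10) ^ j" .
    then have "18 * (N a + N b) * e \<le> 1/100 * (6/10) ^ j * e"
      by (rule mult_right_mono) (simp add: e_def)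
    then have s: "norm ((\<phi> (a \<otimes> a) - \<phi> (b \<otimes> b)) - 2 *\<^sub>R (\<phi> a - \<phi> b)) \<le> 1/100 * (6/10) ^ j * e"
      using square_diff[OF ab] unfolding e_def by (rule order_trans[rotated])
    have "norm (\<phi> (a \<otimes> a) - \<phi> (b \<otimes> b)) \<le>
        norm ((\<phi> (a \<otimes> a) - \<phi> (b \<otimes> b)) - 2 *\<^sub>R (\<phi> a - \<phi> b)) + norm (2 *\<^sub>R (\<phi> a - \<phi> b))"
      by (metis diff_add_cancel norm_triangle_ineq)
    also have "\<dots> \<le> 1/100 * (6/10) ^ j * e + 2 * e" using s by (simp add: e_def)
    finally have "2 ^ j * norm (\<phi> (a \<otimes> a) - \<phi> (b \<otimes> b)) \<le> 2 ^ j * (1/100 * (6/10) ^ j * e + 2 * e)"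
      by (rule mult_left_mono) simp
    also have "\<dots> = (1 + 1/200 * (6/10) ^ j) * (2 ^ Suc j * e)" by (simp add: algebra_simps)
    finally show ?thesis unfolding d_def sq[symmetric] e_def a_def b_def .
  qed
  \<comment> \<open>The factor \<open>2 - 0.6 ^ j\<close> starts at 1, stays below 2, and grows faster than the errors accumulate.\<close>
  have le: "d 0 \<le> (2 - (6/10) ^ j) * d j" for j
  proof (induction j)
    case (Suc j)
    define q :: real where "q = (6/10) ^ j"
    have q: "0 \<le> q" "q \<le> 1" unfolding q_def by (auto intro: power_le_one)
    have "d 0 \<le> (2 - q) * d j" using Suc by (simp add: q_def)
    also have "\<dots> \<le> (2 - q) * ((1 + 1/200 * q) * d (Suc j))"
      using step[of j] q by (intro mult_left_mono) (auto simp: q_def)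
    also have "\<dots> = ((2 - q) * (1 + 1/200 * q)) * d (Suc j)" by simp
    also have "\<dots> \<le> (2 - 6/10 * q) * d (Suc j)"
    proof (intro mult_right_mono d0)
      have "(2 - q) * (1 + c * q) = 2 + (2 * c - 1) * q - c * (q * q)" for c
        by (simp add: algebra_simps)
      from this[of "1/200"] have "(2 - q) * (1 + 1/200 * q) = 2 - 99/100 * q - 1/200 * (q * q)" by simp
      also have "\<dots> \<le> 2 - 6/10 * q" using q mult_nonneg_nonneg[OF q(1) q(1)] by linarith
      finally show "(2 - q) * (1 + 1/200 * q) \<le> 2 - 6/10 * q" .
    qed
    finally show ?case by (simp add: q_def)
  qed simp
  have "d 0 \<le> 2 * d j" for j
  proof -
    have "(2 - (6/10) ^ j) * d j \<le> 2 * d j" by (intro mult_right_mono d0) simp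
    then show ?thesis using le[of j] by linarith
  qed
  moreover have "(\<lambda>j. 2 * d j) \<longlonglongrightarrow> 2 * norm (chart_log x - chart_log y)"
  proof -
    have "d j = norm (2 ^ j *\<^sub>R \<phi> ((sqroot ^^ j) x) - 2 ^ j *\<^sub>R \<phi> ((sqroot ^^ j) y))" for j
      unfolding d_def by (simp flip: scaleR_diff_right)
    then show ?thesis
      using tendsto_mult[OF tendsto_const[of 2] tendsto_norm[OF tendsto_diff[OF chart_log_tendsto[OF x] chart_log_tendsto[OF y]]]]
      by simp
  qed
  ultimately have "d 0 \<le> 2 * norm (chart_log x - chart_log y)" by (intro LIMSEQ_le_const) blast+
  then have "\<phi> x = \<phi> y" using eq by (simp add: d_def)
  then show ?thesis using inj B_V[OF x] B_V[OF y] by (simp add: inj_on_def)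
qed

section \<open>Tangent vectors of sequences\<close>

text \<open>The sequence \<open>x\<close> approaches the unit in the direction \<open>u\<close> at the
  speed \<open>2 ^ - j\<close>. Only the tail of the sequence matters, so statements about
  tangents need no condition on the size of the group elements involved.\<close>

definition tangent :: "(nat \<Rightarrow> 'a) \<Rightarrow> 'v \<Rightarrow> bool" where
  "tangent x u \<longleftrightarrow> (\<forall>\<^sub>F j in sequentially. x j \<in> V) \<and> (\<lambda>j. 2 ^ j *\<^sub>R \<phi> (x j)) \<longlonglongrightarrow> u"

lemma tangent_N: assumes "tangent x u" shows "(\<lambda>j. N (x j)) \<longlonglongrightarrow> 0"
proof -
  have "(\<lambda>j. (1/2) ^ j *\<^sub>R (2 ^ j *\<^sub>R \<phi> (x j))) \<longlonglongrightarrow> 0 *\<^sub>R u"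
    using assms unfolding tangent_def by (intro tendsto_intros LIMSEQ_power_zero) auto
  then have "(\<lambda>j. \<phi> (x j)) \<longlonglongrightarrow> 0" by (simp add: power_divide)
  then show ?thesis by (rule tendsto_norm_zero)
qed

lemma tangent_B: assumes "tangent x u" "\<rho> > 0" shows "\<forall>\<^sub>F j in sequentially. x j \<in> B \<rho>"
proof -
  have "\<forall>\<^sub>F j in sequentially. N (x j) < \<rho>"
    using tangent_N[OF assms(1)] assms(2) by (rule order_tendstoD(2))
  moreover have "\<forall>\<^sub>F j in sequentially. x j \<in> V" using assms by (simp add: tangent_def)
  ultimately show ?thesis by eventually_elim (rule B_I)
qed

lemma tangent_unique: "tangent x u \<Longrightarrow> tangent x v \<Longrightarrow> u = v"
  unfolding tangent_def using LIMSEQ_unique by blast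

lemma tangent_cong:
  assumes "tangent x u" "\<forall>\<^sub>F j in sequentially. x j = y j" shows "tangent y u"
proof -
  have "\<forall>\<^sub>F j in sequentially. x j \<in> V" using assms(1) by (simp add: tangent_def)
  with assms(2) have "\<forall>\<^sub>F j in sequentially. y j \<in> V" by eventually_elim simp
  moreover have "(\<lambda>j. 2 ^ j *\<^sub>R \<phi> (y j)) \<longlonglongrightarrow> u"
  proof (rule Lim_transform_eventually)
    show "(\<lambda>j. 2 ^ j *\<^sub>R \<phi> (x j)) \<longlonglongrightarrow> u" using assms(1) by (simp add: tangent_def)
    show "\<forall>\<^sub>F j in sequentially. 2 ^ j *\<^sub>R \<phi> (x j) = 2 ^ j *\<^sub>R \<phi> (y j)"
      using assms(2) by eventually_elim simp
  qed
  ultimately show ?thesis by (simp add: tangent_def)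
qed

lemma tangent_log: "h \<in> B (r/64) \<Longrightarrow> tangent (\<lambda>j. (sqroot ^^ j) h) (chart_log h)"
  unfolding tangent_def by (auto intro!: always_eventually B_V[OF roots_B] chart_log_tendsto)

lemma tangent_one: "tangent (\<lambda>j. \<one>) 0"
  by (simp add: tangent_def one_V \<phi>_one)

text \<open>The error in the product estimate is quadratic and disappears after multiplication by \<open>2
  ^ j\<close>.\<close>

lemma tangent_mult:
  assumes x: "tangent x u" and y: "tangent y v" shows "tangent (\<lambda>j. x j \<otimes> y j) (u + v)"
proof -
  have ev: "\<forall>\<^sub>F j in sequentially. x j \<in> B r \<and> y j \<in> B r"
    using tangent_B[OF x r(1)] tangent_B[OF y r(1)] by (rule eventually_conj)
  have "(\<lambda>j. 2 ^ j *\<^sub>R (\<phi> (x j \<otimes> y j) - \<phi> (x j) - \<phi> (y j))) \<longlonglongrightarrow> 0"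
  proof (rule Lim_null_comparison)
    show "\<forall>\<^sub>F j in sequentially. norm (2 ^ j *\<^sub>R (\<phi> (x j \<otimes> y j) - \<phi> (x j) - \<phi> (y j)))
        \<le> norm (2 ^ j *\<^sub>R \<phi> (x j)) * N (y j)"
      using ev
    proof eventually_elim
      case (elim j)
      then have "norm (\<phi> (x j \<otimes> y j) - \<phi> (x j) - \<phi> (y j)) \<le> N (x j) * N (y j)"
        by (intro mult_approx) auto
      then show ?case by (simp add: mult.assoc)
    qed
    have "(\<lambda>j. norm (2 ^ j *\<^sub>R \<phi> (x j)) * N (y j)) \<longlonglongrightarrow> norm u * 0"
      using x tangent_N[OF y] unfolding tangent_def by (intro tendsto_intros) auto
    then show "(\<lambda>j. norm (2 ^ j *\<^sub>R \<phi> (x j)) * N (y j)) \<longlonglongrightarrow> 0" by simp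
  qed
  then have "(\<lambda>j. 2 ^ j *\<^sub>R (\<phi> (x j \<otimes> y j) - \<phi> (x j) - \<phi> (y j)) + (2 ^ j *\<^sub>R \<phi> (x j) + 2 ^ j *\<^sub>R \<phi> (y j))) \<longlonglongrightarrow> 0 + (u + v)"
    using x y unfolding tangent_def by (intro tendsto_add) auto
  then have "(\<lambda>j. 2 ^ j *\<^sub>R \<phi> (x j \<otimes> y j)) \<longlonglongrightarrow> u + v" by (simp add: algebra_simps)
  moreover have "\<forall>\<^sub>F j in sequentially. x j \<otimes> y j \<in> V"
    using ev by eventually_elim (blast intro: mult_V)
  ultimately show ?thesis by (simp add: tangent_def)
qed

lemma tangent_pow:
  assumes x: "tangent x u" shows "tangent (\<lambda>j. x j [^] (m::nat)) (of_nat m *\<^sub>R u)"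
proof (induction m)
  case 0
  then show ?case using tangent_one by simp
next
  case (Suc m)
  have "tangent (\<lambda>j. x j [^] m \<otimes> x j) (of_nat m *\<^sub>R u + u)" by (rule tangent_mult[OF Suc x])
  then show ?case by (simp add: scaleR_left_distrib add.commute)
qed

lemma tangent_exists:
  assumes u: "u \<in> W" obtains x where "tangent x u" "\<forall>\<^sub>F j in sequentially. \<phi> (x j) = (1/2) ^ j *\<^sub>R u"
proof -
  define x where "x j = (SOME x. x \<in> V \<and> \<phi> x = (1/2) ^ j *\<^sub>R u)" for j
  have "(\<lambda>j. (1/2) ^ j *\<^sub>R u) \<longlonglongrightarrow> 0 *\<^sub>R u" by (intro tendsto_intros LIMSEQ_power_zero) auto
  then have "(\<lambda>j. norm ((1/2) ^ j *\<^sub>R u)) \<longlonglongrightarrow> 0" by (intro tendsto_norm_zero) simp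
  then have "\<forall>\<^sub>F j in sequentially. norm ((1/2) ^ j *\<^sub>R u) < r" using r(1) by (rule order_tendstoD(2))
  then have x: "\<forall>\<^sub>F j in sequentially. x j \<in> V \<and> \<phi> (x j) = (1/2) ^ j *\<^sub>R u"
  proof eventually_elim
    case (elim j)
    have "\<exists>x. x \<in> V \<and> \<phi> x = (1/2) ^ j *\<^sub>R u"
      using onto[OF subspace_scale[OF subspace_W u] elim] by blast
    then show ?case unfolding x_def by (rule someI_ex)
  qed
  have "(\<lambda>j. 2 ^ j *\<^sub>R \<phi> (x j)) \<longlonglongrightarrow> u"
  proof (rule tendsto_eventually)
    show "\<forall>\<^sub>F j in sequentially. 2 ^ j *\<^sub>R \<phi> (x j) = u"
      using x by eventually_elim (simp add: power_divide)
  qed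
  then have "tangent x u" using x by (auto simp: tangent_def elim: eventually_mono)
  moreover have "\<forall>\<^sub>F j in sequentially. \<phi> (x j) = (1/2) ^ j *\<^sub>R u" using x by (auto elim: eventually_mono)
  ultimately show thesis using that by blast
qed

section \<open>Conjugation and the adjoint representation\<close>

abbreviation conj_by :: "'a \<Rightarrow> 'a \<Rightarrow> 'a" where "conj_by g x \<equiv> g \<otimes> x \<otimes> inv g"

lemma conj_by_mult: "g \<in> carrier G \<Longrightarrow> x \<in> carrier G \<Longrightarrow> y \<in> carrier G \<Longrightarrow> conj_by g (x \<otimes> y) = conj_by g x \<otimes> conj_by g y"
  by (simp add: m_assoc) (simp flip: m_assoc)

text \<open>Compare \<open>(g x g\<^sup>-\<^sup>1) g\<close> with \<open>g x\<close>: both chart values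
  are a sum plus a product of norms.\<close>

lemma conj_by_close_B:
  assumes g: "g \<in> B (r/8)" and x: "x \<in> B (r/8)"
  shows conj_by_B: "conj_by g x \<in> B r" and conj_by_N: "N (conj_by g x) \<le> 2 * N x"
    and conj_by_close: "norm (\<phi> (conj_by g x) - \<phi> x) \<le> 3 * N g * N x"
proof -
  have c: "g \<in> carrier G" "x \<in> carrier G" using g x B_carrier by auto
  have gr: "g \<in> B r" and xr: "x \<in> B r" using g x B_mono r(1) by (auto simp: field_simps)
  have "g \<otimes> x \<in> B (r/2)" by (rule mult_B[OF g x]) (use r in simp_all)
  moreover have "inv g \<in> B (2 * (r/8))" by (rule inv_B[OF g]) (use r in simp)
  ultimately show cr: "conj_by g x \<in> B r" by (rule mult_B) (use r in simp_all)
  have "conj_by g x \<otimes> g = g \<otimes> x" using c by (simp add: m_assoc)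
  then have a: "norm (\<phi> (g \<otimes> x) - \<phi> (conj_by g x) - \<phi> g) \<le> N (conj_by g x) * N g"
    using mult_approx[OF cr gr] by simp
  have "\<phi> (conj_by g x) - \<phi> x = (\<phi> (g \<otimes> x) - \<phi> g - \<phi> x) - (\<phi> (g \<otimes> x) - \<phi> (conj_by g x) - \<phi> g)" by simp
  then have "norm (\<phi> (conj_by g x) - \<phi> x) \<le> norm (\<phi> (g \<otimes> x) - \<phi> g - \<phi> x) + norm (\<phi> (g \<otimes> x) - \<phi> (conj_by g x) - \<phi> g)"
    by (metis norm_triangle_ineq4)
  then have d: "norm (\<phi> (conj_by g x) - \<phi> x) \<le> N g * N x + N (conj_by g x) * N g"
    using a mult_approx[OF gr xr] by linarith
  have "N g * N x \<le> 1/100 * N x" "N (conj_by g x) * N g \<le> N (conj_by g x) * (1/100)"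
    by (intro mult_right_mono mult_left_mono small gr; simp)+
  then show le: "N (conj_by g x) \<le> 2 * N x"
    using d norm_triangle_ineq2[of "\<phi> (conj_by g x)" "\<phi> x"] norm_ge_zero[of "\<phi> x"] by argo
  have "N (conj_by g x) * N g \<le> (2 * N x) * N g" by (rule mult_right_mono[OF le]) simp
  moreover have "(2 * N x) * N g = 2 * (N g * N x)" "3 * N g * N x = 3 * (N g * N x)" by simp_all
  ultimately show "norm (\<phi> (conj_by g x) - \<phi> x) \<le> 3 * N g * N x" using d by linarith
qed

lemma conj_by_lipschitz:
  assumes g: "g \<in> B (r/8)" and x: "x \<in> B (r/32)" and y: "y \<in> B (r/32)"
  shows "norm (\<phi> (conj_by g y) - \<phi> (conj_by g x)) \<le> 8 * norm (\<phi> y - \<phi> x)"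
proof -
  have x8: "x \<in> B (r/8)" and y8: "y \<in> B (r/8)" using x y B_mono r(1) by (auto simp: field_simps)
  have c: "g \<in> carrier G" "x \<in> carrier G" "y \<in> carrier G" using g x y B_carrier by auto
  define w where "w = inv x \<otimes> y"
  have Nw: "N w \<le> 2 * norm (\<phi> y - \<phi> x)" unfolding w_def by (rule left_quotient_N[OF y8 x8])
  have "norm (\<phi> y - \<phi> x) < r/16"
    using norm_triangle_ineq4[of "\<phi> y" "\<phi> x"] B_N[OF x] B_N[OF y] by linarith
  then have w: "w \<in> B (r/8)"
    using Nw B_V[OF left_quotient_B[OF y8 x8]] unfolding w_def by (intro B_I) auto
  have "x \<otimes> w = y" unfolding w_def using c by (simp flip: m_assoc)
  then have "conj_by g y = conj_by g x \<otimes> conj_by g w" using conj_by_mult[of g x w] c B_carrier[OF w] by simp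
  then have "norm (\<phi> (conj_by g y) - \<phi> (conj_by g x) - \<phi> (conj_by g w)) \<le> N (conj_by g x) * N (conj_by g w)"
    using mult_approx[OF conj_by_B[OF g x8] conj_by_B[OF g w]] by simp
  also have "\<dots> \<le> 1 * N (conj_by g w)"
    using small[OF conj_by_B[OF g x8]] by (intro mult_right_mono) auto
  finally have "norm (\<phi> (conj_by g y) - \<phi> (conj_by g x)) \<le> 2 * N (conj_by g w)"
    using norm_triangle_ineq2[of "\<phi> (conj_by g y) - \<phi> (conj_by g x)" "\<phi> (conj_by g w)"] by linarith
  then show ?thesis using conj_by_N[OF g w] Nw by linarith
qed

text \<open>Let \<open>x\<^sub>j\<close> have chart value \<open>u / 2 ^ j\<close>. The square of
  \<open>x\<close> at index \<open>j + 1\<close> agrees with \<open>x\<^sub>j\<close> up to a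
  term of order \<open>4 ^ - j\<close>. Conjugation by \<open>g\<close> is a Lipschitz
  homomorphism, so the conjugates have the same property, and \<open>2 ^ j \<phi> (g x\<^sub>j
  g\<^sup>-\<^sup>1)\<close> is a Cauchy sequence.\<close>

lemma conj_by_tangent_exists:
  assumes g: "g \<in> B (r/8)" and u: "u \<in> W"
  obtains v x where "tangent x u" "tangent (\<lambda>j. conj_by g (x j)) v"
proof -
  obtain x where x: "tangent x u" "\<forall>\<^sub>F j in sequentially. \<phi> (x j) = (1/2) ^ j *\<^sub>R u"
    using tangent_exists[OF u] by blast
  have "\<forall>\<^sub>F j in sequentially. x j \<in> B (r/128) \<and> \<phi> (x j) = (1/2) ^ j *\<^sub>R u"
    using tangent_B[OF x(1), of "r/128"] x(2) r(1) by (auto intro: eventually_conj)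
  then obtain J where J: "\<And>j. j \<ge> J \<Longrightarrow> x j \<in> B (r/128)" "\<And>j. j \<ge> J \<Longrightarrow> \<phi> (x j) = (1/2) ^ j *\<^sub>R u"
    unfolding eventually_sequentially by blast
  have B8: "y \<in> B (r/8)" and B32: "y \<in> B (r/32)" and B1: "y \<in> B r" if "y \<in> B (r/128)" for y
    using B_mono[OF that] r(1) by auto
  define X where "X i = 2 ^ (i + J) *\<^sub>R \<phi> (conj_by g (x (i + J)))" for i
  have "norm (X (Suc i) - X i) \<le> (3 * (norm u * norm u)) * (1/2) ^ i" for i
  proof -
    define k where "k = i + J"
    define a where "a = x k"
    define b where "b = x (Suc k)"
    have "k \<ge> J" by (simp add: k_def)
    then have a: "a \<in> B (r/128)" "\<phi> a = (1/2) ^ k *\<^sub>R u" and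
      b: "b \<in> B (r/128)" "\<phi> b = (1/2) ^ Suc k *\<^sub>R u"
      unfolding a_def b_def using J[of k] J[of "Suc k"] by auto
    have bb: "b \<otimes> b \<in> B (r/32)" by (rule mult_B[OF b(1) b(1)]) (use r in simp_all)
    have "\<phi> a = 2 *\<^sub>R \<phi> b" using a(2) b(2) by simp
    then have ab: "norm (\<phi> (b \<otimes> b) - \<phi> a) \<le> N b * N b"
      using mult_approx[OF B1[OF b(1)] B1[OF b(1)]] by (simp add: scaleR_2 diff_diff_add)
    have gc: "g \<in> carrier G" and bc: "b \<in> carrier G" using g b B_carrier by auto
    define s where "s = \<phi> (conj_by g (b \<otimes> b)) - \<phi> (conj_by g a)"
    define t where "t = \<phi> (conj_by g b \<otimes> conj_by g b) - \<phi> (conj_by g b) - \<phi> (conj_by g b)"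
    have "norm s \<le> 8 * norm (\<phi> (b \<otimes> b) - \<phi> a)"
      unfolding s_def by (rule conj_by_lipschitz[OF g B32[OF a(1)] bb])
    then have s: "norm s \<le> 8 * (N b * N b)" using ab by linarith
    have "norm t \<le> N (conj_by g b) * N (conj_by g b)"
      unfolding t_def by (intro mult_approx conj_by_B g B8 b)
    also have "\<dots> \<le> (2 * N b) * (2 * N b)"
      by (intro mult_mono conj_by_N g B8 b) auto
    finally have t: "norm t \<le> 4 * (N b * N b)" by simp
    have "X (Suc i) - X i = 2 ^ k *\<^sub>R (2 *\<^sub>R \<phi> (conj_by g b) - \<phi> (conj_by g a))"
      unfolding X_def a_def b_def k_def by (simp add: scaleR_diff_right)
    also have "2 *\<^sub>R \<phi> (conj_by g b) - \<phi> (conj_by g a) = s - t"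
      unfolding s_def t_def conj_by_mult[OF gc bc bc] by (simp add: scaleR_2)
    finally have "norm (X (Suc i) - X i) = 2 ^ k * norm (s - t)" by simp
    also have "\<dots> \<le> 2 ^ k * (12 * (N b * N b))"
      using s t norm_triangle_ineq4[of s t] by (intro mult_left_mono) auto
    also have "N b = (1/2) ^ k * (1/2 * norm u)" using b(2) by simp
    also have "2 ^ k * (12 * ((1/2) ^ k * (1/2 * norm u) * ((1/2) ^ k * (1/2 * norm u)))) =
      (2 * (1/2)) ^ k * (1/2) ^ k * (3 * (norm u * norm u))"
      unfolding power_mult_distrib by simp
    also have "\<dots> \<le> (1/2) ^ i * (3 * (norm u * norm u))"
    proof (intro mult_right_mono)
      have "(1/2 :: real) ^ k \<le> (1/2) ^ i" by (intro power_decreasing) (auto simp: k_def)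
      then show "(2 * (1/2) :: real) ^ k * (1/2) ^ k \<le> (1/2) ^ i" by simp
    qed simp
    finally show ?thesis by (simp add: mult.commute)
  qed
  then obtain v where "X \<longlonglongrightarrow> v" by (rule geometric_convergent) auto
  then have "(\<lambda>j. 2 ^ j *\<^sub>R \<phi> (conj_by g (x j))) \<longlonglongrightarrow> v"
    unfolding X_def[abs_def] by (rule LIMSEQ_offset)
  moreover have "conj_by g (x j) \<in> V" if "j \<ge> J" for j
    by (rule B_V[OF conj_by_B[OF g B8[OF J(1)[OF that]]]])
  then have "\<forall>\<^sub>F j in sequentially. conj_by g (x j) \<in> V" unfolding eventually_sequentially by blast
  ultimately have "tangent (\<lambda>j. conj_by g (x j)) v" by (simp add: tangent_def)
  with x(1) show thesis using that by blast
qed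

text \<open>The adjoint representation: the derivative at the unit of conjugation by \<open>g\<close>.\<close>

definition Ad :: "'a \<Rightarrow> 'v \<Rightarrow> 'v" where
  "Ad g u = (SOME v. \<exists>x. tangent x u \<and> tangent (\<lambda>j. conj_by g (x j)) v)"

text \<open>Two sequences with the same tangent have conjugates with the same tangent, since conjugation
  is Lipschitz. So \<open>Ad g u\<close> depends on the tangent \<open>u\<close> only.\<close>

lemma tangent_conj_by:
  assumes g: "g \<in> B (r/8)" and u: "u \<in> W" and x: "tangent x u"
  shows "tangent (\<lambda>j. conj_by g (x j)) (Ad g u)"
proof -
  have "\<exists>v y. tangent y u \<and> tangent (\<lambda>j. conj_by g (y j)) v" using conj_by_tangent_exists[OF g u] by blast
  then have "\<exists>y. tangent y u \<and> tangent (\<lambda>j. conj_by g (y j)) (Ad g u)" unfolding Ad_def by (rule someI_ex)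
  then obtain y where y: "tangent y u" "tangent (\<lambda>j. conj_by g (y j)) (Ad g u)" by blast
  have ev: "\<forall>\<^sub>F j in sequentially. x j \<in> B (r/32) \<and> y j \<in> B (r/32)"
    using tangent_B[OF x, of "r/32"] tangent_B[OF y(1), of "r/32"] r(1) by (auto intro: eventually_conj)
  have "(\<lambda>j. 2 ^ j *\<^sub>R \<phi> (conj_by g (x j)) - 2 ^ j *\<^sub>R \<phi> (conj_by g (y j))) \<longlonglongrightarrow> 0"
  proof (rule Lim_null_comparison)
    show "\<forall>\<^sub>F j in sequentially. norm (2 ^ j *\<^sub>R \<phi> (conj_by g (x j)) - 2 ^ j *\<^sub>R \<phi> (conj_by g (y j))) \<le>
        8 * norm (2 ^ j *\<^sub>R \<phi> (x j) - 2 ^ j *\<^sub>R \<phi> (y j))"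
      using ev
    proof eventually_elim
      case (elim j)
      then show ?case using conj_by_lipschitz[OF g, of "y j" "x j"] by (simp flip: scaleR_diff_right)
    qed
    have "(\<lambda>j. 8 * norm (2 ^ j *\<^sub>R \<phi> (x j) - 2 ^ j *\<^sub>R \<phi> (y j))) \<longlonglongrightarrow> 8 * norm (u - u)"
      using x y(1) unfolding tangent_def by (intro tendsto_intros) auto
    then show "(\<lambda>j. 8 * norm (2 ^ j *\<^sub>R \<phi> (x j) - 2 ^ j *\<^sub>R \<phi> (y j))) \<longlonglongrightarrow> 0" by simp
  qed
  moreover have "(\<lambda>j. 2 ^ j *\<^sub>R \<phi> (conj_by g (y j))) \<longlonglongrightarrow> Ad g u" using y(2) by (simp add: tangent_def)
  ultimately have "(\<lambda>j. 2 ^ j *\<^sub>R \<phi> (conj_by g (x j)) - 2 ^ j *\<^sub>R \<phi> (conj_by g (y j)) + 2 ^ j *\<^sub>R \<phi> (conj_by g (y j))) \<longlonglongrightarrow> 0 + Ad g u"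
    by (rule tendsto_add)
  then have "(\<lambda>j. 2 ^ j *\<^sub>R \<phi> (conj_by g (x j))) \<longlonglongrightarrow> Ad g u" by simp
  moreover have "\<forall>\<^sub>F j in sequentially. conj_by g (x j) \<in> V"
    using ev
  proof eventually_elim
    case (elim j)
    then have "x j \<in> B (r/8)" using B_mono[of "x j" "r/32" "r/8"] r(1) by simp
    then show ?case using conj_by_B[OF g] B_V by blast
  qed
  ultimately show ?thesis by (simp add: tangent_def)
qed

lemma tangent_W: assumes "tangent x u" shows "u \<in> W"
proof (rule Lim_in_closed_set[OF closed_W])
  have "\<forall>\<^sub>F j in sequentially. x j \<in> V" using assms by (simp add: tangent_def)
  then show "\<forall>\<^sub>F j in sequentially. 2 ^ j *\<^sub>R \<phi> (x j) \<in> W"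
    by eventually_elim (intro subspace_scale[OF subspace_W] \<phi>_W)
  show "(\<lambda>j. 2 ^ j *\<^sub>R \<phi> (x j)) \<longlonglongrightarrow> u" using assms by (simp add: tangent_def)
qed simp

lemma Ad_W: "g \<in> B (r/8) \<Longrightarrow> u \<in> W \<Longrightarrow> Ad g u \<in> W"
  using tangent_exists[of u] tangent_conj_by tangent_W by metis

lemma Ad_add:
  assumes g: "g \<in> B (r/8)" and u: "u \<in> W" and v: "v \<in> W"
  shows "Ad g (u + v) = Ad g u + Ad g v"
proof -
  obtain x y where x: "tangent x u" and y: "tangent y v" using tangent_exists u v by metis
  have "tangent (\<lambda>j. conj_by g (x j) \<otimes> conj_by g (y j)) (Ad g u + Ad g v)"
    by (rule tangent_mult[OF tangent_conj_by[OF g u x] tangent_conj_by[OF g v y]])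
  moreover have "tangent (\<lambda>j. conj_by g (x j \<otimes> y j)) (Ad g (u + v))"
    by (rule tangent_conj_by[OF g subspace_add[OF subspace_W u v] tangent_mult[OF x y]])
  then have "tangent (\<lambda>j. conj_by g (x j) \<otimes> conj_by g (y j)) (Ad g (u + v))"
  proof (rule tangent_cong)
    show "\<forall>\<^sub>F j in sequentially. conj_by g (x j \<otimes> y j) = conj_by g (x j) \<otimes> conj_by g (y j)"
    using tangent_B[OF x r(1)] tangent_B[OF y r(1)]
      by eventually_elim (rule conj_by_mult[OF B_carrier[OF g] B_carrier B_carrier])
  qed
  ultimately show ?thesis using tangent_unique by blast
qed

lemma Ad_close:
  assumes g: "g \<in> B (r/8)" and u: "u \<in> W" shows "norm (Ad g u - u) \<le> 3 * N g * norm u"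
proof -
  obtain x where x: "tangent x u" using tangent_exists u by metis
  have y: "tangent (\<lambda>j. conj_by g (x j)) (Ad g u)" by (rule tangent_conj_by[OF g u x])
  have ev: "\<forall>\<^sub>F j in sequentially. x j \<in> B (r/8)" using tangent_B[OF x, of "r/8"] r(1) by simp
  have l: "(\<lambda>j. norm (2 ^ j *\<^sub>R \<phi> (conj_by g (x j)) - 2 ^ j *\<^sub>R \<phi> (x j))) \<longlonglongrightarrow> norm (Ad g u - u)"
    using x y unfolding tangent_def by (intro tendsto_intros) auto
  have r': "(\<lambda>j. 3 * N g * norm (2 ^ j *\<^sub>R \<phi> (x j))) \<longlonglongrightarrow> 3 * N g * norm u"
    using x unfolding tangent_def by (intro tendsto_intros) auto
  show ?thesis
  proof (rule tendsto_le[OF _ r' l])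
    show "\<forall>\<^sub>F j in sequentially. norm (2 ^ j *\<^sub>R \<phi> (conj_by g (x j)) - 2 ^ j *\<^sub>R \<phi> (x j)) \<le> 3 * N g * norm (2 ^ j *\<^sub>R \<phi> (x j))"
      using ev
    proof eventually_elim
      case (elim j)
      have "2 ^ j * norm (\<phi> (conj_by g (x j)) - \<phi> (x j)) \<le> 2 ^ j * (3 * N g * N (x j))"
        by (intro mult_left_mono conj_by_close[OF g elim]) simp
      then show ?case by (simp add: mult_ac flip: scaleR_diff_right)
    qed
  qed simp
qed

lemma Ad_scale:
  assumes g: "g \<in> B (r/8)" and u: "u \<in> W" shows "Ad g (c *\<^sub>R u) = c *\<^sub>R Ad g u"
proof (rule additive_bounded_scale[OF subspace_W Ad_add[OF g] _ u])
  fix w assume w: "w \<in> W"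
  have "norm (Ad g w) \<le> 3 * N g * norm w + norm w"
    using Ad_close[OF g w] norm_triangle_ineq2[of "Ad g w" w] by linarith
  then show "norm (Ad g w) \<le> (3 * N g + 1) * norm w" by (simp add: distrib_right)
qed

text \<open>Conjugation by \<open>g ^ m\<close> is the iterate of conjugation by \<open>g\<close>. The
  intermediate powers of \<open>g\<close> may lie far outside the chart, but a sequence
  tending to the unit has conjugates that tend to the unit.\<close>

lemma Ad_pow:
  assumes g: "g \<in> B (r/8)" and gm: "g [^] (m::nat) \<in> B (r/8)" and u: "u \<in> W"
  shows "Ad (g [^] m) u = (Ad g ^^ m) u"
proof -
  have gc: "g \<in> carrier G" using g B_carrier by blast
  obtain x where x: "tangent x u" using tangent_exists u by metis
  have i: "(Ad g ^^ i) u \<in> W \<and> tangent (\<lambda>j. (conj_by g ^^ i) (x j)) ((Ad g ^^ i) u)" for i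
    by (induction i) (use u x Ad_W[OF g] tangent_conj_by[OF g] in auto)
  have cji: "(conj_by g ^^ i) y = conj_by (g [^] i) y" if y: "y \<in> carrier G" for i y
  proof (induction i)
    case (Suc i)
    have "(conj_by g ^^ Suc i) y = conj_by g (conj_by (g [^] i) y)" using Suc by simp
    also have "\<dots> = (g \<otimes> g [^] i) \<otimes> y \<otimes> inv (g \<otimes> g [^] i)"
      using gc y by (simp add: m_assoc inv_mult_group)
    also have "g \<otimes> g [^] i = g [^] Suc i" by (rule nat_pow_Suc2[OF gc, symmetric])
    finally show ?case .
  qed (use y in simp)
  have "tangent (\<lambda>j. conj_by (g [^] m) (x j)) (Ad (g [^] m) u)" by (rule tangent_conj_by[OF gm u x])
  moreover have "tangent (\<lambda>j. (conj_by g ^^ m) (x j)) ((Ad g ^^ m) u)" using i by blast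
  then have "tangent (\<lambda>j. conj_by (g [^] m) (x j)) ((Ad g ^^ m) u)"
  proof (rule tangent_cong)
    show "\<forall>\<^sub>F j in sequentially. (conj_by g ^^ m) (x j) = conj_by (g [^] m) (x j)"
      using tangent_B[OF x r(1)] by eventually_elim (rule cji[OF B_carrier])
  qed
  ultimately show ?thesis using tangent_unique by blast
qed

text \<open>The conjugates of the iterated roots of \<open>h\<close> are the iterated roots of the
  conjugate, by uniqueness of roots, so the conjugate of \<open>h\<close> has logarithm
  \<open>Ad g (log h) = log h\<close>. The logarithm is injective.\<close>

lemma Ad_id_commute:
  assumes g: "g \<in> B (r/8)" and id: "\<And>u. u \<in> W \<Longrightarrow> Ad g u = u" and h: "h \<in> B (r/128)"
  shows "g \<otimes> h = h \<otimes> g"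
proof -
  have gc: "g \<in> carrier G" and hc: "h \<in> carrier G" using g h B_carrier by auto
  have h64: "h \<in> B (r/64)" using h by (rule B_mono) (use r in simp)
  have B64: "conj_by g y \<in> B (r/64)" if "y \<in> B (r/128)" for y
  proof -
    have y8: "y \<in> B (r/8)" using that by (rule B_mono) (use r in simp)
    show ?thesis using conj_by_N[OF g y8] B_N[OF that] B_V[OF conj_by_B[OF g y8]] by (intro B_I) auto
  qed
  have roots: "(sqroot ^^ j) (conj_by g h) = conj_by g ((sqroot ^^ j) h)" for j
  proof (induction j)
    case (Suc j)
    define y where "y = (sqroot ^^ Suc j) h"
    have y: "y \<in> B (r/128)" unfolding y_def by (rule roots_B[OF h]) (use r in simp)
    have yy: "y \<otimes> y = (sqroot ^^ j) h" unfolding y_def by (rule roots_square[OF h64])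
    have "sqroot (conj_by g ((sqroot ^^ j) h)) = conj_by g y"
    proof (rule sqroot_eqI)
      show "conj_by g ((sqroot ^^ j) h) \<in> B (r/64)" by (rule B64[OF roots_B[OF h]]) (use r in simp)
      show "conj_by g y \<in> B (r/32)" using B64[OF y] by (rule B_mono) (use r in simp)
      show "conj_by g y \<otimes> conj_by g y = conj_by g ((sqroot ^^ j) h)"
        using conj_by_mult[OF gc B_carrier[OF y] B_carrier[OF y]] yy by simp
    qed
    then show ?case using Suc by (simp add: y_def)
  qed simp
  have "tangent (\<lambda>j. conj_by g ((sqroot ^^ j) h)) (Ad g (chart_log h))"
    by (rule tangent_conj_by[OF g chart_log_W[OF h64] tangent_log[OF h64]])
  moreover have "tangent (\<lambda>j. (sqroot ^^ j) (conj_by g h)) (chart_log (conj_by g h))" by (rule tangent_log[OF B64[OF h]])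
  ultimately have "chart_log (conj_by g h) = chart_log h" unfolding roots id[OF chart_log_W[OF h64]] by (metis tangent_unique)
  then have "conj_by g h = h" using chart_log_inj[OF B64[OF h] h64] by blast
  then have "conj_by g h \<otimes> g = h \<otimes> g" by simp
  then show ?thesis using gc hc by (simp add: m_assoc)
qed

section \<open>Elements commuting with a ball\<close>

text \<open>In a Lie group this is the centralizer of the identity component. Its small elements commute
  with each other, which makes the logarithm additive on them.\<close>

definition Z :: "'a set" where "Z = {z \<in> carrier G. \<forall>h\<in>B (r/128). z \<otimes> h = h \<otimes> z}"

lemma Z_carrier: "z \<in> Z \<Longrightarrow> z \<in> carrier G" by (simp add: Z_def)

lemma Z_commute: "z \<in> Z \<Longrightarrow> h \<in> B (r/128) \<Longrightarrow> z \<otimes> h = h \<otimes> z" by (simp add: Z_def)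

lemma Z_one: "\<one> \<in> Z" using B_carrier by (auto simp: Z_def)

lemma Z_mult: assumes "x \<in> Z" "y \<in> Z" shows "x \<otimes> y \<in> Z"
  unfolding Z_def
proof (intro CollectI conjI ballI)
  show "x \<otimes> y \<in> carrier G" using assms Z_carrier by simp
  fix h assume h: "h \<in> B (r/128)"
  have "x \<otimes> y \<otimes> h = x \<otimes> h \<otimes> y"
    using Z_commute[OF assms(2) h] assms Z_carrier B_carrier[OF h] by (simp add: m_assoc)
  then show "x \<otimes> y \<otimes> h = h \<otimes> (x \<otimes> y)"
    using Z_commute[OF assms(1) h] assms Z_carrier B_carrier[OF h] by (simp add: m_assoc)
qed

lemma Z_inv: assumes "x \<in> Z" shows "inv x \<in> Z"
  unfolding Z_def
proof (intro CollectI conjI ballI)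
  have xc: "x \<in> carrier G" by (rule Z_carrier[OF assms])
  then show "inv x \<in> carrier G" by simp
  fix h assume h: "h \<in> B (r/128)"
  have hc: "h \<in> carrier G" by (rule B_carrier[OF h])
  have "inv x \<otimes> h = inv x \<otimes> (h \<otimes> x) \<otimes> inv x" using xc hc by (simp add: m_assoc)
  also have "\<dots> = inv x \<otimes> (x \<otimes> h) \<otimes> inv x" using Z_commute[OF assms h] by simp
  also have "\<dots> = h \<otimes> inv x" using xc hc by (simp flip: m_assoc)
  finally show "inv x \<otimes> h = h \<otimes> inv x" .
qed

lemma Z_pow: "x \<in> Z \<Longrightarrow> x [^] (m::nat) \<in> Z"
  by (induction m) (auto intro: Z_one Z_mult)

text \<open>A conjugate of the root of \<open>z\<close> by a small \<open>h\<close> is again a small root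
  of \<open>z\<close>; roots are unique.\<close>

lemma Z_sqroot:
  assumes z: "z \<in> Z" "z \<in> B (r/128)" shows "sqroot z \<in> Z"
proof -
  have z64: "z \<in> B (r/64)" using z(2) by (rule B_mono) (use r in simp)
  have y: "sqroot z \<in> B (r/128)" by (rule sqroot_B[OF z(2)]) (use r in simp)
  have yc: "sqroot z \<in> carrier G" and zc: "z \<in> carrier G" using y z B_carrier by auto
  have y8: "sqroot z \<in> B (r/8)" using y by (rule B_mono) (use r in simp)
  have "sqroot z \<otimes> h = h \<otimes> sqroot z" if h: "h \<in> B (r/128)" for h
  proof -
    have hc: "h \<in> carrier G" by (rule B_carrier[OF h])
    have h8: "h \<in> B (r/8)" using h by (rule B_mono) (use r in simp)
    have "sqroot z = conj_by h (sqroot z)"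
    proof (rule sqroot_eqI[OF z64])
      show "conj_by h (sqroot z) \<in> B (r/32)"
        using conj_by_N[OF h8 y8] B_N[OF y] B_V[OF conj_by_B[OF h8 y8]] r by (intro B_I) auto
      have "conj_by h (sqroot z) \<otimes> conj_by h (sqroot z) = conj_by h z"
        using conj_by_mult[OF hc yc yc] sqroot_square[OF z64] by simp
      also have "\<dots> = z \<otimes> h \<otimes> inv h" using Z_commute[OF z(1) h] by simp
      also have "\<dots> = z" using zc hc by (simp add: m_assoc)
      finally show "conj_by h (sqroot z) \<otimes> conj_by h (sqroot z) = z" .
    qed
    then have "sqroot z \<otimes> h = conj_by h (sqroot z) \<otimes> h" by simp
    also have "\<dots> = h \<otimes> sqroot z" using hc yc by (simp add: m_assoc)
    finally show ?thesis .
  qed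
  then show ?thesis using yc by (simp add: Z_def)
qed

lemma Z_roots: "z \<in> Z \<Longrightarrow> z \<in> B (r/128) \<Longrightarrow> (sqroot ^^ j) z \<in> Z"
proof (induction j)
  case (Suc j)
  have "(sqroot ^^ j) z \<in> B (r/128)" by (rule roots_B[OF Suc.prems(2)]) (use r in simp)
  then show ?case using Z_sqroot Suc by simp
qed simp

text \<open>For commuting elements the product of the roots is the root of the product, and the tangent of
  a product of sequences is the sum of the tangents.\<close>

lemma chart_log_mult:
  assumes x: "x \<in> Z" "x \<in> B (r/512)" and y: "y \<in> Z" "y \<in> B (r/512)"
  shows "chart_log (x \<otimes> y) = chart_log x + chart_log y"
proof -
  have x': "x \<in> B (r/64)" "x \<in> B (r/128)" and y': "y \<in> B (r/64)" "y \<in> B (r/128)"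
    using B_mono[OF x(2)] B_mono[OF y(2)] r(1) by auto
  have xy: "a \<otimes> b \<in> B (r/64)" if "a \<in> B (r/512)" "b \<in> B (r/512)" for a b
    by (rule mult_B[OF that]) (use r in simp_all)
  have roots: "(sqroot ^^ j) (x \<otimes> y) = (sqroot ^^ j) x \<otimes> (sqroot ^^ j) y" for j
  proof (induction j)
    case (Suc j)
    define a where "a = (sqroot ^^ Suc j) x"
    define b where "b = (sqroot ^^ Suc j) y"
    have a: "a \<in> B (r/512)" "a \<in> Z" unfolding a_def
      by (rule roots_B[OF x(2)], use r in simp, rule Z_roots[OF x(1) x'(2)])
    have b: "b \<in> B (r/512)" "b \<in> Z" unfolding b_def
      by (rule roots_B[OF y(2)], use r in simp, rule Z_roots[OF y(1) y'(2)])
    have c: "a \<in> carrier G" "b \<in> carrier G" using a b B_carrier by auto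
    have ab: "b \<otimes> a = a \<otimes> b"
      using a b Z_commute B_mono[OF a(1), of "r/128"] r(1) by simp
    have sq: "a \<otimes> a = (sqroot ^^ j) x" "b \<otimes> b = (sqroot ^^ j) y" unfolding a_def b_def
      by (rule roots_square x' y')+
    have "sqroot ((sqroot ^^ j) x \<otimes> (sqroot ^^ j) y) = a \<otimes> b"
    proof (rule sqroot_eqI)
      show "(sqroot ^^ j) x \<otimes> (sqroot ^^ j) y \<in> B (r/64)"
        by (rule xy[OF roots_B[OF x(2)] roots_B[OF y(2)]]) (use r in simp_all)
      show "a \<otimes> b \<in> B (r/32)" using xy[OF a(1) b(1)] by (rule B_mono) (use r in simp)
      have "a \<otimes> b \<otimes> (a \<otimes> b) = a \<otimes> (b \<otimes> a) \<otimes> b" using c by (simp add: m_assoc)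
      also have "\<dots> = (a \<otimes> a) \<otimes> (b \<otimes> b)" unfolding ab using c by (simp add: m_assoc)
      finally show "a \<otimes> b \<otimes> (a \<otimes> b) = (sqroot ^^ j) x \<otimes> (sqroot ^^ j) y" by (simp only: sq)
    qed
    then show ?case using Suc by (simp add: a_def b_def)
  qed simp
  have "tangent (\<lambda>j. (sqroot ^^ j) x \<otimes> (sqroot ^^ j) y) (chart_log x + chart_log y)"
    by (rule tangent_mult[OF tangent_log[OF x'(1)] tangent_log[OF y'(1)]])
  moreover have "tangent (\<lambda>j. (sqroot ^^ j) (x \<otimes> y)) (chart_log (x \<otimes> y))"
    by (rule tangent_log[OF xy[OF x(2) y(2)]])
  ultimately show ?thesis unfolding roots by (metis tangent_unique)
qed

lemma chart_log_pow:
  assumes x: "x \<in> Z" and pw: "\<And>i. i \<le> m \<Longrightarrow> x [^] i \<in> B (r/512)"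
  shows "chart_log (x [^] (m::nat)) = of_nat m *\<^sub>R chart_log x"
proof -
  have "i \<le> m \<Longrightarrow> chart_log (x [^] i) = of_nat i *\<^sub>R chart_log x" for i
  proof (induction i)
    case (Suc i)
    have x1: "x \<in> B (r/512)" using pw[of 1] Suc.prems Z_carrier[OF x] by simp
    have "chart_log (x [^] i \<otimes> x) = chart_log (x [^] i) + chart_log x"
      by (rule chart_log_mult[OF Z_pow[OF x] pw x x1]) (use Suc.prems in simp)
    then show ?case using Suc by (simp add: scaleR_left_distrib)
  qed (simp add: chart_log_one)
  then show ?thesis by simp
qed

lemma chart_log_inv:
  assumes x: "x \<in> Z" "x \<in> B (r/1024)" shows "chart_log (inv x) = - chart_log x"
proof -
  have x': "x \<in> B (r/512)" using x(2) by (rule B_mono) (use r in simp)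
  have "inv x \<in> B (2 * (r/1024))" by (rule inv_B[OF x(2)]) (use r in simp)
  then have ix: "inv x \<in> B (r/512)" by simp
  have "chart_log (x \<otimes> inv x) = chart_log x + chart_log (inv x)" by (rule chart_log_mult[OF x(1) x' Z_inv[OF x(1)] ix])
  then show ?thesis using Z_carrier[OF x(1)] by (simp add: chart_log_one eq_neg_iff_add_eq_0 add.commute)
qed

section \<open>Logarithms of elements of finite two-power order\<close>

text \<open>The kernel of the exponential map on the centre of the Lie algebra. A vector \<open>v\<close>
  belongs to it if \<open>exp (v / 2 ^ j)\<close>, for \<open>j\<close> so large that this is
  a small element, has \<open>2 ^ j\<close>-th power \<open>\<one>\<close>.\<close>

definition log_kernel :: "'v set" where
  "log_kernel = {v. \<exists>j z. z \<in> Z \<and> z \<in> B (r/1024) \<and> z [^] (2 ^ j :: nat) = \<one> \<and> v = 2 ^ j *\<^sub>R chart_log z}"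

lemma log_kernel_I: "z \<in> Z \<Longrightarrow> z \<in> B (r/1024) \<Longrightarrow> z [^] (2 ^ j :: nat) = \<one> \<Longrightarrow> v = 2 ^ j *\<^sub>R chart_log z \<Longrightarrow> v \<in> log_kernel"
  by (auto simp: log_kernel_def)

lemma log_kernel_0: "0 \<in> log_kernel"
  by (rule log_kernel_I[of \<one> 0]) (use r B_one Z_one chart_log_one in auto)

lemma log_kernel_W: "log_kernel \<subseteq> W"
proof
  fix v assume "v \<in> log_kernel"
  then obtain j z where z: "z \<in> B (r/1024)" "v = 2 ^ j *\<^sub>R chart_log z" by (auto simp: log_kernel_def)
  have "z \<in> B (r/64)" using z(1) by (rule B_mono) (use r in simp)
  then show "v \<in> W" unfolding z(2) by (intro subspace_scale[OF subspace_W] chart_log_W)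
qed

text \<open>Taking roots replaces the witness by one that is as small as desired, with a larger exponent.\<close>

lemma log_kernel_small:
  assumes v: "v \<in> log_kernel" and \<rho>: "\<rho> > 0"
  obtains J where "\<And>j. j \<ge> J \<Longrightarrow> \<exists>z. z \<in> Z \<and> z \<in> B \<rho> \<and> z [^] (2 ^ j :: nat) = \<one> \<and> v = 2 ^ j *\<^sub>R chart_log z"
proof -
  obtain j0 z where z: "z \<in> Z" "z \<in> B (r/1024)" "z [^] (2 ^ j0 :: nat) = \<one>" "v = 2 ^ j0 *\<^sub>R chart_log z"
    using v by (auto simp: log_kernel_def)
  have z': "z \<in> B (r/64)" "z \<in> B (r/128)" using B_mono[OF z(2)] r(1) by auto
  obtain M where M: "\<And>m. m \<ge> M \<Longrightarrow> (sqroot ^^ m) z \<in> B \<rho>"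
    using tangent_B[OF tangent_log[OF z'(1)] \<rho>] unfolding eventually_sequentially by blast
  have "\<exists>z. z \<in> Z \<and> z \<in> B \<rho> \<and> z [^] (2 ^ j :: nat) = \<one> \<and> v = 2 ^ j *\<^sub>R chart_log z" if j: "j \<ge> j0 + M" for j
  proof -
    define m where "m = j - j0"
    have jm: "j = m + j0" "m \<ge> M" using j by (auto simp: m_def)
    define y where "y = (sqroot ^^ m) z"
    have yB: "y \<in> B \<rho>" unfolding y_def by (rule M[OF jm(2)])
    have "y [^] (2 ^ j :: nat) = (y [^] (2 ^ m :: nat)) [^] (2 ^ j0 :: nat)"
      using B_carrier[OF yB] by (simp add: nat_pow_pow jm power_add)
    also have "y [^] (2 ^ m :: nat) = z" unfolding y_def by (rule roots_pow[OF z'(1)])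
    finally have "y [^] (2 ^ j :: nat) = \<one>" using z(3) by simp
    moreover have "v = 2 ^ j *\<^sub>R chart_log y"
      unfolding y_def chart_log_roots[OF z'(1)] z(4) by (simp add: jm power_add power_divide)
    moreover have "y \<in> Z" unfolding y_def by (rule Z_roots[OF z(1) z'(2)])
    ultimately show ?thesis using yB by blast
  qed
  then show thesis using that by blast
qed

lemma quotient_mem_log_kernel:
  assumes x: "x \<in> Z" "x \<in> B (r/4096)" and y: "y \<in> Z" "y \<in> B (r/4096)"
    and pow: "x [^] (2 ^ j :: nat) = y [^] (2 ^ j :: nat)"
  shows "2 ^ j *\<^sub>R chart_log x - 2 ^ j *\<^sub>R chart_log y \<in> log_kernel"
proof (rule log_kernel_I)
  have x': "x \<in> B (r/512)" and y': "y \<in> B (r/1024)" "y \<in> B (r/128)"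
    using B_mono[OF x(2)] B_mono[OF y(2)] r(1) by auto
  have c: "x \<in> carrier G" "y \<in> carrier G" using x y Z_carrier by auto
  have iy: "inv y \<in> B (2 * (r/4096))" by (rule inv_B[OF y(2)]) (use r in simp)
  show "x \<otimes> inv y \<in> Z" by (intro Z_mult Z_inv x y)
  show "x \<otimes> inv y \<in> B (r/1024)" by (rule mult_B[OF x(2) iy]) (use r in simp_all)
  have "chart_log (x \<otimes> inv y) = chart_log x + chart_log (inv y)"
    by (rule chart_log_mult[OF x(1) x' Z_inv[OF y(1)] B_mono[OF iy]]) (use r in simp)
  then show "2 ^ j *\<^sub>R chart_log x - 2 ^ j *\<^sub>R chart_log y = 2 ^ j *\<^sub>R chart_log (x \<otimes> inv y)"
    unfolding chart_log_inv[OF y(1) y'(1)] by (simp add: scaleR_diff_right)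
  have "inv y \<in> B (r/128)" using iy by (rule B_mono) (use r in simp)
  then have "x \<otimes> inv y = inv y \<otimes> x" by (rule Z_commute[OF x(1)])
  then have "(x \<otimes> inv y) [^] (2 ^ j :: nat) = x [^] (2 ^ j :: nat) \<otimes> inv y [^] (2 ^ j :: nat)"
    using c by (intro pow_mult_distrib) auto
  also have "\<dots> = \<one>" using c by (simp add: pow nat_pow_inv)
  finally show "(x \<otimes> inv y) [^] (2 ^ j :: nat) = \<one>" .
qed

lemma log_kernel_diff:
  assumes v: "v \<in> log_kernel" and w: "w \<in> log_kernel" shows "v - w \<in> log_kernel"
proof -
  have r4: "r/4096 > 0" using r by simp
  obtain J1 where J1: "\<And>j. j \<ge> J1 \<Longrightarrow> \<exists>z. z \<in> Z \<and> z \<in> B (r/4096) \<and> z [^] (2 ^ j :: nat) = \<one> \<and> v = 2 ^ j *\<^sub>R chart_log z"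
    using log_kernel_small[OF v r4] by metis
  obtain J2 where J2: "\<And>j. j \<ge> J2 \<Longrightarrow> \<exists>z. z \<in> Z \<and> z \<in> B (r/4096) \<and> z [^] (2 ^ j :: nat) = \<one> \<and> w = 2 ^ j *\<^sub>R chart_log z"
    using log_kernel_small[OF w r4] by metis
  define j where "j = max J1 J2"
  obtain x where x: "x \<in> Z" "x \<in> B (r/4096)" "x [^] (2 ^ j :: nat) = \<one>" "v = 2 ^ j *\<^sub>R chart_log x"
    using J1[of j] by (auto simp: j_def)
  obtain y where y: "y \<in> Z" "y \<in> B (r/4096)" "y [^] (2 ^ j :: nat) = \<one>" "w = 2 ^ j *\<^sub>R chart_log y"
    using J2[of j] by (auto simp: j_def)
  show ?thesis unfolding x(4) y(4) by (rule quotient_mem_log_kernel) (use x y in simp_all)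
qed

text \<open>If \<open>v = 2 ^ j log z\<close> is small then the powers \<open>z ^ 2 ^ i\<close> for
  \<open>i \<le> j\<close> stay in the region where the logarithm is additive, so
  \<open>v\<close> is the logarithm of \<open>z ^ 2 ^ j = \<one>\<close>.\<close>

lemma log_kernel_discrete:
  assumes v: "v \<in> log_kernel" and small: "norm v < r/8192" shows "v = 0"
proof -
  obtain j z where z: "z \<in> Z" "z \<in> B (r/1024)" "z [^] (2 ^ j :: nat) = \<one>" "v = 2 ^ j *\<^sub>R chart_log z"
    using v by (auto simp: log_kernel_def)
  have "i \<le> j \<Longrightarrow> z [^] (2 ^ i :: nat) \<in> B (r/1024) \<and> chart_log (z [^] (2 ^ i :: nat)) = 2 ^ i *\<^sub>R chart_log z" for i
  proof (induction i)
    case 0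
    then show ?case using z Z_carrier[OF z(1)] by simp
  next
    case (Suc i)
    define y where "y = z [^] (2 ^ i :: nat)"
    have y: "y \<in> B (r/1024)" "chart_log y = 2 ^ i *\<^sub>R chart_log z" using Suc by (auto simp: y_def)
    have yZ: "y \<in> Z" unfolding y_def by (rule Z_pow[OF z(1)])
    have y': "y \<in> B (r/512)" "y \<in> B (r/64)" "y \<in> B r" using B_mono[OF y(1)] r(1) by auto
    have sq: "z [^] (2 ^ Suc i :: nat) = y \<otimes> y"
      unfolding y_def using Z_carrier[OF z(1)] by (simp add: nat_pow_mult mult_2)
    have "norm (chart_log y) \<le> norm v"
      unfolding y(2) z(4) using Suc.prems by (simp add: mult_right_mono)
    then have "N y \<le> 2 * (r/8192)" using chart_log_ge[OF y'(2)] small by linarith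
    then have "101/100 * (N y + N y) \<le> 101/100 * (2 * (r/8192) + 2 * (r/8192))"
      by (intro mult_left_mono add_mono) simp_all
    also have "\<dots> < r/1024" using r(1) by simp
    finally have "N (y \<otimes> y) < r/1024" using mult_N[OF y'(3) y'(3)] by simp
    then have "y \<otimes> y \<in> B (r/1024)" by (intro B_I mult_V y')
    moreover have "chart_log (y \<otimes> y) = 2 ^ Suc i *\<^sub>R chart_log z"
      using chart_log_mult[OF yZ y'(1) yZ y'(1)] y(2) by (simp flip: scaleR_2)
    ultimately show ?case unfolding sq by blast
  qed
  from this[of j] show ?thesis using z(3,4) chart_log_one by simp
qed

text \<open>Let \<open>z\<close> and \<open>w\<close> be the \<open>2 ^ j\<close>-th roots of
  \<open>g\<close> and of \<open>g ^ m\<close>. Then \<open>z ^ m\<close> and \<open>w\<close>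
  have the same \<open>2 ^ j\<close>-th power, and for large \<open>j\<close> the powers of
  \<open>z\<close> up to \<open>m\<close> are small enough for their logarithms to add up.\<close>

lemma power_relation_mem_log_kernel:
  assumes g: "g \<in> Z" "g \<in> B (r/1024)" and h: "g [^] (m::nat) \<in> B (r/1024)"
  shows "of_nat m *\<^sub>R chart_log g - chart_log (g [^] m) \<in> log_kernel"
proof -
  have B: "y \<in> B (r/64)" "y \<in> B (r/128)" if "y \<in> B (r/1024)" for y using B_mono[OF that] r(1) by auto
  have hZ: "g [^] m \<in> Z" by (rule Z_pow[OF g(1)])
  have t: "tangent (\<lambda>j. (sqroot ^^ j) g) (chart_log g)" by (rule tangent_log[OF B(1)[OF g(2)]])
  have "\<forall>\<^sub>F j in sequentially. (sqroot ^^ j) g [^] i \<in> B (r/4096)" for i :: nat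
    by (rule tangent_B[OF tangent_pow[OF t]]) (use r in simp)
  then have ev1: "\<forall>\<^sub>F j in sequentially. \<forall>i\<in>{..m}. (sqroot ^^ j) g [^] i \<in> B (r/4096)"
    by (intro eventually_ball_finite) auto
  have ev2: "\<forall>\<^sub>F j in sequentially. (sqroot ^^ j) (g [^] m) \<in> B (r/4096)"
    by (rule tangent_B[OF tangent_log[OF B(1)[OF h]]]) (use r in simp)
  obtain j where jj: "(\<forall>i\<in>{..m}. (sqroot ^^ j) g [^] i \<in> B (r/4096)) \<and> (sqroot ^^ j) (g [^] m) \<in> B (r/4096)"
    using eventually_happens'[OF sequentially_bot eventually_conj[OF ev1 ev2]] by blast
  have j: "(sqroot ^^ j) g [^] i \<in> B (r/4096)" if "i \<le> m" for i
    using jj that by blast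
  have jh: "(sqroot ^^ j) (g [^] m) \<in> B (r/4096)" using jj by blast
  define z where "z = (sqroot ^^ j) g"
  define w where "w = (sqroot ^^ j) (g [^] m)"
  have zZ: "z \<in> Z" and wZ: "w \<in> Z"
    unfolding z_def w_def by (rule Z_roots g hZ B h)+
  have "chart_log (z [^] m) = of_nat m *\<^sub>R chart_log z"
  proof (rule chart_log_pow[OF zZ])
    show "z [^] i \<in> B (r/512)" if "i \<le> m" for i
      using j[OF that] unfolding z_def by (rule B_mono) (use r in simp)
  qed
  then have lz: "2 ^ j *\<^sub>R chart_log (z [^] m) = of_nat m *\<^sub>R chart_log g"
    unfolding z_def chart_log_roots[OF B(1)[OF g(2)]] by (simp add: power_divide)
  have lw: "2 ^ j *\<^sub>R chart_log w = chart_log (g [^] m)"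
    unfolding w_def chart_log_roots[OF B(1)[OF h]] by (simp add: power_divide)
  have "(z [^] m) [^] (2 ^ j :: nat) = (z [^] (2 ^ j :: nat)) [^] m"
    using Z_carrier[OF zZ] by (simp add: nat_pow_pow mult.commute)
  also have "\<dots> = w [^] (2 ^ j :: nat)"
    unfolding z_def w_def roots_pow[OF B(1)[OF g(2)]] roots_pow[OF B(1)[OF h]] ..
  finally have "2 ^ j *\<^sub>R chart_log (z [^] m) - 2 ^ j *\<^sub>R chart_log w \<in> log_kernel"
    using j[of m] jh by (intro quotient_mem_log_kernel Z_pow zZ wZ) (simp_all add: z_def w_def)
  then show ?thesis by (simp only: lz lw)
qed

text \<open>Let all \<open>g ^ n k\<close> be small. Then the operators \<open>Ad g ^ n k\<close> are near
  the identity, so \<open>Ad g\<close> is the identity and \<open>g\<close> commutes with a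
  ball of fixed radius. So the logarithms of \<open>g\<close> and of its powers satisfy
  \<open>n k log g - log (g ^ n k) \<in> log_kernel\<close>, and the result for discrete
  subgroups gives \<open>log g = 0\<close>.\<close>

theorem chart_nss:
  assumes n: "strict_mono n" "n 0 = 1" and \<epsilon>: "circle_separated n \<epsilon>" "\<epsilon> > 0"
  shows "\<exists>\<delta>>0. \<delta> \<le> r \<and> (\<forall>g\<in>carrier G. (\<forall>k. g [^] n k \<in> B \<delta>) \<longrightarrow> g = \<one>)"
proof -
  have r8: "r/8192 > 0" using r by simp
  obtain d where d: "d > 0" "\<And>x. x \<in> W \<Longrightarrow> norm x < d \<Longrightarrow>
      (\<forall>k. \<exists>y\<in>W. norm y < d \<and> of_nat (n k) *\<^sub>R x - y \<in> log_kernel) \<Longrightarrow> x = 0"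
    using lattice_nss[OF log_kernel_W log_kernel_0 log_kernel_diff r8 log_kernel_discrete n(1) \<epsilon>] by blast
  define e where "e = min \<epsilon> (1/2)"
  have e: "e > 0" "e \<le> 1/2" "circle_separated n e"
    unfolding e_def using \<epsilon> circle_separated_mono[OF \<epsilon>(1)] by auto
  \<comment> \<open>The bounds serve, in this order, the logarithm, the adjoint operators and the lattice argument.\<close>
  define \<delta> where "\<delta> = min (r/1024) (min (e/6) (d/2))"
  have \<delta>: "\<delta> > 0" "\<delta> \<le> r/1024" "\<delta> \<le> e/6" "\<delta> \<le> d/2" unfolding \<delta>_def using r e d by auto
  have B: "y \<in> B (r/8)" "y \<in> B (r/64)" "y \<in> B (r/1024)" if "y \<in> B \<delta>" for y
    using B_mono[OF that] \<delta>(2) r(1) by auto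
  have "g = \<one>" if gc: "g \<in> carrier G" and gk: "\<And>k. g [^] n k \<in> B \<delta>" for g
  proof -
    have g: "g \<in> B \<delta>" using gk[of 0] n(2) gc by simp
    have Ad_id: "Ad g u = u" if "u \<in> W" for u
    proof (rule linear_nss[OF subspace_W _ W_subset_span _ _ _ n(1) e(3,2) _ that])
      show "finite (bv ` I)" using finite_I by simp
      show "Ad g \<in> W \<rightarrow> W" using Ad_W[OF B(1)[OF g]] by blast
      show "Ad g (x + y) = Ad g x + Ad g y" if "x \<in> W" "y \<in> W" for x y
        by (rule Ad_add[OF B(1)[OF g] that])
      show "Ad g (c *\<^sub>R x) = c *\<^sub>R Ad g x" if "x \<in> W" for c x by (rule Ad_scale[OF B(1)[OF g] that])
      show "norm ((Ad g ^^ n k) u - u) \<le> e / 2 * norm u" if u: "u \<in> W" for k u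
      proof -
        have "(Ad g ^^ n k) u = Ad (g [^] n k) u"
          by (rule Ad_pow[OF B(1)[OF g] B(1)[OF gk] u, symmetric])
        then have "norm ((Ad g ^^ n k) u - u) \<le> 3 * N (g [^] n k) * norm u"
          using Ad_close[OF B(1)[OF gk] u] by simp
        also have "\<dots> \<le> e / 2 * norm u"
          using B_N[OF gk, of k] \<delta>(3) by (intro mult_right_mono) auto
        finally show ?thesis .
      qed
    qed
    have gZ: "g \<in> Z" unfolding Z_def using gc Ad_id_commute[OF B(1)[OF g] Ad_id] by blast
    have lgd: "norm (chart_log y) < d" if "y \<in> B \<delta>" for y
      using chart_log_le[OF B(2)[OF that]] B_N[OF that] \<delta>(4) by linarith
    have "chart_log g = 0"
    proof (rule d(2)[OF chart_log_W[OF B(2)[OF g]] lgd[OF g]], rule allI)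
      fix k
      have "of_nat (n k) *\<^sub>R chart_log g - chart_log (g [^] n k) \<in> log_kernel"
        by (rule power_relation_mem_log_kernel[OF gZ B(3)[OF g] B(3)[OF gk]])
      then show "\<exists>y\<in>W. norm y < d \<and> of_nat (n k) *\<^sub>R chart_log g - y \<in> log_kernel"
        using chart_log_W[OF B(2)[OF gk]] lgd[OF gk] by blast
    qed
    then show "g = \<one>" by (rule chart_log_eq_0D[OF B(2)[OF g]])
  qed
  then show ?thesis using \<delta>(1,2) r(1) by (intro exI[of _ \<delta>]) simp
qed

end

section \<open>Bounded sequences as a Banach space\<close>

text \<open>The sequence space \<open>nat \<Rightarrow>\<^sub>C 'k\<close> is complete as soon as its
  index type is a metric space. The distance of integers induces the discrete topology, so
  every bounded sequence is an element.\<close>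

instantiation nat :: metric_space
begin

definition dist_nat :: "nat \<Rightarrow> nat \<Rightarrow> real" where "dist_nat m n = \<bar>real m - real n\<bar>"

definition uniformity_nat :: "(nat \<times> nat) filter" where
  "uniformity_nat = (INF e\<in>{0<..}. principal {(x, y). dist x y < e})"

instance
proof
  show "open U = (\<forall>x\<in>U. \<forall>\<^sub>F (x', y) in uniformity. x' = x \<longrightarrow> y \<in> U)" for U :: "nat set"
  proof -
    have "\<forall>\<^sub>F (x', y) in uniformity. x' = (y :: nat)"
      unfolding uniformity_nat_def
    proof (rule eventually_INF1)
      show "(1::real) \<in> {0<..}" by simp
      show "\<forall>\<^sub>F (x', y) in principal {(x, y). dist x y < 1}. x' = (y :: nat)"
        by (auto simp: eventually_principal dist_nat_def)
    qed
    then have "\<forall>\<^sub>F (x', y) in uniformity. x' = x \<longrightarrow> y \<in> U" if "x \<in> U" for x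
      by (rule eventually_mono) (use that in auto)
    then show ?thesis by (simp add: open_discrete)
  qed
qed (auto simp: dist_nat_def uniformity_nat_def)

end

instance bcontfun :: (metric_space, banach) banach ..

section \<open>Lie groups satisfy the bilinear estimate\<close>

text \<open>Outside the first \<open>D\<close> coordinates all points of the coordinate space agree, so a
  basic open set of the product topology restricts only finitely many coordinates.\<close>

lemma open_contains_box:
  fixes c :: "nat \<Rightarrow> 'k::real_normed_field"
  assumes "open U" "c \<in> U" "c \<in> coord_space D"
  obtains \<rho> where "\<rho> > 0" "\<And>z. z \<in> coord_space D \<Longrightarrow> (\<And>i. i < D \<Longrightarrow> norm (z i - c i) < \<rho>) \<Longrightarrow> z \<in> U"
proof -
  have "openin (product_topology (\<lambda>i. euclidean) UNIV) U"
    using assms(1) by (simp add: open_fun_def)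
  then obtain X where X: "c \<in> (\<Pi>\<^sub>E i\<in>UNIV. X i)" "\<And>i. open (X i)" "(\<Pi>\<^sub>E i\<in>UNIV. X i) \<subseteq> U"
    using product_topology_open_contains_basis[OF _ assms(2)] by (metis open_openin)
  have "\<exists>e>0. \<forall>y. norm (y - c i) < e \<longrightarrow> y \<in> X i" for i
    using X(1) X(2)[of i] unfolding open_dist by (auto simp: PiE_iff dist_norm)
  then obtain e where e: "\<And>i. e i > 0" "\<And>i y. norm (y - c i) < e i \<Longrightarrow> y \<in> X i" by metis
  define \<rho> where "\<rho> = Min (insert 1 (e ` {..<D}))"
  have \<rho>: "\<rho> > 0" "\<And>i. i < D \<Longrightarrow> \<rho> \<le> e i" unfolding \<rho>_def using e(1) by (auto intro: Min_le)
  have "z \<in> U" if z: "z \<in> coord_space D" "\<And>i. i < D \<Longrightarrow> norm (z i - c i) < \<rho>" for z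
  proof -
    have "z i \<in> X i" for i
    proof (cases "i < D")
      case True
      then show ?thesis using e(2) z(2)[OF True] \<rho>(2)[OF True] by (meson less_le_trans)
    next
      case False
      then have "z i = c i" using z(1) assms(3) by (simp add: coord_space_def)
      then show ?thesis using X(1) by (auto simp: PiE_iff)
    qed
    then show ?thesis using X(3) by (auto simp: PiE_iff)
  qed
  then show thesis using that \<rho>(1) by blast
qed

definition cbox_at :: "nat \<Rightarrow> (nat \<Rightarrow> 'k::real_normed_field) \<Rightarrow> real \<Rightarrow> (nat \<Rightarrow> 'k) set" where
  "cbox_at D c \<rho> = {z \<in> coord_space D. \<forall>i<D. norm (z i - c i) < \<rho>}"

lemma cbox_at_mono: "\<rho> \<le> \<sigma> \<Longrightarrow> cbox_at D c \<rho> \<subseteq> cbox_at D c \<sigma>"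
  by (force simp: cbox_at_def)

lemma cbox_at_upd: "z \<in> cbox_at D c \<rho> \<Longrightarrow> i < D \<Longrightarrow> norm (s - c i) < \<rho> \<Longrightarrow> z(i := s) \<in> cbox_at D c \<rho>"
  by (auto simp: cbox_at_def coord_space_def)

lemma continuous_on_locally_bounded:
  fixes f :: "(nat \<Rightarrow> 'k::real_normed_field) \<Rightarrow> 'k"
  assumes f: "continuous_on S f" and S: "cbox_at D c \<rho> \<subseteq> S" "\<rho> > 0" and c: "c \<in> coord_space D"
  obtains \<sigma> where "\<sigma> > 0" "\<sigma> \<le> \<rho>" "\<And>z. z \<in> cbox_at D c \<sigma> \<Longrightarrow> norm (f z) \<le> norm (f c) + 1"
proof -
  have cS: "c \<in> S" using S c by (auto simp: cbox_at_def)
  obtain U where U: "open U" "c \<in> U" "\<And>z. z \<in> S \<Longrightarrow> z \<in> U \<Longrightarrow> f z \<in> ball (f c) 1"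
    using f cS unfolding continuous_on_topological by (metis centre_in_ball open_ball zero_less_one)
  obtain \<tau> where \<tau>: "\<tau> > 0" "\<And>z. z \<in> coord_space D \<Longrightarrow> (\<And>i. i < D \<Longrightarrow> norm (z i - c i) < \<tau>) \<Longrightarrow> z \<in> U"
    by (rule open_contains_box[OF U(1,2) c]) blast
  have "norm (f z) \<le> norm (f c) + 1" if z: "z \<in> cbox_at D c (min \<rho> \<tau>)" for z
  proof -
    have "z \<in> S" using z S(1) cbox_at_mono[of "min \<rho> \<tau>" \<rho> D c] by auto
    moreover have "z \<in> U" using z \<tau>(2) by (auto simp: cbox_at_def)
    ultimately have "norm (f c - f z) < 1" using U(3) by (auto simp: dist_norm)
    then show ?thesis using norm_triangle_ineq2[of "f z" "f c"] by (simp add: norm_minus_commute)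
  qed
  then show thesis using that[of "min \<rho> \<tau>"] \<tau>(1) S(2) by auto
qed

lemma partial_deriv_has_derivative:
  assumes "(\<lambda>t. f (x(i := t))) field_differentiable at (x i)" and "x i = s"
  shows "((\<lambda>t. f (x(i := t))) has_field_derivative partial_deriv i f x) (at s)"
  using field_differentiable_derivI[OF assms(1)] assms(2) by (simp add: partial_deriv_def)

text \<open>The mean value inequality in two variables: apply it first in direction \<open>i\<close> to
  the partial derivative in direction \<open>l\<close>, then in direction \<open>l\<close> to
  the increment in direction \<open>i\<close>.\<close>

lemma mixed_increment_bound:
  fixes F :: "(nat \<Rightarrow> 'k::real_normed_field) \<Rightarrow> 'k"
  assumes F: "C_diff D 2 S F" and S: "cbox_at D c \<rho> \<subseteq> S"
    and il: "i < D" "l < D" "i \<noteq> l"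
    and K: "\<And>z. z \<in> cbox_at D c \<rho> \<Longrightarrow> norm (partial_deriv i (partial_deriv l F) z) \<le> K"
    and z: "z \<in> cbox_at D c \<rho>"
    and s: "norm (s - c i) < \<rho>" "norm (s' - c i) < \<rho>" and t: "norm (t - c l) < \<rho>" "norm (t' - c l) < \<rho>"
  shows "norm (F (z(i := s, l := t)) - F (z(i := s', l := t)) - F (z(i := s, l := t')) + F (z(i := s', l := t')))
    \<le> K * norm (s - s') * norm (t - t')"
proof -
  have dF: "(\<lambda>t. F (x(l := t))) field_differentiable at (x l)"
    "(\<lambda>t. partial_deriv l F (x(i := t))) field_differentiable at (x i)" if "x \<in> cbox_at D c \<rho>" for x
    using F S il that by (auto simp: numeral_2_eq_2)
  have in_box: "z(i := p, l := q) \<in> cbox_at D c \<rho>" if "norm (p - c i) < \<rho>" "norm (q - c l) < \<rho>" for p q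
    using that z il by (intro cbox_at_upd) auto
  have g: "norm (partial_deriv l F (z(i := s, l := q)) - partial_deriv l F (z(i := s', l := q))) \<le> K * norm (s - s')"
    if q: "norm (q - c l) < \<rho>" for q
  proof (rule field_differentiable_bound[of "ball (c i) \<rho>" "\<lambda>p. partial_deriv l F (z(i := p, l := q))"
        "\<lambda>p. partial_deriv i (partial_deriv l F) (z(i := p, l := q))"])
    fix p assume "p \<in> ball (c i) \<rho>"
    then have x: "z(i := p, l := q) \<in> cbox_at D c \<rho>" using in_box q by (auto simp: dist_norm norm_minus_commute)
    have "((\<lambda>t. partial_deriv l F (z(i := p, l := q, i := t))) has_field_derivative
        partial_deriv i (partial_deriv l F) (z(i := p, l := q))) (at p)"
      by (rule partial_deriv_has_derivative[OF dF(2)[OF x]]) (use il in simp)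
    moreover have "z(i := p, l := q, i := t) = z(i := t, l := q)" for t using il by (auto simp: fun_eq_iff)
    ultimately show "((\<lambda>p. partial_deriv l F (z(i := p, l := q))) has_field_derivative
        partial_deriv i (partial_deriv l F) (z(i := p, l := q))) (at p within ball (c i) \<rho>)"
      by (simp add: has_field_derivative_at_within)
    show "norm (partial_deriv i (partial_deriv l F) (z(i := p, l := q))) \<le> K" by (rule K[OF x])
  qed (use s in \<open>auto simp: dist_norm norm_minus_commute\<close>)
  have "norm ((F (z(i := s, l := t)) - F (z(i := s', l := t))) - (F (z(i := s, l := t')) - F (z(i := s', l := t'))))
      \<le> K * norm (s - s') * norm (t - t')"
  proof (rule field_differentiable_bound[of "ball (c l) \<rho>" "\<lambda>q. F (z(i := s, l := q)) - F (z(i := s', l := q))"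
        "\<lambda>q. partial_deriv l F (z(i := s, l := q)) - partial_deriv l F (z(i := s', l := q))"])
    fix q assume "q \<in> ball (c l) \<rho>"
    then have q: "norm (q - c l) < \<rho>" by (auto simp: dist_norm norm_minus_commute)
    have d: "((\<lambda>q. F (z(i := p, l := q))) has_field_derivative partial_deriv l F (z(i := p, l := q))) (at q)"
      if p: "norm (p - c i) < \<rho>" for p
    proof -
      have "((\<lambda>t. F (z(i := p, l := q, l := t))) has_field_derivative partial_deriv l F (z(i := p, l := q))) (at q)"
        by (rule partial_deriv_has_derivative[OF dF(1)[OF in_box[OF p q]]]) simp
      then show ?thesis by simp
    qed
    show "((\<lambda>q. F (z(i := s, l := q)) - F (z(i := s', l := q))) has_field_derivative
        partial_deriv l F (z(i := s, l := q)) - partial_deriv l F (z(i := s', l := q))) (at q within ball (c l) \<rho>)"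
      by (rule has_field_derivative_at_within[OF DERIV_diff[OF d[OF s(1)] d[OF s(2)]]])
    show "norm (partial_deriv l F (z(i := s, l := q)) - partial_deriv l F (z(i := s', l := q))) \<le> K * norm (s - s')"
      by (rule g[OF q])
  qed (use t in \<open>auto simp: dist_norm norm_minus_commute\<close>)
  then show ?thesis by (simp add: algebra_simps)
qed

lemma double_telescope:
  fixes f :: "nat \<Rightarrow> nat \<Rightarrow> 'b::ab_group_add"
  shows "(\<Sum>p<m. \<Sum>q<k. f (Suc p) (Suc q) - f p (Suc q) - f (Suc p) q + f p q) = f m k - f 0 k - f m 0 + f 0 0"
proof -
  have "(\<Sum>q<k. f (Suc p) (Suc q) - f p (Suc q) - f (Suc p) q + f p q) = (f (Suc p) k - f (Suc p) 0) - (f p k - f p 0)" for p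
    by (induction k) (auto simp: algebra_simps)
  then have "(\<Sum>p<m. \<Sum>q<k. f (Suc p) (Suc q) - f p (Suc q) - f (Suc p) q + f p q)
      = (\<Sum>p<m. (f (Suc p) k - f (Suc p) 0) - (f p k - f p 0))" by simp
  also have "\<dots> = (f m k - f m 0) - (f 0 k - f 0 0)" by (rule sum_lessThan_telescope)
  finally show ?thesis by (simp add: algebra_simps)
qed

text \<open>Move from \<open>a\<close> to \<open>x\<close> and from \<open>a\<close> to \<open>y\<close>
  one coordinate at a time. The mixed increment is the sum of the mixed increments of the
  \<open>d * d\<close> pairs of steps.\<close>

lemma bilinear_increment_bound:
  fixes F :: "(nat \<Rightarrow> 'k::real_normed_field) \<Rightarrow> 'k"
  assumes F: "C_diff (d + d) 2 S F" and S: "cbox_at (d + d) (append_coords d a a) \<rho> \<subseteq> S"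
    and K: "\<And>i l z. i < d + d \<Longrightarrow> l < d + d \<Longrightarrow> z \<in> cbox_at (d + d) (append_coords d a a) \<rho> \<Longrightarrow>
      norm (partial_deriv i (partial_deriv l F) z) \<le> K" "K \<ge> 0"
    and a: "a \<in> coord_space d" and x: "x \<in> cbox_at d a \<rho>" and y: "y \<in> cbox_at d a \<rho>"
    and X: "\<And>i. i < d \<Longrightarrow> norm (x i - a i) \<le> X" and Y: "\<And>i. i < d \<Longrightarrow> norm (y i - a i) \<le> Y"
  shows "norm (F (append_coords d x y) - F (append_coords d a y) - F (append_coords d x a) + F (append_coords d a a))
    \<le> (K * of_nat d * of_nat d) * (X * Y)"
proof (cases "d = 0")
  case True
  have eq: "append_coords d p q = append_coords d a a"
    if "p \<in> coord_space d" "q \<in> coord_space d" for p q :: "nat \<Rightarrow> 'k"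
    using True that a by (auto simp: append_coords_def coord_space_def fun_eq_iff)
  have xd: "x \<in> coord_space d" and yd: "y \<in> coord_space d" using x y by (auto simp: cbox_at_def)
  show ?thesis unfolding eq[OF xd yd] eq[OF a yd] eq[OF xd a] using True by simp
next
  case False
  then have "\<rho> > 0" using x by (auto simp: cbox_at_def dest!: spec[of _ 0] intro: le_less_trans[OF norm_ge_zero])
  have "X \<ge> 0" using X[of 0] False norm_ge_zero[of "x 0 - a 0"] by linarith
  \<comment> \<open>The first \<open>m\<close> coordinates are those of \<open>w\<close>, the others still those of \<open>a\<close>.\<close>
  define hy where "hy w m = (\<lambda>i. if i < m then w i else a i)" for w m
  define \<Phi> where "\<Phi> p q = F (append_coords d (hy x p) (hy y q))" for p q
  have hy0: "hy w 0 = a" for w by (simp add: hy_def)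
  have hyd: "hy w d = w" if "w \<in> cbox_at d a \<rho>" for w
    using that a by (auto simp: hy_def cbox_at_def coord_space_def fun_eq_iff)
  have box: "append_coords d (hy x p) (hy y q) \<in> cbox_at (d + d) (append_coords d a a) \<rho>" for p q
    using x y a \<open>\<rho> > 0\<close> by (auto simp: append_coords_def hy_def cbox_at_def coord_space_def)
  have step: "norm (\<Phi> (Suc p) (Suc q) - \<Phi> p (Suc q) - \<Phi> (Suc p) q + \<Phi> p q) \<le> K * (X * Y)"
    if p: "p < d" and q: "q < d" for p q
  proof -
    define z where "z = append_coords d (hy x p) (hy y q)"
    define c where "c = append_coords d a a"
    have c: "c p = a p" "c (d + q) = a q" using p by (auto simp: c_def append_coords_def)
    have "z(p := x p, d + q := y q) = append_coords d (hy x (Suc p)) (hy y (Suc q))"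
      "z(p := a p, d + q := y q) = append_coords d (hy x p) (hy y (Suc q))"
      "z(p := x p, d + q := a q) = append_coords d (hy x (Suc p)) (hy y q)"
      "z(p := a p, d + q := a q) = append_coords d (hy x p) (hy y q)"
      using p q unfolding z_def by (auto simp: append_coords_def hy_def fun_eq_iff less_Suc_eq)
    then have "\<Phi> (Suc p) (Suc q) - \<Phi> p (Suc q) - \<Phi> (Suc p) q + \<Phi> p q =
      F (z(p := x p, d + q := y q)) - F (z(p := a p, d + q := y q)) - F (z(p := x p, d + q := a q)) + F (z(p := a p, d + q := a q))"
      by (simp add: \<Phi>_def)
    also have "norm \<dots> \<le> K * norm (x p - a p) * norm (y q - a q)"
    proof (rule mixed_increment_bound[OF F S])
      show "z \<in> cbox_at (d + d) (append_coords d a a) \<rho>" unfolding z_def by (rule box)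
    qed (use p q x y \<open>\<rho> > 0\<close> K c in \<open>auto simp: cbox_at_def c_def\<close>)
    also have "\<dots> \<le> K * X * Y"
      using K(2) X[OF p] Y[OF q] \<open>X \<ge> 0\<close> by (intro mult_mono) auto
    finally show ?thesis by (simp add: mult.assoc)
  qed
  have "F (append_coords d x y) - F (append_coords d a y) - F (append_coords d x a) + F (append_coords d a a)
      = \<Phi> d d - \<Phi> 0 d - \<Phi> d 0 + \<Phi> 0 0"
    unfolding \<Phi>_def hy0 hyd[OF x] hyd[OF y] ..
  also have "\<dots> = (\<Sum>p<d. \<Sum>q<d. \<Phi> (Suc p) (Suc q) - \<Phi> p (Suc q) - \<Phi> (Suc p) q + \<Phi> p q)"
    by (rule double_telescope[symmetric])
  also have "norm \<dots> \<le> (\<Sum>p<d. \<Sum>q<d. K * (X * Y))"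
    by (intro sum_norm_le step) auto
  also have "\<dots> = (K * of_nat d * of_nat d) * (X * Y)" by simp
  finally show ?thesis .
qed

text \<open>Coordinate spaces of all dimensions and over both scalar fields are subspaces of one sequence
  space with the supremum norm.\<close>

definition emb :: "nat \<Rightarrow> (nat \<Rightarrow> 'k::{real_normed_field, euclidean_space}) \<Rightarrow> nat \<Rightarrow>\<^sub>C 'k" where
  "emb d u = Bcontfun (\<lambda>i. if i < d then u i else 0)"

lemma apply_emb: "apply_bcontfun (emb d u) i = (if i < d then u i else 0)"
proof -
  have "(\<lambda>i. if i < d then u i else 0) \<in> bcontfun"
  proof (rule bcontfun_normI)
    show "norm (if i < d then u i else 0) \<le> (\<Sum>i<d. norm (u i))" for i
      using member_le_sum[of i "{..<d}" "\<lambda>i. norm (u i)"] by (auto intro: sum_nonneg)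
  qed (simp add: continuous_on_discrete discrete_def open_discrete)
  then show ?thesis unfolding emb_def by (simp add: Bcontfun_inverse)
qed

lemma norm_emb_less:
  assumes "\<rho> > 0" shows "norm (emb d u) < \<rho> \<longleftrightarrow> (\<forall>i<d. norm (u i) < \<rho>)"
proof
  assume "norm (emb d u) < \<rho>"
  then show "\<forall>i<d. norm (u i) < \<rho>"
    using norm_bounded[of "emb d u"] by (metis apply_emb le_less_trans)
next
  assume *: "\<forall>i<d. norm (u i) < \<rho>"
  define m where "m = Max (insert 0 ((\<lambda>i. norm (u i)) ` {..<d}))"
  have "norm (emb d u) \<le> m"
    by (rule norm_bound) (auto simp: apply_emb m_def intro: Max_ge)
  also have "m < \<rho>" unfolding m_def using * assms by auto
  finally show "norm (emb d u) < \<rho>" .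
qed

lemma norm_emb_le: "i < d \<Longrightarrow> norm (u i) \<le> norm (emb d u)"
  using norm_bounded[of "emb d u" i] by (simp add: apply_emb)

lemma emb_norm_le: "0 \<le> b \<Longrightarrow> (\<And>i. i < d \<Longrightarrow> norm (u i) \<le> b) \<Longrightarrow> norm (emb d u) \<le> b"
  by (rule norm_bound) (auto simp: apply_emb)

definition coord_subsp :: "nat \<Rightarrow> (nat \<Rightarrow>\<^sub>C 'k::{real_normed_field, euclidean_space}) set" where
  "coord_subsp d = {f. \<forall>i\<ge>d. apply_bcontfun f i = 0}"

lemma apply_bcontfun_sum: "apply_bcontfun (sum f S) i = (\<Sum>s\<in>S. apply_bcontfun (f s) i)"
  for f :: "'s \<Rightarrow> nat \<Rightarrow>\<^sub>C 'k::real_normed_vector"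
  by (induction S rule: infinite_finite_induct) (auto simp: plus_bcontfun.rep_eq)

lemma coord_subspace_coord_subsp:
  "coord_subspace (coord_subsp d :: (nat \<Rightarrow>\<^sub>C 'k::{real_normed_field, euclidean_space}) set) ({..<d} \<times> Basis)
     (\<lambda>(i, b) f. inner (apply_bcontfun f i) b) (\<lambda>(i, b). emb d (\<lambda>j. if j = i then b else 0))"
proof (rule coord_subspace.intro)
  show "subspace (coord_subsp d :: (nat \<Rightarrow>\<^sub>C 'k) set)"
    unfolding subspace_def coord_subsp_def by (auto simp: plus_bcontfun.rep_eq scaleR_bcontfun.rep_eq zero_bcontfun.rep_eq)
  show "finite ({..<d} \<times> (Basis :: 'k set))" by simp
  fix p :: "nat \<times> 'k" assume "p \<in> {..<d} \<times> Basis"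
  then obtain i b where p: "p = (i, b)" "i < d" "b \<in> Basis" by auto
  have "bounded_linear (\<lambda>f :: nat \<Rightarrow>\<^sub>C 'k. inner (apply_bcontfun f i) b)"
  proof (rule bounded_linear_intro[where K = 1])
    show "norm (inner (apply_bcontfun f i) b) \<le> norm f * 1" for f :: "nat \<Rightarrow>\<^sub>C 'k"
      using Basis_le_norm[OF p(3), of "apply_bcontfun f i"] norm_bounded[of f i] by simp
  qed (auto simp: inner_add_left)
  then show "bounded_linear ((\<lambda>(i, b) f. inner (apply_bcontfun f i) b) p)" unfolding p by simp
next
  fix p :: "nat \<times> 'k" assume "p \<in> {..<d} \<times> Basis"
  then obtain i b where p: "p = (i, b)" "i < d" "b \<in> Basis" by auto
  show "(case p of (i, b) \<Rightarrow> emb d (\<lambda>j. if j = i then b else 0)) \<in> coord_subsp d"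
    by (auto simp: p coord_subsp_def apply_emb)
next
  fix w :: "nat \<Rightarrow>\<^sub>C 'k" assume w: "w \<in> coord_subsp d"
  show "w = (\<Sum>p\<in>{..<d} \<times> Basis. (case p of (i, b) \<Rightarrow> \<lambda>f. inner (apply_bcontfun f i) b) w *\<^sub>R
      (case p of (i, b) \<Rightarrow> emb d (\<lambda>j. if j = i then b else 0)))"
  proof (rule bcontfun_eqI)
    fix j
    have "(\<Sum>p\<in>{..<d} \<times> Basis. inner (apply_bcontfun w (fst p)) (snd p) *\<^sub>R (if j < d then (if j = fst p then snd p else 0) else 0))
       = (\<Sum>i<d. \<Sum>b\<in>Basis. inner (apply_bcontfun w i) b *\<^sub>R (if j < d then (if j = i then b else 0) else 0))"
      by (simp add: sum.cartesian_product split_def)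
    also have "\<dots> = (\<Sum>i<d. if i = j then (\<Sum>b\<in>Basis. inner (apply_bcontfun w i) b *\<^sub>R b) else 0)"
    proof (intro sum.cong refl)
      show "(\<Sum>b\<in>Basis. inner (apply_bcontfun w i) b *\<^sub>R (if j < d then (if j = i then b else 0) else 0))
        = (if i = j then (\<Sum>b\<in>Basis. inner (apply_bcontfun w i) b *\<^sub>R b) else 0)" if "i \<in> {..<d}" for i
        using that by (cases "j = i"; cases "j < d") auto
    qed
    also have "\<dots> = (if j < d then apply_bcontfun w j else 0)"
      by (simp add: euclidean_representation)
    also have "\<dots> = apply_bcontfun w j" using w by (auto simp: coord_subsp_def)
    finally show "apply_bcontfun w j = apply_bcontfun (\<Sum>p\<in>{..<d} \<times> Basis. (case p of (i, b) \<Rightarrow> \<lambda>f. inner (apply_bcontfun f i) b) w *\<^sub>R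
      (case p of (i, b) \<Rightarrow> emb d (\<lambda>j. if j = i then b else 0))) j"
      by (simp add: apply_bcontfun_sum scaleR_bcontfun.rep_eq apply_emb split_def)
  qed
qed

lemma open_coordinate_ball: "open {u :: nat \<Rightarrow> 'k::real_normed_field. norm (u i - a i) < \<rho>}"
proof -
  have "continuous_on UNIV (\<lambda>u :: nat \<Rightarrow> 'k. norm (u i - a i))"
    by (intro continuous_on_norm continuous_on_diff continuous_on_product_coordinates continuous_on_const)
  from open_Collect_less[OF this continuous_on_const] show ?thesis .
qed

text \<open>In the chart the product \<open>F\<close> satisfies \<open>F (x, a) = x\<close> and \<open>F
  (a, y) = y\<close>, where \<open>a\<close> is the image of the unit, so its mixed increment
  is \<open>F (x, y) - x - y + a\<close>. The second partial derivatives are continuous and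
  hence bounded near \<open>(a, a)\<close>. The statement covers the pairs \<open>(x, inv
  x)\<close> separately, because the inverse of an element of the box need not lie in the same
  box.\<close>

lemma smooth_mult_estimate:
  fixes G :: "'a topgroup" (structure) and A :: "('a, 'k::real_normed_field) chart set"
  assumes G: "topological_group G" and A: "smooth_atlas d (gtop G) A"
    and smooth: "smooth_map (d + d) (product_atlas d A A) d A (\<lambda>(x, y). x \<otimes> y)"
    and V: "(V, \<phi>) \<in> A" "\<one> \<in> V"
  obtains \<rho> C where "\<rho> > 0" "C > 0"
    "\<And>u. u \<in> cbox_at d (\<phi> \<one>) \<rho> \<Longrightarrow> \<exists>x\<in>V. \<phi> x = u"
    "\<And>x. x \<in> V \<Longrightarrow> \<phi> x \<in> cbox_at d (\<phi> \<one>) \<rho> \<Longrightarrow> inv x \<in> V"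
    "\<And>x y. x \<in> V \<Longrightarrow> \<phi> x \<in> cbox_at d (\<phi> \<one>) \<rho> \<Longrightarrow> y \<in> V \<Longrightarrow>
        \<phi> y \<in> cbox_at d (\<phi> \<one>) \<rho> \<or> y = inv x \<Longrightarrow> x \<otimes> y \<in> V"
    "\<And>x y X Y j. x \<in> V \<Longrightarrow> \<phi> x \<in> cbox_at d (\<phi> \<one>) \<rho> \<Longrightarrow> y \<in> V \<Longrightarrow>
        \<phi> y \<in> cbox_at d (\<phi> \<one>) \<rho> \<or> y = inv x \<Longrightarrow> j < d \<Longrightarrow>
        (\<And>i. i < d \<Longrightarrow> norm (\<phi> x i - \<phi> \<one> i) \<le> X) \<Longrightarrow> (\<And>i. i < d \<Longrightarrow> norm (\<phi> y i - \<phi> \<one> i) \<le> Y) \<Longrightarrow>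
        norm (\<phi> (x \<otimes> y) j - \<phi> x j - \<phi> y j + \<phi> \<one> j) \<le> C * (X * Y)"
proof -
  interpret topological_group G by fact
  have homeo: "homeomorphic_map (subtopology (gtop G) V) (top_of_set (\<phi> ` V)) \<phi>"
    and openV: "openin (gtop G) V" and open\<phi>V: "openin (top_of_set (coord_space d)) (\<phi> ` V)"
    using A V(1) by (auto simp: smooth_atlas_def)
  have VG: "V \<subseteq> carrier G" using openV openin_subset topspace_gtop by metis
  have "topspace (subtopology (gtop G) V) = V" using VG by (simp add: topspace_gtop Int_absorb1)
  then have inj: "inj_on \<phi> V" using homeo homeomorphic_imp_injective_map by metis
  define a where "a = \<phi> \<one>"
  have \<phi>_coord: "\<phi> x \<in> coord_space d" if "x \<in> V" for x
    using open\<phi>V that by (auto dest: openin_imp_subset)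
  have a: "a \<in> coord_space d" unfolding a_def by (rule \<phi>_coord[OF V(2)])
  have nbhd_box: "\<exists>\<rho>>0. \<forall>u\<in>cbox_at d a \<rho>. \<exists>x\<in>O' \<inter> V. \<phi> x = u"
    if O': "openin (gtop G) O'" "\<one> \<in> O'" for O'
  proof -
    have "openin (subtopology (gtop G) V) (O' \<inter> V)" using O'(1) by (rule openin_subtopology_Int)
    then have "openin (top_of_set (\<phi> ` V)) (\<phi> ` (O' \<inter> V))"
      using homeomorphic_map_openness_eq[OF homeo] by blast
    then have "openin (top_of_set (coord_space d)) (\<phi> ` (O' \<inter> V))" using open\<phi>V openin_trans by blast
    then obtain U where U: "open U" "\<phi> ` (O' \<inter> V) = coord_space d \<inter> U" by (auto simp: openin_open)
    have "a \<in> U" using U(2) O'(2) V(2) unfolding a_def by blast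
    then obtain \<rho> where "\<rho> > 0" "\<And>z. z \<in> coord_space d \<Longrightarrow> (\<And>i. i < d \<Longrightarrow> norm (z i - a i) < \<rho>) \<Longrightarrow> z \<in> U"
      using open_contains_box[OF U(1) _ a] by metis
    then have "\<forall>u\<in>cbox_at d a \<rho>. u \<in> \<phi> ` (O' \<inter> V)" unfolding U(2) by (auto simp: cbox_at_def)
    then show ?thesis using \<open>\<rho> > 0\<close> by (metis imageE)
  qed
  define P where "P = {p \<in> topspace (prod_topology (gtop G) (gtop G)). (case p of (x, y) \<Rightarrow> x \<otimes> y) \<in> V}"
  have P: "openin (prod_topology (gtop G) (gtop G)) P"
    unfolding P_def using continuous_mult openV by (rule openin_continuous_map_preimage)
  have "(\<one>, \<one>) \<in> P" unfolding P_def using V(2) by (simp add: topspace_gtop)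
  from P[unfolded openin_prod_topology_alt, rule_format, OF this]
  obtain O1 O2 where O12: "openin (gtop G) O1" "openin (gtop G) O2" "\<one> \<in> O1" "\<one> \<in> O2" "O1 \<times> O2 \<subseteq> P"
    by blast
  have mV: "x \<otimes> y \<in> V" if "x \<in> O1 \<inter> O2" "y \<in> O1 \<inter> O2" for x y
    using O12(5) that unfolding P_def by auto
  have "openin (gtop G) (O1 \<inter> O2)" "\<one> \<in> O1 \<inter> O2" using O12 by auto
  from nbhd_box[OF this] obtain \<rho>1 where \<rho>1: "\<rho>1 > 0" "\<And>u. u \<in> cbox_at d a \<rho>1 \<Longrightarrow> \<exists>x\<in>(O1 \<inter> O2) \<inter> V. \<phi> x = u"
    by blast
  have \<rho>1': "x \<in> O1 \<inter> O2" if "x \<in> V" "\<phi> x \<in> cbox_at d a \<rho>1" for x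
    using \<rho>1(2)[OF that(2)] that(1) inj by (auto dest: inj_onD)
  define \<Phi> where "\<Phi> = (\<lambda>(x, y). append_coords d (\<phi> x) (\<phi> y))"
  define S where "S = \<Phi> ` {p \<in> V \<times> V. (case p of (x, y) \<Rightarrow> x \<otimes> y) \<in> V}"
  define F where "F j z = \<phi> (case inv_into (V \<times> V) \<Phi> z of (x, y) \<Rightarrow> x \<otimes> y) j" for j z
  have "(V \<times> V, \<Phi>) \<in> product_atlas d A A" unfolding product_atlas_def \<Phi>_def using V(1) by blast
  then have "smooth_on_coords (d + d) d S (\<phi> \<circ> (\<lambda>(x, y). x \<otimes> y) \<circ> inv_into (V \<times> V) \<Phi>)"
    using smooth V(1) unfolding smooth_map_def S_def by fast
  then have smoothF: "C_diff (d + d) 2 S (F j)" if "j < d" for j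
    using that unfolding smooth_on_coords_def F_def[abs_def] o_def by blast
  have inj\<Phi>: "inj_on \<Phi> (V \<times> V)"
  proof (rule inj_onI)
    fix p q assume p: "p \<in> V \<times> V" and q: "q \<in> V \<times> V" and eq: "\<Phi> p = \<Phi> q"
    have c: "\<phi> (fst p) \<in> coord_space d" "\<phi> (fst q) \<in> coord_space d" "\<phi> (snd p) \<in> coord_space d" "\<phi> (snd q) \<in> coord_space d"
      using p q \<phi>_coord by auto
    have "\<phi> (fst p) i = \<phi> (fst q) i" for i
      using fun_cong[OF eq, of i] c by (cases "i < d") (auto simp: \<Phi>_def append_coords_def split_def coord_space_def)
    moreover have "\<phi> (snd p) i = \<phi> (snd q) i" for i
      using fun_cong[OF eq, of "d + i"] by (simp add: \<Phi>_def append_coords_def split_def)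
    ultimately have "\<phi> (fst p) = \<phi> (fst q)" "\<phi> (snd p) = \<phi> (snd q)" by blast+
    then show "p = q" using p q inj by (auto simp: prod_eq_iff dest: inj_onD)
  qed
  have F: "F j (append_coords d (\<phi> x) (\<phi> y)) = \<phi> (x \<otimes> y) j" if "x \<in> V" "y \<in> V" for x y j
    using inv_into_f_f[OF inj\<Phi>, of "(x, y)"] that by (simp add: F_def \<Phi>_def)
  define c where "c = append_coords d a a"
  have c: "c \<in> coord_space (d + d)" using a by (auto simp: c_def append_coords_def coord_space_def)
  have box_S: "cbox_at (d + d) c \<rho>1 \<subseteq> S"
  proof
    fix z assume z: "z \<in> cbox_at (d + d) c \<rho>1"
    define u where "u = (\<lambda>i. if i < d then z i else 0)"
    define v where "v = (\<lambda>i. z (d + i))"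
    have zi: "norm (z i - c i) < \<rho>1" if "i < d + d" for i using z that by (simp add: cbox_at_def)
    have "norm (z i - a i) < \<rho>1" if "i < d" for i
      using zi[of i] that by (simp add: c_def append_coords_def)
    then have "u \<in> cbox_at d a \<rho>1" unfolding u_def cbox_at_def coord_space_def by simp
    moreover have "norm (z (d + i) - a i) < \<rho>1" if "i < d" for i
      using zi[of "d + i"] that by (simp add: c_def append_coords_def)
    then have "v \<in> cbox_at d a \<rho>1" using z unfolding v_def cbox_at_def coord_space_def by simp
    ultimately obtain x y where xy: "x \<in> O1 \<inter> O2" "x \<in> V" "\<phi> x = u" "y \<in> O1 \<inter> O2" "y \<in> V" "\<phi> y = v"
      using \<rho>1(2) by (metis IntE IntI)
    have "z = \<Phi> (x, y)" unfolding \<Phi>_def by (simp add: xy u_def v_def append_coords_def fun_eq_iff)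
    moreover have "x \<otimes> y \<in> V" by (rule mV[OF xy(1,4)])
    ultimately show "z \<in> S" unfolding S_def
      by (intro image_eqI[of _ _ "(x, y)"] CollectI) (simp_all add: xy)
  qed
  have "\<exists>\<sigma>>0. \<sigma> \<le> \<rho>1 \<and> (\<forall>z\<in>cbox_at (d + d) c \<sigma>. norm (partial_deriv i (partial_deriv l (F j)) z) \<le> norm (partial_deriv i (partial_deriv l (F j)) c) + 1)"
    if "i < d + d" "l < d + d" "j < d" for i l j
  proof -
    have "continuous_on S (partial_deriv i (partial_deriv l (F j)))"
      using smoothF[OF that(3)] that(1,2) by (simp add: numeral_2_eq_2)
    from continuous_on_locally_bounded[OF this box_S \<rho>1(1) c] show ?thesis by metis
  qed
  then obtain \<sigma> where \<sigma>: "\<And>i l j. i < d + d \<Longrightarrow> l < d + d \<Longrightarrow> j < d \<Longrightarrow> \<sigma> i l j > 0 \<and> \<sigma> i l j \<le> \<rho>1 \<and>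
      (\<forall>z\<in>cbox_at (d + d) c (\<sigma> i l j). norm (partial_deriv i (partial_deriv l (F j)) z) \<le> norm (partial_deriv i (partial_deriv l (F j)) c) + 1)"
    by metis
  define T where "T = {..<d + d} \<times> {..<d + d} \<times> {..<d}"
  have finT: "finite T" by (simp add: T_def)
  define \<rho>2 where "\<rho>2 = Min (insert \<rho>1 ((\<lambda>(i, l, j). \<sigma> i l j) ` T))"
  define K where "K = Max (insert 0 ((\<lambda>(i, l, j). norm (partial_deriv i (partial_deriv l (F j)) c) + 1) ` T))"
  have \<rho>2: "\<rho>2 > 0" "\<rho>2 \<le> \<rho>1" unfolding \<rho>2_def using finT \<rho>1(1) \<sigma> by (auto simp: T_def)
  have "K \<ge> 0" unfolding K_def using finT by simp
  have bound: "norm (partial_deriv i (partial_deriv l (F j)) z) \<le> K"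
    if "i < d + d" "l < d + d" "j < d" "z \<in> cbox_at (d + d) c \<rho>2" for i l j z
  proof -
    have ilj: "(i, l, j) \<in> T" using that by (simp add: T_def)
    then have "\<sigma> i l j \<in> insert \<rho>1 ((\<lambda>(i, l, j). \<sigma> i l j) ` T)" by force
    then have "\<rho>2 \<le> \<sigma> i l j" unfolding \<rho>2_def using finT by (intro Min_le) auto
    then have "z \<in> cbox_at (d + d) c (\<sigma> i l j)" using that(4) cbox_at_mono by blast
    then have "norm (partial_deriv i (partial_deriv l (F j)) z) \<le> norm (partial_deriv i (partial_deriv l (F j)) c) + 1"
      using \<sigma>[OF that(1-3)] by blast
    also have "norm (partial_deriv i (partial_deriv l (F j)) c) + 1 \<in> insert 0 ((\<lambda>(i, l, j). norm (partial_deriv i (partial_deriv l (F j)) c) + 1) ` T)"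
      using ilj by force
    then have "norm (partial_deriv i (partial_deriv l (F j)) c) + 1 \<le> K" unfolding K_def using finT by (intro Max_ge) auto
    finally show ?thesis .
  qed
  \<comment> \<open>Inversion is continuous, so it maps a smaller box into the box where the derivatives are bounded.\<close>
  obtain \<rho>3 where \<rho>3: "\<rho>3 > 0" "\<And>x. x \<in> V \<Longrightarrow> \<phi> x \<in> cbox_at d a \<rho>3 \<Longrightarrow> inv x \<in> V \<and> \<phi> (inv x) \<in> cbox_at d a \<rho>2"
  proof -
    define B where "B = {u \<in> \<phi> ` V. \<forall>i<d. norm (u i - a i) < \<rho>2}"
    define Q where "Q = {x \<in> topspace (gtop G). inv x \<in> {x \<in> topspace (subtopology (gtop G) V). \<phi> x \<in> B}}"
    have "open (\<Inter>i\<in>{..<d}. {u :: nat \<Rightarrow> 'k. norm (u i - a i) < \<rho>2})"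
      by (intro open_INT ballI finite_lessThan open_coordinate_ball)
    then have "openin (top_of_set (\<phi> ` V)) (\<phi> ` V \<inter> (\<Inter>i\<in>{..<d}. {u. norm (u i - a i) < \<rho>2}))"
      by (rule openin_open_Int)
    moreover have "B = \<phi> ` V \<inter> (\<Inter>i\<in>{..<d}. {u. norm (u i - a i) < \<rho>2})" by (auto simp: B_def)
    ultimately have "openin (top_of_set (\<phi> ` V)) B" by (simp only:)
    then have "openin (subtopology (gtop G) V) {x \<in> topspace (subtopology (gtop G) V). \<phi> x \<in> B}"
      by (rule openin_continuous_map_preimage[OF homeomorphic_imp_continuous_map[OF homeo]])
    then have "openin (gtop G) {x \<in> topspace (subtopology (gtop G) V). \<phi> x \<in> B}"
      using openV by (rule openin_trans_full)
    then have "openin (gtop G) {x \<in> topspace (gtop G). inv x \<in> {x \<in> topspace (subtopology (gtop G) V). \<phi> x \<in> B}}"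
      by (rule openin_continuous_map_preimage[OF continuous_inv])
    then have Q: "openin (gtop G) Q" by (simp only: Q_def)
    have "\<one> \<in> Q" unfolding Q_def
      using V(2) \<rho>2(1) by (auto simp: topspace_gtop B_def a_def)
    from nbhd_box[OF Q this] obtain \<rho> where \<rho>: "\<rho> > 0" "\<forall>u\<in>cbox_at d a \<rho>. \<exists>x\<in>Q \<inter> V. \<phi> x = u"
      by (elim exE conjE)
    show thesis
    proof (rule that[OF \<rho>(1)])
      fix x assume x: "x \<in> V" "\<phi> x \<in> cbox_at d a \<rho>"
      obtain y where "y \<in> Q" and y: "y \<in> V" "\<phi> y = \<phi> x" using \<rho>(2) x(2) by blast
      then have y': "inv y \<in> V" "\<phi> (inv y) \<in> B" by (auto simp: Q_def)
      have "y = x" by (rule inj_onD[OF inj y(2,1) x(1)])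
      then show "inv x \<in> V \<and> \<phi> (inv x) \<in> cbox_at d a \<rho>2"
        using y' \<phi>_coord by (auto simp: B_def cbox_at_def)
    qed
  qed
  define \<rho> where "\<rho> = min \<rho>2 \<rho>3"
  have sub2: "cbox_at d a \<rho> \<subseteq> cbox_at d a \<rho>2" and sub3: "cbox_at d a \<rho> \<subseteq> cbox_at d a \<rho>3"
    and sub1: "cbox_at d a \<rho>2 \<subseteq> cbox_at d a \<rho>1"
    unfolding \<rho>_def using \<rho>2(2) by (intro cbox_at_mono; simp)+
  define C where "C = K * of_nat d * of_nat d + 1"
  show thesis
  proof (rule that[of \<rho> C])
    show "\<rho> > 0" using \<rho>2(1) \<rho>3(1) by (simp add: \<rho>_def)
    show "C > 0" unfolding C_def using \<open>K \<ge> 0\<close> by (intro add_nonneg_pos) auto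
    show "\<exists>x\<in>V. \<phi> x = u" if "u \<in> cbox_at d (\<phi> \<one>) \<rho>" for u
      using \<rho>1(2)[of u] that sub1 sub2 unfolding a_def by blast
    show "inv x \<in> V" if "x \<in> V" "\<phi> x \<in> cbox_at d (\<phi> \<one>) \<rho>" for x
      using \<rho>3(2)[of x] that sub3 unfolding a_def by blast
    have box2: "\<phi> x \<in> cbox_at d a \<rho>2 \<and> \<phi> y \<in> cbox_at d a \<rho>2"
      if "x \<in> V" "\<phi> x \<in> cbox_at d (\<phi> \<one>) \<rho>" "\<phi> y \<in> cbox_at d (\<phi> \<one>) \<rho> \<or> y = inv x" for x y
      using \<rho>3(2)[of x] that sub2 sub3 unfolding a_def by blast
    show mult: "x \<otimes> y \<in> V" if "x \<in> V" "\<phi> x \<in> cbox_at d (\<phi> \<one>) \<rho>" "y \<in> V" "\<phi> y \<in> cbox_at d (\<phi> \<one>) \<rho> \<or> y = inv x" for x y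
      using box2[OF that(1,2,4)] sub1 that by (intro mV \<rho>1') auto
    show "norm (\<phi> (x \<otimes> y) j - \<phi> x j - \<phi> y j + \<phi> \<one> j) \<le> C * (X * Y)"
      if x: "x \<in> V" "\<phi> x \<in> cbox_at d (\<phi> \<one>) \<rho>" and y: "y \<in> V" "\<phi> y \<in> cbox_at d (\<phi> \<one>) \<rho> \<or> y = inv x"
        and j: "j < d" and X: "\<And>i. i < d \<Longrightarrow> norm (\<phi> x i - \<phi> \<one> i) \<le> X"
        and Y: "\<And>i. i < d \<Longrightarrow> norm (\<phi> y i - \<phi> \<one> i) \<le> Y" for x y X Y j
    proof -
      have xc: "x \<in> carrier G" and yc: "y \<in> carrier G" using x y VG by auto
      have "norm (F j (append_coords d (\<phi> x) (\<phi> y)) - F j (append_coords d a (\<phi> y)) - F j (append_coords d (\<phi> x) a) + F j (append_coords d a a))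
          \<le> (K * of_nat d * of_nat d) * (X * Y)"
      proof (rule bilinear_increment_bound[OF smoothF[OF j]])
        show "cbox_at (d + d) (append_coords d a a) \<rho>2 \<subseteq> S"
          using box_S cbox_at_mono[OF \<rho>2(2)] unfolding c_def by blast
        show "norm (partial_deriv i (partial_deriv l (F j)) z) \<le> K"
          if "i < d + d" "l < d + d" "z \<in> cbox_at (d + d) (append_coords d a a) \<rho>2" for i l z
          by (rule bound[OF that(1,2) j]) (use that(3) in \<open>simp add: c_def\<close>)
      qed (use \<open>K \<ge> 0\<close> a box2[OF x y(2)] X Y in \<open>auto simp: a_def\<close>)
      also have "F j (append_coords d (\<phi> x) (\<phi> y)) = \<phi> (x \<otimes> y) j" by (rule F[OF x(1) y(1)])
      also have "F j (append_coords d a (\<phi> y)) = \<phi> y j" unfolding a_def using F[OF V(2) y(1)] yc by simp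
      also have "F j (append_coords d (\<phi> x) a) = \<phi> x j" unfolding a_def using F[OF x(1) V(2)] xc by simp
      also have "F j (append_coords d a a) = \<phi> \<one> j" unfolding a_def using F[OF V(2) V(2)] by simp
      also have "\<phi> (x \<otimes> y) j - \<phi> y j - \<phi> x j + \<phi> \<one> j = \<phi> (x \<otimes> y) j - \<phi> x j - \<phi> y j + \<phi> \<one> j" by simp
      finally have "norm (\<phi> (x \<otimes> y) j - \<phi> x j - \<phi> y j + \<phi> \<one> j) \<le> (K * of_nat d * of_nat d) * (X * Y)" .
      moreover have "X * Y \<ge> 0"
        using X[OF j] Y[OF j] by (intro mult_nonneg_nonneg) (auto intro: order_trans[OF norm_ge_zero])
      ultimately show ?thesis unfolding C_def by (simp add: distrib_right)
    qed
  qed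
qed

text \<open>Centre the chart at the unit and multiply it by the constant \<open>C\<close> of the bilinear
  estimate; then the estimate holds with constant 1.\<close>

theorem lie_group_nss:
  fixes G :: "'a topgroup" (structure)
  assumes G: "lie_group TYPE('k::{real_normed_field, euclidean_space}) G"
    and n: "strict_mono n" "n 0 = 1" and \<epsilon>: "circle_separated n \<epsilon>" "\<epsilon> > 0"
  shows "nss G n"
proof -
  have "topological_group G" using G by (simp add: lie_group_def)
  then interpret topological_group G .
  obtain d and A :: "('a, 'k) chart set" where A: "smooth_atlas d (gtop G) A"
    "smooth_map (d + d) (product_atlas d A A) d A (\<lambda>(x, y). x \<otimes> y)"
    using G by (auto simp: lie_group_def)
  have "(\<Union>(V, \<phi>)\<in>A. V) = carrier G" using A(1) by (simp add: smooth_atlas_def topspace_gtop)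
  then obtain V \<phi> where V: "(V, \<phi>) \<in> A" "\<one> \<in> V" using one_closed by fast
  have homeo: "homeomorphic_map (subtopology (gtop G) V) (top_of_set (\<phi> ` V)) \<phi>"
    and openV: "openin (gtop G) V" and open\<phi>V: "openin (top_of_set (coord_space d)) (\<phi> ` V)"
    using A V(1) by (auto simp: smooth_atlas_def)
  have VG: "V \<subseteq> carrier G" using openV openin_subset topspace_gtop by metis
  have topV: "topspace (subtopology (gtop G) V) = V" using VG by (simp add: topspace_gtop Int_absorb1)
  then have inj: "inj_on \<phi> V" using homeo homeomorphic_imp_injective_map by metis
  have \<phi>_coord: "\<phi> x \<in> coord_space d" if "x \<in> V" for x
    using open\<phi>V that by (auto dest: openin_imp_subset)
  define a where "a = \<phi> \<one>"
  obtain \<rho> C where \<rho>: "\<rho> > 0" and C: "C > 0"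
    and onto: "\<And>u. u \<in> cbox_at d a \<rho> \<Longrightarrow> \<exists>x\<in>V. \<phi> x = u"
    and invV: "\<And>x. x \<in> V \<Longrightarrow> \<phi> x \<in> cbox_at d a \<rho> \<Longrightarrow> inv x \<in> V"
    and multV: "\<And>x y. x \<in> V \<Longrightarrow> \<phi> x \<in> cbox_at d a \<rho> \<Longrightarrow> y \<in> V \<Longrightarrow>
        \<phi> y \<in> cbox_at d a \<rho> \<or> y = inv x \<Longrightarrow> x \<otimes> y \<in> V"
    and est: "\<And>x y X Y j. x \<in> V \<Longrightarrow> \<phi> x \<in> cbox_at d a \<rho> \<Longrightarrow> y \<in> V \<Longrightarrow>
        \<phi> y \<in> cbox_at d a \<rho> \<or> y = inv x \<Longrightarrow> j < d \<Longrightarrow>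
        (\<And>i. i < d \<Longrightarrow> norm (\<phi> x i - a i) \<le> X) \<Longrightarrow> (\<And>i. i < d \<Longrightarrow> norm (\<phi> y i - a i) \<le> Y) \<Longrightarrow>
        norm (\<phi> (x \<otimes> y) j - \<phi> x j - \<phi> y j + a j) \<le> C * (X * Y)"
    unfolding a_def by (rule smooth_mult_estimate[OF \<open>topological_group G\<close> A V]) blast
  define E where "E x = emb d (\<lambda>i. \<phi> x i - a i)" for x
  define f where "f x = C *\<^sub>R E x" for x
  \<comment> \<open>Norms in the rescaled chart are \<open>C\<close> times the original ones.\<close>
  define r where "r = min (1/100) (C * \<rho>)"
  have r: "r > 0" "r \<le> 1/100" "r \<le> C * \<rho>" unfolding r_def using C \<rho> by auto
  have Nf: "norm (f x) = C * norm (E x)" for x unfolding f_def using C by simp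
  have f_box: "\<phi> x \<in> cbox_at d a \<rho>" if "x \<in> V" "norm (f x) < r" for x
  proof -
    have "C * norm (E x) < C * \<rho>" using that(2) r(3) Nf by simp
    then have "norm (E x) < \<rho>" using C by simp
    then show ?thesis using \<phi>_coord[OF that(1)] \<rho> by (simp add: E_def norm_emb_less cbox_at_def)
  qed
  have f_est: "norm (f (x \<otimes> y) - f x - f y) \<le> norm (f x) * norm (f y)"
    if x: "x \<in> V" "norm (f x) < r" and y: "y \<in> V" "norm (f y) < r \<or> y = inv x" for x y
  proof -
    have y': "\<phi> y \<in> cbox_at d a \<rho> \<or> y = inv x" using y f_box by blast
    have "norm (emb d (\<lambda>j. \<phi> (x \<otimes> y) j - \<phi> x j - \<phi> y j + a j)) \<le> C * (norm (E x) * norm (E y))"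
    proof (rule emb_norm_le)
      show "0 \<le> C * (norm (E x) * norm (E y))" using C by simp
      show "norm (\<phi> (x \<otimes> y) j - \<phi> x j - \<phi> y j + a j) \<le> C * (norm (E x) * norm (E y))" if "j < d" for j
        using norm_emb_le[of _ d "\<lambda>i. \<phi> x i - a i"] norm_emb_le[of _ d "\<lambda>i. \<phi> y i - a i"]
        unfolding E_def by (intro est[OF x(1) f_box[OF x] y(1) y' that])
    qed
    moreover have "emb d (\<lambda>j. \<phi> (x \<otimes> y) j - \<phi> x j - \<phi> y j + a j) = E (x \<otimes> y) - E x - E y"
      by (rule bcontfun_eqI) (simp add: E_def apply_emb minus_bcontfun.rep_eq)
    ultimately have "C * norm (E (x \<otimes> y) - E x - E y) \<le> C * (C * (norm (E x) * norm (E y)))"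
      using C by simp
    moreover have "f (x \<otimes> y) - f x - f y = C *\<^sub>R (E (x \<otimes> y) - E x - E y)"
      by (simp add: f_def scaleR_diff_right)
    ultimately show ?thesis using C by (simp add: Nf mult_ac)
  qed
  have f_one: "f \<one> = 0"
    unfolding f_def E_def a_def by (simp add: bcontfun_eqI[of "emb d (\<lambda>i. 0)" 0] apply_emb zero_bcontfun.rep_eq)
  interpret chart_group G "coord_subsp d :: (nat \<Rightarrow>\<^sub>C 'k) set" "{..<d} \<times> Basis"
    "\<lambda>(i, b) f. inner (apply_bcontfun f i) b" "\<lambda>(i, b). emb d (\<lambda>j. if j = i then b else 0)" V f r
  proof (intro chart_group.intro chart_group_axioms.intro coord_subspace_coord_subsp)
    show "group G" by (rule is_group)
    show "V \<subseteq> carrier G" by (rule VG)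
    show "inj_on f V"
    proof (rule inj_onI)
      fix x y assume xy: "x \<in> V" "y \<in> V" "f x = f y"
      have "E x = E y" using xy(3) C by (simp add: f_def)
      have "\<phi> x i = \<phi> y i" for i
      proof (cases "i < d")
        case True
        then show ?thesis using arg_cong[OF \<open>E x = E y\<close>, of "\<lambda>g. apply_bcontfun g i"] by (simp add: E_def apply_emb)
      next
        case False
        then show ?thesis using \<phi>_coord xy by (auto simp: coord_space_def)
      qed
      then show "x = y" using xy inj by (auto dest: inj_onD)
    qed
    show "f x \<in> coord_subsp d" for x
      unfolding f_def E_def coord_subsp_def by (simp add: apply_emb scaleR_bcontfun.rep_eq)
    show "\<exists>x\<in>V. f x = w" if w: "w \<in> coord_subsp d" "norm w < r" for w
    proof -
      define u where "u = (\<lambda>i. if i < d then a i + inverse C *\<^sub>R apply_bcontfun w i else 0)"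
      have "norm (u i - a i) < \<rho>" if "i < d" for i
      proof -
        have "norm (u i - a i) = inverse C * norm (apply_bcontfun w i)" using that C by (simp add: u_def)
        also have "\<dots> \<le> inverse C * norm w" using C norm_bounded[of w i] by (intro mult_left_mono) auto
        also have "\<dots> < inverse C * (C * \<rho>)" using C w(2) r(3) by (intro mult_strict_left_mono) auto
        also have "\<dots> = \<rho>" using C by (simp flip: mult.assoc)
        finally show ?thesis .
      qed
      then have "u \<in> cbox_at d a \<rho>" by (auto simp: cbox_at_def coord_space_def u_def)
      then obtain x where x: "x \<in> V" "\<phi> x = u" using onto by blast
      have "f x = w"
        using w(1) C by (intro bcontfun_eqI)
          (auto simp: f_def E_def x(2) u_def apply_emb scaleR_bcontfun.rep_eq coord_subsp_def)
      then show ?thesis using x(1) by blast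
    qed
    show "\<one> \<in> V" by (rule V(2))
    show "f \<one> = 0" by (rule f_one)
    show "0 < r" "r \<le> 1/100" by (rule r)+
    show "x \<otimes> y \<in> V \<and> norm (f (x \<otimes> y) - f x - f y) \<le> norm (f x) * norm (f y)"
      if "x \<in> V" "y \<in> V" "norm (f x) < r" "norm (f y) < r" for x y
      using f_est[of x y] multV[of x y] f_box that by blast
    show "inv x \<in> V \<and> norm (f (inv x)) \<le> 2 * norm (f x)" if x: "x \<in> V" "norm (f x) < r" for x
    proof
      show iV: "inv x \<in> V" by (rule invV[OF x(1) f_box[OF x]])
      have "norm (f (x \<otimes> inv x) - f x - f (inv x)) \<le> norm (f x) * norm (f (inv x))"
        using f_est[OF x iV] by blast
      moreover have "x \<otimes> inv x = \<one>" using x(1) VG by auto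
      ultimately have "norm (- f x - f (inv x)) \<le> norm (f x) * norm (f (inv x))" by (simp add: f_one)
      moreover have "norm (f (inv x)) \<le> norm (f x) + norm (- f x - f (inv x))"
        using norm_triangle_ineq4[of "- f x" "- f x - f (inv x)"] by simp
      moreover have "norm (f x) * norm (f (inv x)) \<le> 1/100 * norm (f (inv x))"
        using x(2) r(2) by (intro mult_right_mono) auto
      ultimately show "norm (f (inv x)) \<le> 2 * norm (f x)" using norm_ge_zero[of "f x"] by argo
    qed
  qed
  obtain \<delta> where \<delta>: "\<delta> > 0" "\<And>g. g \<in> carrier G \<Longrightarrow> (\<forall>k. g [^] n k \<in> B \<delta>) \<Longrightarrow> g = \<one>"
    using chart_nss[OF n \<epsilon>] by blast
  have B_eq: "B \<delta> = {x \<in> topspace (subtopology (gtop G) V). \<phi> x \<in> \<phi> ` V \<inter> (\<Inter>i\<in>{..<d}. {u. norm (u i - a i) < \<delta> / C})}"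
  proof -
    have "norm (f x) < \<delta> \<longleftrightarrow> (\<forall>i<d. norm (\<phi> x i - a i) < \<delta> / C)" for x
    proof -
      have "norm (f x) < \<delta> \<longleftrightarrow> norm (E x) < \<delta> / C" unfolding Nf using C by (simp add: pos_less_divide_eq mult.commute)
      then show ?thesis unfolding E_def using C \<delta>(1) by (simp add: norm_emb_less)
    qed
    then show ?thesis unfolding B_def topV by auto
  qed
  have "open (\<Inter>i\<in>{..<d}. {u :: nat \<Rightarrow> 'k. norm (u i - a i) < \<delta> / C})"
    by (intro open_INT ballI finite_lessThan open_coordinate_ball)
  then have "openin (subtopology (gtop G) V) (B \<delta>)"
    unfolding B_eq by (intro openin_continuous_map_preimage[OF homeomorphic_imp_continuous_map[OF homeo]] openin_open_Int)
  then have "openin (gtop G) (B \<delta>)" using openV by (rule openin_trans_full)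
  moreover have "\<one> \<in> B \<delta>" using \<delta>(1) by (rule B_one)
  ultimately have "neighborhood_of (gtop G) \<one> (B \<delta>)"
    unfolding neighborhood_of_def using openin_subset by blast
  then show ?thesis unfolding nss_def using \<delta>(2) by blast
qed

section \<open>The multiplicative group of the complex numbers as a Lie group\<close>

lemma eventually_upd_mem:
  fixes x :: "nat \<Rightarrow> 'k::real_normed_field"
  assumes U: "openin (top_of_set (coord_space d)) U" and x: "x \<in> U" and i: "i < d"
  shows "\<forall>\<^sub>F t in nhds (x i). x(i := t) \<in> U"
proof -
  obtain O' where O': "open O'" "U = coord_space d \<inter> O'" using U by (auto simp: openin_open)
  have "continuous_on UNIV (\<lambda>t. x(i := t))"
  proof (rule continuous_on_coordinatewise_then_product)
    show "continuous_on UNIV (\<lambda>t. (x(i := t)) j)" for j by (cases "j = i") auto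
  qed
  then have "open ((\<lambda>t. x(i := t)) -` O')" using O'(1) by (rule open_vimage[rotated])
  moreover have "x i \<in> (\<lambda>t. x(i := t)) -` O'" using x O'(2) by simp
  ultimately have "\<forall>\<^sub>F t in nhds (x i). t \<in> (\<lambda>t. x(i := t)) -` O'" by (rule eventually_nhds_in_open)
  then show ?thesis
  proof eventually_elim
    case (elim t)
    have "x(i := t) \<in> coord_space d" using x i O'(2) by (auto simp: coord_space_def)
    then show ?case using elim O'(2) by simp
  qed
qed

text \<open>The domain is open in the coordinate space, so equality on it determines the partial
  derivatives.\<close>

lemma C_diff_cong:
  assumes U: "openin (top_of_set (coord_space d)) U"
  shows "(\<And>x. x \<in> U \<Longrightarrow> f x = g x) \<Longrightarrow> C_diff d m U f \<Longrightarrow> C_diff d m U g"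
proof (induction m arbitrary: f g)
  case 0
  then show ?case by (simp cong: continuous_on_cong)
next
  case (Suc m)
  have ev: "\<forall>\<^sub>F t in nhds (x i). f (x(i := t)) = g (x(i := t))" if "x \<in> U" "i < d" for x i
    using eventually_upd_mem[OF U that] by eventually_elim (rule Suc.prems(1))
  show ?case unfolding C_diff.simps
  proof (intro conjI allI impI ballI)
    show "continuous_on U g" using Suc.prems by (simp cong: continuous_on_cong)
    fix i assume i: "i < d"
    show "(\<lambda>t. g (x(i := t))) field_differentiable at (x i)" if x: "x \<in> U" for x
    proof -
      obtain D where "((\<lambda>t. f (x(i := t))) has_field_derivative D) (at (x i))"
        using Suc.prems(2) i x by (auto simp: field_differentiable_def)
      then have "((\<lambda>t. g (x(i := t))) has_field_derivative D) (at (x i))"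
        using DERIV_cong_ev[OF refl ev[OF x i] refl] by blast
      then show ?thesis by (auto simp: field_differentiable_def)
    qed
    show "C_diff d m U (partial_deriv i g)"
    proof (rule Suc.IH)
      show "C_diff d m U (partial_deriv i f)" using Suc.prems(2) i by simp
      show "partial_deriv i f x = partial_deriv i g x" if "x \<in> U" for x
        unfolding partial_deriv_def by (rule deriv_cong_ev[OF ev[OF that i] refl])
    qed
  qed
qed

lemma C_diff_const: "C_diff d m U (\<lambda>x. c)"
proof (induction m arbitrary: c)
  case (Suc m)
  have "partial_deriv i (\<lambda>x. c) = (\<lambda>x. 0)" for i by (simp add: partial_deriv_def fun_eq_iff)
  then show ?case using Suc by simp
qed simp

lemma continuous_on_coordinate: "continuous_on U (\<lambda>x :: nat \<Rightarrow> 'k::real_normed_field. x k)"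
  by (rule continuous_on_subset[OF continuous_on_product_coordinates subset_UNIV])

lemma C_diff_coordinate: "C_diff d m U (\<lambda>x :: nat \<Rightarrow> 'k::real_normed_field. x k)"
proof (cases m)
  case (Suc l)
  have "partial_deriv i (\<lambda>x :: nat \<Rightarrow> 'k. x k) = (\<lambda>x. if i = k then 1 else 0)" for i
    by (cases "i = k") (auto simp: partial_deriv_def fun_eq_iff)
  moreover have "(\<lambda>t. (x(i := t)) k) field_differentiable at (x i)" for x :: "nat \<Rightarrow> 'k" and i
    by (cases "i = k") auto
  ultimately show ?thesis using Suc by (simp add: C_diff_const continuous_on_coordinate)
qed (simp add: continuous_on_coordinate)

lemma C_diff_coordinate_mult:
  assumes "k \<noteq> l" shows "C_diff d m U (\<lambda>x :: nat \<Rightarrow> 'k::real_normed_field. x k * x l)"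
proof (cases m)
  case (Suc m')
  have k: "partial_deriv i (\<lambda>x :: nat \<Rightarrow> 'k. x k * x l) = (\<lambda>x. if i = k then x l else if i = l then x k else 0)" for i
    using assms by (auto simp: partial_deriv_def fun_eq_iff)
  have "(\<lambda>t. (x(i := t)) k * (x(i := t)) l) field_differentiable at (x i)" for x :: "nat \<Rightarrow> 'k" and i
    using assms by (cases "i = k"; cases "i = l") (auto intro!: derivative_intros)
  moreover have "C_diff d m' U (partial_deriv i (\<lambda>x :: nat \<Rightarrow> 'k. x k * x l))" for i
    unfolding k by (cases "i = k"; cases "i = l") (simp_all add: C_diff_const C_diff_coordinate)
  ultimately show ?thesis using Suc by (auto intro!: continuous_intros continuous_on_coordinate)
qed (auto intro!: continuous_intros continuous_on_coordinate)

text \<open>The derivative of a holomorphic function is holomorphic, which settles all orders at once.\<close>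

lemma C_diff_holomorphic:
  assumes S: "open S" shows "h holomorphic_on S \<Longrightarrow> C_diff (Suc 0) m {x \<in> coord_space (Suc 0). x 0 \<in> S} (\<lambda>x. h (x 0))"
proof (induction m arbitrary: h)
  case 0
  have "continuous_on {x \<in> coord_space (Suc 0). x 0 \<in> S} (\<lambda>x. h (x 0))"
    by (rule continuous_on_compose2[OF holomorphic_on_imp_continuous_on[OF 0] continuous_on_coordinate]) auto
  then show ?case by simp
next
  case (Suc m)
  have "partial_deriv 0 (\<lambda>x. h (x 0)) = (\<lambda>x. deriv h (x 0))" by (simp add: partial_deriv_def fun_eq_iff)
  moreover have "C_diff (Suc 0) m {x \<in> coord_space (Suc 0). x 0 \<in> S} (\<lambda>x. deriv h (x 0))"
    by (rule Suc.IH[OF holomorphic_deriv[OF Suc.prems S]])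
  moreover have "continuous_on {x \<in> coord_space (Suc 0). x 0 \<in> S} (\<lambda>x. h (x 0))"
    by (rule continuous_on_compose2[OF holomorphic_on_imp_continuous_on[OF Suc.prems] continuous_on_coordinate]) auto
  moreover have "h field_differentiable at z" if "z \<in> S" for z
    using Suc.prems S that holomorphic_on_imp_differentiable_at by blast
  ultimately show ?case by simp
qed

text \<open>The group of nonzero complex numbers contains the circle and is a complex Lie group with a
  single chart. The bijection \<open>f\<close> onto a subset moves it to the given type.\<close>

definition transported_units :: "(complex \<Rightarrow> 'a) \<Rightarrow> 'a topgroup" where
  "transported_units f = \<lparr>carrier = f ` (- {0}), monoid.mult = (\<lambda>x y. f (inv_into UNIV f x * inv_into UNIV f y)), one = f 1,
     gtop = pullback_topology (f ` (- {0})) (inv_into UNIV f) (top_of_set (- {0}))\<rparr>"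

locale units_copy =
  fixes f :: "complex \<Rightarrow> 'a"
  assumes inj: "inj f"
begin

abbreviation "G \<equiv> transported_units f"
abbreviation "S \<equiv> - {0 :: complex}"
abbreviation "g \<equiv> inv_into UNIV f"

lemma gf: "g (f z) = z" using inj by simp

lemma G_simps:
  "carrier G = f ` S" "x \<otimes>\<^bsub>G\<^esub> y = f (g x * g y)" "\<one>\<^bsub>G\<^esub> = f 1"
  "gtop G = pullback_topology (f ` S) g (top_of_set S)"
  by (simp_all add: transported_units_def)

lemma topspace_G: "topspace (gtop G) = f ` S"
  by (auto simp: G_simps topspace_pullback_topology gf)

lemma group_G: "group G"
proof (rule groupI)
  fix x assume "x \<in> carrier G"
  then obtain z where z: "z \<noteq> 0" "x = f z" by (auto simp: G_simps)
  show "\<exists>y\<in>carrier G. y \<otimes>\<^bsub>G\<^esub> x = \<one>\<^bsub>G\<^esub>"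
    by (rule bexI[of _ "f (inverse z)"]) (use z in \<open>auto simp: G_simps gf\<close>)
qed (auto simp: G_simps gf mult.assoc)

lemma inv_G: "z \<noteq> 0 \<Longrightarrow> inv\<^bsub>G\<^esub> (f z) = f (inverse z)"
  by (rule group.inv_equality[OF group_G]) (auto simp: G_simps gf)

lemma pow_G: "z \<noteq> 0 \<Longrightarrow> f z [^]\<^bsub>G\<^esub> (m::nat) = f (z ^ m)"
  by (induction m) (auto simp: nat_pow_def G_simps gf mult.commute)

lemma continuous_from_G: "continuous_map (top_of_set S) X h \<Longrightarrow> continuous_map (gtop G) X (h \<circ> g)"
  unfolding G_simps by (rule continuous_map_pullback)

lemma continuous_to_G:
  assumes "continuous_map X (top_of_set S) h" shows "continuous_map X (gtop G) (f \<circ> h)"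
  unfolding G_simps
proof (rule continuous_map_pullback')
  have "g \<circ> (f \<circ> h) = h" by (simp add: fun_eq_iff gf)
  then show "continuous_map X (top_of_set S) (g \<circ> (f \<circ> h))" using assms by simp
  have "h x \<in> S" if "x \<in> topspace X" for x
    using subsetD[OF continuous_map_image_subset_topspace[OF assms] imageI[OF that]] by simp
  then show "topspace X \<subseteq> (f \<circ> h) -` f ` S" by (simp add: subset_iff)
qed

lemma continuous_g: "continuous_map (gtop G) (top_of_set S) g"
  using continuous_from_G[OF continuous_map_id] unfolding id_o .

lemma topological_group_G: "topological_group G"
proof (intro topological_group.intro topological_group_axioms.intro group_G)
  show "topspace (gtop G) = carrier G" unfolding G_simps(1) by (rule topspace_G)
  have "continuous_map (prod_topology (gtop G) (gtop G)) (top_of_set (S \<times> S)) (\<lambda>(x, y). (g x, g y))"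
    unfolding prod_topology_subtopology_eu[symmetric] continuous_map_prod_top using continuous_g by blast
  moreover have "continuous_map (top_of_set (S \<times> S)) (top_of_set S) (\<lambda>(z, w). z * w)"
    by (auto simp: continuous_map_iff_continuous2 split_def intro!: continuous_intros)
  ultimately have "continuous_map (prod_topology (gtop G) (gtop G)) (gtop G) (f \<circ> ((\<lambda>(z, w). z * w) \<circ> (\<lambda>(x, y). (g x, g y))))"
    by (intro continuous_to_G continuous_map_compose)
  moreover have "f \<circ> ((\<lambda>(z, w). z * w) \<circ> (\<lambda>(x, y). (g x, g y))) = (\<lambda>(x, y). x \<otimes>\<^bsub>G\<^esub> y)"
    by (auto simp: fun_eq_iff G_simps)
  ultimately show "continuous_map (prod_topology (gtop G) (gtop G)) (gtop G) (\<lambda>(x, y). x \<otimes>\<^bsub>G\<^esub> y)" by simp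
  have "continuous_map (top_of_set S) (top_of_set S) inverse"
    by (auto simp: continuous_map_iff_continuous2 intro!: continuous_intros)
  then have "continuous_map (gtop G) (gtop G) (f \<circ> (inverse \<circ> g))"
    by (intro continuous_to_G continuous_from_G)
  then show "continuous_map (gtop G) (gtop G) (\<lambda>x. inv\<^bsub>G\<^esub> x)"
  proof (rule continuous_map_eq)
    fix x assume "x \<in> topspace (gtop G)"
    then obtain z where "z \<noteq> 0" "x = f z" by (auto simp: topspace_G)
    then show "(f \<circ> (inverse \<circ> g)) x = inv\<^bsub>G\<^esub> x" by (simp add: gf inv_G)
  qed
qed

definition unit_coord :: "'a \<Rightarrow> nat \<Rightarrow> complex" where
  "unit_coord x = (\<lambda>i. if i = 0 then g x else 0)"

abbreviation "D \<equiv> {u \<in> coord_space (Suc 0). u 0 \<in> S}"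

lemma D_upd: "u \<in> coord_space (Suc 0) \<Longrightarrow> (\<lambda>i. if i = 0 then u 0 else 0) = u"
  by (auto simp: coord_space_def fun_eq_iff)

lemma unit_coord_f: "unit_coord (f z) = (\<lambda>i. if i = 0 then z else 0)"
  unfolding unit_coord_def gf ..

lemma unit_coord_f_D: "u \<in> D \<Longrightarrow> unit_coord (f (u 0)) = u"
  by (simp add: unit_coord_f D_upd)

lemma unit_coord_image: "unit_coord ` (f ` S) = D"
proof (intro equalityI subsetI)
  fix u assume u: "u \<in> D"
  from unit_coord_f_D[OF u] show "u \<in> unit_coord ` (f ` S)"
    by (rule image_eqI[OF sym]) (use u in simp)
qed (auto simp: unit_coord_def gf coord_space_def)

lemma inj_unit_coord: "inj_on unit_coord (f ` S)"
  by (rule inj_onI) (auto simp: unit_coord_def gf fun_eq_iff dest: spec[of _ 0])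

lemma open_coordinate_nonzero: "open {u :: nat \<Rightarrow> complex. u k \<noteq> 0}"
  by (rule open_Collect_neq[OF continuous_on_coordinate continuous_on_const])

lemma openin_D: "openin (top_of_set (coord_space (Suc 0))) D"
proof -
  have "D = coord_space (Suc 0) \<inter> {u. u 0 \<noteq> 0}" by auto
  then show ?thesis using openin_open_Int[OF open_coordinate_nonzero] by metis
qed

lemma inv_into_unit_coord: "u \<in> D \<Longrightarrow> inv_into (f ` S) unit_coord u = f (u 0)"
  by (intro inv_into_f_eq[OF inj_unit_coord] unit_coord_f_D) auto

lemma homeomorphic_unit_coord: "homeomorphic_map (gtop G) (top_of_set D) unit_coord"
proof (rule homeomorphic_maps_imp_map)
  show "homeomorphic_maps (gtop G) (top_of_set D) unit_coord (f \<circ> (\<lambda>u. u 0))"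
    unfolding homeomorphic_maps_def
  proof (intro conjI ballI)
    have "continuous_on S (\<lambda>z :: complex. \<lambda>i :: nat. if i = 0 then z else 0)"
    proof (rule continuous_on_coordinatewise_then_product)
      show "continuous_on S (\<lambda>z :: complex. if i = 0 then z else 0)" for i :: nat by (cases "i = 0") auto
    qed
    then have "continuous_map (top_of_set S) (top_of_set D) (\<lambda>z i. if i = 0 then z else 0)"
      by (auto simp: continuous_map_iff_continuous2 coord_space_def)
    then have "continuous_map (gtop G) (top_of_set D) ((\<lambda>z i. if i = 0 then z else 0) \<circ> g)"
      by (rule continuous_from_G)
    moreover have "(\<lambda>z i. if i = 0 then z else 0) \<circ> g = unit_coord" by (simp add: fun_eq_iff unit_coord_def)
    ultimately show "continuous_map (gtop G) (top_of_set D) unit_coord" by simp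
    show "continuous_map (top_of_set D) (gtop G) (f \<circ> (\<lambda>u. u 0))"
      by (rule continuous_to_G) (auto simp: continuous_map_iff_continuous2 continuous_on_coordinate)
    show "(f \<circ> (\<lambda>u. u 0)) (unit_coord x) = x" if "x \<in> topspace (gtop G)" for x
      using that by (auto simp: topspace_G unit_coord_def gf)
    show "unit_coord ((f \<circ> (\<lambda>u. u 0)) u) = u" if "u \<in> topspace (top_of_set D)" for u
      using unit_coord_f_D[of u] that by simp
  qed
qed

lemma lie_group_G: "lie_group TYPE(complex) G"
proof -
  define V where "V = f ` S"
  define A where "A = {(V, unit_coord)}"
  have V_top: "V = topspace (gtop G)" by (simp add: V_def topspace_G)
  have "Hausdorff_space (top_of_set D)" by (simp add: Hausdorff_space_subtopology)
  then have haus: "Hausdorff_space (gtop G)"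
    using homeomorphic_Hausdorff_space homeomorphic_map_imp_homeomorphic_space[OF homeomorphic_unit_coord] by blast
  have id: "smooth_on_coords (Suc 0) (Suc 0) D (unit_coord \<circ> inv_into V unit_coord)"
    unfolding smooth_on_coords_def
  proof (intro allI impI)
    fix j m assume "j < Suc 0"
    have "C_diff (Suc 0) m D (\<lambda>u. u 0)" by (rule C_diff_coordinate)
    then show "C_diff (Suc 0) m D (\<lambda>u. (unit_coord \<circ> inv_into V unit_coord) u j)"
      by (rule C_diff_cong[OF openin_D, rotated])
        (use \<open>j < Suc 0\<close> in \<open>simp add: V_def inv_into_unit_coord unit_coord_def gf\<close>)
  qed
  have atlas: "smooth_atlas (Suc 0) (gtop G) A"
    unfolding smooth_atlas_def A_def
    using homeomorphic_unit_coord openin_D id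
    by (simp add: V_top unit_coord_image[folded topspace_G])
  have inv: "smooth_map (Suc 0) A (Suc 0) A (\<lambda>x. inv\<^bsub>G\<^esub> x)"
  proof -
    have im: "unit_coord ` {x \<in> V. inv\<^bsub>G\<^esub> x \<in> V} = D"
    proof -
      have "{x \<in> V. inv\<^bsub>G\<^esub> x \<in> V} = f ` S" by (auto simp: V_def inv_G)
      then show ?thesis using unit_coord_image by simp
    qed
    have "C_diff (Suc 0) m D (\<lambda>u. (unit_coord \<circ> (\<lambda>x. inv\<^bsub>G\<^esub> x) \<circ> inv_into V unit_coord) u j)" if "j < Suc 0" for j m
    proof (rule C_diff_cong[OF openin_D])
      show "C_diff (Suc 0) m D (\<lambda>u. inverse (u 0))"
        by (rule C_diff_holomorphic) (auto intro!: holomorphic_intros)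
      show "inverse (u 0) = (unit_coord \<circ> (\<lambda>x. inv\<^bsub>G\<^esub> x) \<circ> inv_into V unit_coord) u j" if "u \<in> D" for u
        using that \<open>j < Suc 0\<close> by (simp add: V_def inv_into_unit_coord inv_G unit_coord_def gf)
    qed
    then show ?thesis unfolding smooth_map_def A_def smooth_on_coords_def by (simp add: im)
  qed
  have mult: "smooth_map (Suc 0 + Suc 0) (product_atlas (Suc 0) A A) (Suc 0) A (\<lambda>(x, y). x \<otimes>\<^bsub>G\<^esub> y)"
  proof -
    define \<Phi> where "\<Phi> = (\<lambda>(x, y). append_coords (Suc 0) (unit_coord x) (unit_coord y))"
    define D2 where "D2 = {u \<in> coord_space (Suc 0 + Suc 0). u 0 \<noteq> (0::complex) \<and> u (Suc 0) \<noteq> 0}"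
    have pa: "product_atlas (Suc 0) A A = {(V \<times> V, \<Phi>)}"
      unfolding product_atlas_def A_def \<Phi>_def by auto
    have inj\<Phi>: "inj_on \<Phi> (V \<times> V)"
      by (rule inj_onI) (auto simp: \<Phi>_def V_def append_coords_def unit_coord_def gf fun_eq_iff dest: spec[of _ 0] spec[of _ "Suc 0"])
    have \<Phi>: "\<Phi> (f z, f w) = u \<longleftrightarrow> u \<in> coord_space (Suc 0 + Suc 0) \<and> u 0 = z \<and> u (Suc 0) = w" for z w u
    proof -
      have "\<Phi> (f z, f w) = (\<lambda>i. if i = 0 then z else if i = Suc 0 then w else 0)"
        by (auto simp: \<Phi>_def append_coords_def unit_coord_def gf fun_eq_iff)
      then show ?thesis by (auto simp: coord_space_def fun_eq_iff)
    qed
    have inv\<Phi>: "inv_into (V \<times> V) \<Phi> u = (f (u 0), f (u (Suc 0)))" if "u \<in> D2" for u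
      using that by (intro inv_into_f_eq[OF inj\<Phi>]) (auto simp: \<Phi> D2_def V_def)
    have im: "\<Phi> ` {p \<in> V \<times> V. (case p of (x, y) \<Rightarrow> x \<otimes>\<^bsub>G\<^esub> y) \<in> V} = D2"
    proof (intro equalityI subsetI)
      fix u assume u: "u \<in> D2"
      then have "\<Phi> (f (u 0), f (u (Suc 0))) = u" by (simp add: \<Phi> D2_def)
      moreover have "(f (u 0), f (u (Suc 0))) \<in> {p \<in> V \<times> V. (case p of (x, y) \<Rightarrow> x \<otimes>\<^bsub>G\<^esub> y) \<in> V}"
        using u by (auto simp: V_def D2_def G_simps gf)
      ultimately show "u \<in> \<Phi> ` {p \<in> V \<times> V. (case p of (x, y) \<Rightarrow> x \<otimes>\<^bsub>G\<^esub> y) \<in> V}" by (rule image_eqI[OF sym])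
    next
      fix u assume "u \<in> \<Phi> ` {p \<in> V \<times> V. (case p of (x, y) \<Rightarrow> x \<otimes>\<^bsub>G\<^esub> y) \<in> V}"
      then obtain z w where "u = \<Phi> (f z, f w)" "z \<noteq> 0" "w \<noteq> 0" by (auto simp: V_def)
      then show "u \<in> D2" using \<Phi>[of z w u] by (simp add: D2_def)
    qed
    have open_D2: "openin (top_of_set (coord_space (Suc 0 + Suc 0))) D2"
    proof -
      have "D2 = coord_space (Suc 0 + Suc 0) \<inter> ({u. u 0 \<noteq> 0} \<inter> {u. u (Suc 0) \<noteq> 0})" by (auto simp: D2_def)
      then show ?thesis
        using openin_open_Int[OF open_Int[OF open_coordinate_nonzero open_coordinate_nonzero]] by metis
    qed
    have "C_diff (Suc 0 + Suc 0) m D2 (\<lambda>u. (unit_coord \<circ> (\<lambda>(x, y). x \<otimes>\<^bsub>G\<^esub> y) \<circ> inv_into (V \<times> V) \<Phi>) u j)" if "j < Suc 0" for j m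
    proof (rule C_diff_cong[OF open_D2])
      show "C_diff (Suc 0 + Suc 0) m D2 (\<lambda>u. u 0 * u (Suc 0))" by (rule C_diff_coordinate_mult) simp
      show "u 0 * u (Suc 0) = (unit_coord \<circ> (\<lambda>(x, y). x \<otimes>\<^bsub>G\<^esub> y) \<circ> inv_into (V \<times> V) \<Phi>) u j" if "u \<in> D2" for u
        using inv\<Phi>[OF that] \<open>j < Suc 0\<close> by (simp add: unit_coord_def G_simps gf)
    qed
    then show ?thesis unfolding smooth_map_def pa unfolding A_def smooth_on_coords_def using im by (simp add: split_def)
  qed
  show ?thesis
    unfolding lie_group_def using topological_group_G haus atlas inv mult by blast
qed

text \<open>The circle is a subgroup of the nonzero complex numbers with the subspace topology.\<close>

lemma nss_circle_of_units:
  assumes "nss G n" shows "nss circle_group n"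
proof -
  obtain U where U: "neighborhood_of (gtop G) \<one>\<^bsub>G\<^esub> U"
    and small: "\<And>x. x \<in> carrier G \<Longrightarrow> (\<And>k. x [^]\<^bsub>G\<^esub> n k \<in> U) \<Longrightarrow> x = \<one>\<^bsub>G\<^esub>"
    using assms unfolding nss_def by blast
  obtain W where W: "openin (gtop G) W" "f 1 \<in> W" "W \<subseteq> U"
    using U by (auto simp: neighborhood_of_def G_simps)
  obtain O' where O': "openin (top_of_set S) O'" "W = g -` O' \<inter> f ` S"
    using W(1) by (auto simp: G_simps openin_pullback_topology)
  then obtain O'' where O'': "open O''" "O' = S \<inter> O''" by (auto simp: openin_open)
  define U' where "U' = sphere 0 1 \<inter> O''"
  have "1 \<in> U'" using W(2) O' O'' by (auto simp: U'_def gf)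
  then have "neighborhood_of (gtop circle_group) \<one>\<^bsub>circle_group\<^esub> U'"
    unfolding neighborhood_of_def using O''(1)
    by (auto simp: circle_group_def U'_def intro!: exI[of _ "sphere 0 1 \<inter> O''"] openin_open_Int)
  moreover have "z = 1" if z: "cmod z = 1" and zk: "\<And>k. z ^ n k \<in> U'" for z
  proof -
    have "z \<noteq> 0" using z by auto
    have "f z = \<one>\<^bsub>G\<^esub>"
    proof (rule small)
      show "f z \<in> carrier G" using \<open>z \<noteq> 0\<close> by (auto simp: G_simps)
      show "f z [^]\<^bsub>G\<^esub> n k \<in> U" for k
        using zk[of k] W(3) O' O'' \<open>z \<noteq> 0\<close> by (auto simp: pow_G U'_def gf)
    qed
    then show ?thesis using inj by (simp add: G_simps inj_eq)
  qed
  ultimately show ?thesis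
    unfolding nss_def circle_group_pow by (auto simp: circle_group_def)
qed

end

section \<open>Separated eigenvectors in a separable space\<close>

context complex_normed_space
begin

lemma complex_ring_simps [simp]:
  "carrier complex_ring = UNIV" "x \<otimes>\<^bsub>complex_ring\<^esub> y = x * y" "\<one>\<^bsub>complex_ring\<^esub> = 1"
  "x \<oplus>\<^bsub>complex_ring\<^esub> y = x + y" "\<zero>\<^bsub>complex_ring\<^esub> = 0"
  by (simp_all add: complex_ring_def)

lemma neg_eq: "x \<in> carrier X \<Longrightarrow> \<ominus> x = (-1) \<odot>\<^bsub>X\<^esub> x"
proof (rule M.minus_equality)
  assume x: "x \<in> carrier X"
  have "(-1) \<odot>\<^bsub>X\<^esub> x \<oplus> 1 \<odot>\<^bsub>X\<^esub> x = (-1 + 1) \<odot>\<^bsub>X\<^esub> x"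
    using smult_l_distr[of "-1" 1 x] x by simp
  then show "(-1) \<odot>\<^bsub>X\<^esub> x \<oplus> x = \<zero>" using smult_one[OF x] smult_l_null[OF x] by simp
  show "(-1) \<odot>\<^bsub>X\<^esub> x \<in> carrier X" using x by simp
qed

lemma nrm_minus: "x \<in> carrier X \<Longrightarrow> nrm X (\<ominus> x) = nrm X x"
  by (simp add: neg_eq nrm_smult)

lemma nrm_diff_commute:
  assumes "x \<in> carrier X" "y \<in> carrier X" shows "nrm X (x \<ominus> y) = nrm X (y \<ominus> x)"
proof -
  have "y \<ominus> x = \<ominus> (x \<ominus> y)" using assms by (simp add: a_minus_def M.minus_add M.a_comm)
  then show ?thesis using nrm_minus[of "x \<ominus> y"] assms by simp
qed

lemma nrm_diff_triangle:
  assumes "x \<in> carrier X" "y \<in> carrier X" "z \<in> carrier X"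
  shows "nrm X (x \<ominus> z) \<le> nrm X (x \<ominus> y) + nrm X (y \<ominus> z)"
proof -
  have "x \<ominus> z = (x \<ominus> y) \<oplus> (y \<ominus> z)"
    using assms by (simp add: a_minus_def M.a_assoc M.l_neg M.r_neg1)
  then show ?thesis using nrm_triangle[of "x \<ominus> y" "y \<ominus> z"] assms by simp
qed

lemma diff_eq_0_iff:
  assumes "x \<in> carrier X" "y \<in> carrier X" shows "x \<ominus> y = \<zero> \<longleftrightarrow> x = y"
proof
  assume "x \<ominus> y = \<zero>"
  then have "(x \<oplus> \<ominus> y) \<oplus> y = y" using assms by (simp add: a_minus_def)
  then show "x = y" using assms by (simp add: M.a_assoc M.l_neg)
qed (use assms in \<open>simp add: a_minus_def M.r_neg\<close>)

lemma Metric_space_nrm_dist: "Metric_space (carrier X) (nrm_dist X)"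
proof
  show "0 \<le> nrm_dist X x y" for x y by (simp add: nrm_dist_def nrm_nonneg)
  show "nrm_dist X x y = nrm_dist X y x" for x y by (simp add: nrm_dist_def nrm_diff_commute)
  show "nrm_dist X x y = 0 \<longleftrightarrow> x = y" if "x \<in> carrier X" "y \<in> carrier X" for x y
    using that by (simp add: nrm_dist_def nrm_eq_0_iff diff_eq_0_iff)
  show "nrm_dist X x z \<le> nrm_dist X x y + nrm_dist X y z"
    if "x \<in> carrier X" "y \<in> carrier X" "z \<in> carrier X" for x y z
    using that by (simp add: nrm_dist_def nrm_diff_triangle)
qed

text \<open>Distinct points of a \<open>\<delta>\<close>-separated family have distinct approximations
  within \<open>\<delta>/2\<close> in a countable dense set.\<close>

lemma countable_if_separated:
  assumes sep: "separable_space (Metric_space.mtopology (carrier X) (nrm_dist X))"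
    and y: "\<And>c. c \<in> E \<Longrightarrow> y c \<in> carrier X" and "\<delta> > 0"
    and far: "\<And>c c'. c \<in> E \<Longrightarrow> c' \<in> E \<Longrightarrow> c \<noteq> c' \<Longrightarrow> \<delta> \<le> nrm X (y c \<ominus> y c')"
  shows "countable E"
proof -
  interpret MS: Metric_space "carrier X" "nrm_dist X" by (rule Metric_space_nrm_dist)
  obtain C where C: "countable C" "C \<subseteq> carrier X" "MS.mtopology closure_of C = carrier X"
    using sep by (auto simp: separable_space_def)
  have "\<exists>a\<in>C. nrm X (y c \<ominus> a) < \<delta>/2" if "c \<in> E" for c
  proof -
    have "y c \<in> MS.mtopology closure_of C" using y[OF that] C(3) by simp
    then obtain a where "a \<in> C" "a \<in> MS.mball (y c) (\<delta>/2)"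
      using \<open>\<delta> > 0\<close> unfolding MS.metric_closure_of by (auto dest: spec[of _ "\<delta>/2"])
    then show ?thesis by (auto simp: nrm_dist_def)
  qed
  then obtain a where a: "\<And>c. c \<in> E \<Longrightarrow> a c \<in> C" "\<And>c. c \<in> E \<Longrightarrow> nrm X (y c \<ominus> a c) < \<delta>/2" by metis
  have "inj_on a E"
  proof (rule inj_onI, rule ccontr)
    fix c c' assume c: "c \<in> E" "c' \<in> E" "a c = a c'" "c \<noteq> c'"
    have ac: "a c' \<in> carrier X" using a(1)[OF c(2)] C(2) by blast
    have "nrm X (y c \<ominus> y c') \<le> nrm X (y c \<ominus> a c') + nrm X (a c' \<ominus> y c')"
      by (rule nrm_diff_triangle[OF y[OF c(1)] ac y[OF c(2)]])
    also have "\<dots> < \<delta>"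
      using a(2)[OF c(1)] a(2)[OF c(2)] c(3) nrm_diff_commute[OF ac y[OF c(2)]] by simp
    finally show False using far[OF c(1,2,4)] by simp
  qed
  then show ?thesis using a(1) C(1) by (meson countable_image_inj_on countable_subset image_subsetI)
qed

lemma bounded_operator_pow:
  assumes T: "bounded_operator X T"
  obtains K where "K \<ge> 0" "\<And>m x. x \<in> carrier X \<Longrightarrow> (T ^^ m) x \<in> carrier X \<and> nrm X ((T ^^ m) x) \<le> K ^ m * nrm X x"
proof -
  obtain K where "\<forall>x\<in>carrier X. nrm X (T x) \<le> K * nrm X x"
    using T unfolding bounded_operator_def by (elim conjE exE)
  then have K: "\<And>x. x \<in> carrier X \<Longrightarrow> nrm X (T x) \<le> K * nrm X x" by blast
  have TX: "\<And>x. x \<in> carrier X \<Longrightarrow> T x \<in> carrier X" using T by (auto simp: bounded_operator_def)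
  have K': "nrm X (T x) \<le> \<bar>K\<bar> * nrm X x" if "x \<in> carrier X" for x
    using K[OF that] nrm_nonneg[OF that] by (smt (verit) mult_right_mono)
  have "(T ^^ m) x \<in> carrier X \<and> nrm X ((T ^^ m) x) \<le> \<bar>K\<bar> ^ m * nrm X x" if "x \<in> carrier X" for m x
  proof (induction m)
    case (Suc m)
    then have "nrm X (T ((T ^^ m) x)) \<le> \<bar>K\<bar> * (\<bar>K\<bar> ^ m * nrm X x)"
      using K'[of "(T ^^ m) x"] by (smt (verit) abs_ge_zero mult_left_mono)
    then show ?case using Suc TX by (simp add: mult.assoc)
  qed (use that in simp)
  then show thesis using that[of "\<bar>K\<bar>"] by simp
qed

lemma operator_norm_bound:
  assumes T: "bounded_operator X T" and x: "x \<in> carrier X"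
  shows "nrm X ((T ^^ m) x) \<le> operator_norm X (T ^^ m) * nrm X x"
proof -
  obtain K where K: "K \<ge> 0" "\<And>m x. x \<in> carrier X \<Longrightarrow> (T ^^ m) x \<in> carrier X \<and> nrm X ((T ^^ m) x) \<le> K ^ m * nrm X x"
    using bounded_operator_pow[OF T] by blast
  have Tc: "(T ^^ m) (c \<odot>\<^bsub>X\<^esub> z) = c \<odot>\<^bsub>X\<^esub> (T ^^ m) z" if "z \<in> carrier X" for c z
  proof (induction m)
    case (Suc m)
    then show ?case using T K(2)[OF that, of m] by (simp add: bounded_operator_def)
  qed simp
  show ?thesis
  proof (cases "nrm X x = 0")
    case True
    then show ?thesis using K(2)[OF x, of m] nrm_nonneg[of "(T ^^ m) x"] by simp
  next
    case False
    then have pos: "nrm X x > 0" using nrm_nonneg[OF x] by simp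
    define z where "z = of_real (1 / nrm X x) \<odot>\<^bsub>X\<^esub> x"
    have z: "z \<in> carrier X" "nrm X z = 1"
      using x pos by (auto simp: z_def nrm_smult norm_divide)
    have "bdd_above ((\<lambda>x. nrm X ((T ^^ m) x)) ` {x \<in> carrier X. nrm X x \<le> 1})"
    proof (rule bdd_aboveI2)
      fix v assume v: "v \<in> {x \<in> carrier X. nrm X x \<le> 1}"
      then have "nrm X ((T ^^ m) v) \<le> K ^ m * nrm X v" using K(2) by blast
      also have "\<dots> \<le> K ^ m * 1" using v K(1) by (intro mult_left_mono) auto
      finally show "nrm X ((T ^^ m) v) \<le> K ^ m" by simp
    qed
    then have "nrm X ((T ^^ m) z) \<le> operator_norm X (T ^^ m)"
      unfolding operator_norm_def by (rule cSUP_upper[rotated]) (use z in simp)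
    moreover have "nrm X ((T ^^ m) z) = nrm X ((T ^^ m) x) / nrm X x"
      unfolding z_def Tc[OF x] using K(2)[OF x, of m] pos by (simp add: nrm_smult norm_divide)
    ultimately show ?thesis using pos by (simp add: pos_divide_le_eq)
  qed
qed

text \<open>Let \<open>y a\<close> and \<open>y b\<close> be unit eigenvectors for distinct unimodular
  \<open>a\<close>, \<open>b\<close>, and let \<open>M\<close> bound the powers. For some
  \<open>k\<close> the numbers \<open>a ^ n k\<close> and \<open>b ^ n k\<close> differ by
  more than \<open>\<epsilon>\<close>. Since \<open>T ^ n k\<close> maps \<open>d = y a - y
  b\<close> to \<open>(a ^ n k - b ^ n k) y a + b ^ n k d\<close>, the norm of
  \<open>d\<close> is at least \<open>\<epsilon> / (M + 1)\<close>.\<close>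

lemma unimodular_eigenvalues_countable:
  assumes sep: "separable_space (Metric_space.mtopology (carrier X) (nrm_dist X))"
    and T: "bounded_operator X T" and bd: "bdd_above (range (\<lambda>k. operator_norm X (T ^^ n k)))"
    and n: "circle_separated n \<epsilon>" "\<epsilon> > 0"
  shows "countable {c \<in> eigenvalues X T. cmod c = 1}"
proof -
  obtain M0 where M0: "\<And>k. operator_norm X (T ^^ n k) \<le> M0" using bd by (auto simp: bdd_above_def)
  define M where "M = \<bar>M0\<bar>"
  have M: "M \<ge> 0" "\<And>k x. x \<in> carrier X \<Longrightarrow> nrm X ((T ^^ n k) x) \<le> M * nrm X x"
  proof -
    fix k x assume x: "x \<in> carrier X"
    have "operator_norm X (T ^^ n k) * nrm X x \<le> M * nrm X x"
      using M0[of k] nrm_nonneg[OF x] by (intro mult_right_mono) (auto simp: M_def)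
    then show "nrm X ((T ^^ n k) x) \<le> M * nrm X x" using operator_norm_bound[OF T x, of "n k"] by linarith
  qed (simp add: M_def)
  have TX: "\<And>x. x \<in> carrier X \<Longrightarrow> T x \<in> carrier X"
    and T_add: "\<And>x y. x \<in> carrier X \<Longrightarrow> y \<in> carrier X \<Longrightarrow> T (x \<oplus> y) = T x \<oplus> T y"
    and T_smult: "\<And>c x. x \<in> carrier X \<Longrightarrow> T (c \<odot>\<^bsub>X\<^esub> x) = c \<odot>\<^bsub>X\<^esub> T x"
    using T by (auto simp: bounded_operator_def)
  have Tm1: "(T ^^ m) x \<in> carrier X" if "x \<in> carrier X" for m x
    by (induction m) (use that TX in auto)
  have Tm2: "(T ^^ m) (c \<odot>\<^bsub>X\<^esub> x) = c \<odot>\<^bsub>X\<^esub> (T ^^ m) x" if "x \<in> carrier X" for m c x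
    by (induction m) (use that Tm1 T_smult in auto)
  have Tm3: "(T ^^ m) (x \<oplus> y) = (T ^^ m) x \<oplus> (T ^^ m) y" if "x \<in> carrier X" "y \<in> carrier X" for m x y
    by (induction m) (use that Tm1 T_add in auto)
  have "\<exists>y. y \<in> carrier X \<and> nrm X y = 1 \<and> T y = c \<odot>\<^bsub>X\<^esub> y" if "c \<in> eigenvalues X T" for c
  proof -
    have "\<exists>x\<in>carrier X. x \<noteq> \<zero> \<and> T x = c \<odot>\<^bsub>X\<^esub> x"
      using that by (simp only: eigenvalues_def mem_Collect_eq)
    then obtain x where x: "x \<in> carrier X" "x \<noteq> \<zero>" "T x = c \<odot>\<^bsub>X\<^esub> x" by (elim bexE conjE)
    have pos: "nrm X x > 0" using nrm_nonneg[OF x(1)] nrm_eq_0_iff[OF x(1)] x(2) by simp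
    define z where "z = of_real (1 / nrm X x) \<odot>\<^bsub>X\<^esub> x"
    have "T z = c \<odot>\<^bsub>X\<^esub> z"
      unfolding z_def T_smult[OF x(1)] x(3)
      using smult_assoc1[of _ c x] smult_assoc1[of c _ x] x(1) by (simp add: mult.commute)
    moreover have "nrm X z = 1" using x pos by (auto simp: z_def nrm_smult norm_divide)
    moreover have "z \<in> carrier X" unfolding z_def using x(1) by simp
    ultimately show ?thesis by blast
  qed
  then obtain y where y: "\<And>c. c \<in> eigenvalues X T \<Longrightarrow> y c \<in> carrier X \<and> nrm X (y c) = 1 \<and> T (y c) = c \<odot>\<^bsub>X\<^esub> y c"
    by metis
  show ?thesis
  proof (rule countable_if_separated[OF sep, of _ y "\<epsilon> / (M + 1)"])
    show "\<epsilon> / (M + 1) > 0" using n(2) M(1) by simp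
    show "y c \<in> carrier X" if "c \<in> {c \<in> eigenvalues X T. cmod c = 1}" for c using y that by blast
    fix a b assume a: "a \<in> {c \<in> eigenvalues X T. cmod c = 1}" and b: "b \<in> {c \<in> eigenvalues X T. cmod c = 1}" and "a \<noteq> b"
    have bn: "b \<noteq> 0" "cmod b = 1" using b by auto
    have "cmod (a / b) = 1" "a / b \<noteq> 1" using a b \<open>a \<noteq> b\<close> bn by (auto simp: norm_divide)
    then obtain k where k: "\<epsilon> < cmod ((a / b) ^ n k - 1)"
      using n(1) unfolding circle_separated_def by (metis not_le)
    define A where "A = a ^ n k"
    define B where "B = b ^ n k"
    have B1: "cmod B = 1" unfolding B_def using bn by (simp add: norm_power)
    then have "B \<noteq> 0" by auto
    then have "(a / b) ^ n k - 1 = (A - B) / B"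
      by (simp add: diff_divide_distrib power_divide flip: A_def B_def)
    then have AB: "\<epsilon> < cmod (A - B)" using k B1 by (simp add: norm_divide)
    have ya: "y a \<in> carrier X" "nrm X (y a) = 1" "T (y a) = a \<odot>\<^bsub>X\<^esub> y a"
      and yb: "y b \<in> carrier X" "T (y b) = b \<odot>\<^bsub>X\<^esub> y b" using y a b by auto
    have pow: "(T ^^ m) x = (c ^ m) \<odot>\<^bsub>X\<^esub> x" if "x \<in> carrier X" "T x = c \<odot>\<^bsub>X\<^esub> x" for x c m
    proof (induction m)
      case (Suc m)
      have "(T ^^ Suc m) x = (c ^ m) \<odot>\<^bsub>X\<^esub> (c \<odot>\<^bsub>X\<^esub> x)" using Suc T_smult[OF that(1)] that(2) by simp
      then show ?case using smult_assoc1[of "c ^ m" c x] that(1) by (simp add: mult.commute)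
    qed (use smult_one[OF that(1)] in simp)
    define d where "d = y a \<ominus> y b"
    have d: "d \<in> carrier X" unfolding d_def using ya yb by simp
    have d': "d = y a \<oplus> (-1) \<odot>\<^bsub>X\<^esub> y b" unfolding d_def a_minus_def neg_eq[OF yb(1)] ..
    have Td: "(T ^^ n k) d = A \<odot>\<^bsub>X\<^esub> y a \<oplus> (-1) \<odot>\<^bsub>X\<^esub> (B \<odot>\<^bsub>X\<^esub> y b)"
      unfolding d' using ya yb by (simp add: Tm2 Tm3 pow A_def B_def)
    have "(A - B) \<odot>\<^bsub>X\<^esub> y a = (T ^^ n k) d \<oplus> (- B) \<odot>\<^bsub>X\<^esub> d"
    proof -
      have c: "A \<odot>\<^bsub>X\<^esub> y a \<in> carrier X" "B \<odot>\<^bsub>X\<^esub> y b \<in> carrier X" "(- B) \<odot>\<^bsub>X\<^esub> y a \<in> carrier X"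
        "(- B) \<odot>\<^bsub>X\<^esub> y b \<in> carrier X"
        using ya yb by auto
      have "(- B) \<odot>\<^bsub>X\<^esub> d = (- B) \<odot>\<^bsub>X\<^esub> y a \<oplus> (- B) \<odot>\<^bsub>X\<^esub> ((-1) \<odot>\<^bsub>X\<^esub> y b)"
        unfolding d' using ya yb by (simp add: smult_r_distr)
      also have "(- B) \<odot>\<^bsub>X\<^esub> ((-1) \<odot>\<^bsub>X\<^esub> y b) = B \<odot>\<^bsub>X\<^esub> y b"
        using smult_assoc1[of "- B" "-1" "y b"] yb by simp
      finally have e1: "(- B) \<odot>\<^bsub>X\<^esub> d = (- B) \<odot>\<^bsub>X\<^esub> y a \<oplus> B \<odot>\<^bsub>X\<^esub> y b" .
      have e2: "(-1) \<odot>\<^bsub>X\<^esub> (B \<odot>\<^bsub>X\<^esub> y b) = (- B) \<odot>\<^bsub>X\<^esub> y b"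
        using smult_assoc1[of "-1" B "y b"] yb by simp
      have e3: "(- B) \<odot>\<^bsub>X\<^esub> y b \<oplus> B \<odot>\<^bsub>X\<^esub> y b = \<zero>"
        using smult_l_distr[of "- B" B "y b"] yb smult_l_null[OF yb(1)] by simp
      have "(T ^^ n k) d \<oplus> (- B) \<odot>\<^bsub>X\<^esub> d = A \<odot>\<^bsub>X\<^esub> y a \<oplus> (- B) \<odot>\<^bsub>X\<^esub> y a \<oplus> ((- B) \<odot>\<^bsub>X\<^esub> y b \<oplus> B \<odot>\<^bsub>X\<^esub> y b)"
        unfolding Td e1 e2 using c by (simp add: M.a_assoc M.a_lcomm)
      also have "\<dots> = A \<odot>\<^bsub>X\<^esub> y a \<oplus> (- B) \<odot>\<^bsub>X\<^esub> y a" unfolding e3 using c by simp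
      also have "\<dots> = (A + - B) \<odot>\<^bsub>X\<^esub> y a" using smult_l_distr[of A "- B" "y a"] ya by simp
      finally show ?thesis by simp
    qed
    moreover have "(T ^^ n k) d \<in> carrier X" "(- B) \<odot>\<^bsub>X\<^esub> d \<in> carrier X" using Tm1[OF d] d by auto
    ultimately have "nrm X ((A - B) \<odot>\<^bsub>X\<^esub> y a) \<le> nrm X ((T ^^ n k) d) + nrm X ((- B) \<odot>\<^bsub>X\<^esub> d)"
      using nrm_triangle by simp
    then have "cmod (A - B) \<le> M * nrm X d + nrm X d"
      using M(2)[OF d, of k] ya B1 d by (simp add: nrm_smult)
    then have "\<epsilon> < (M + 1) * nrm X d" using AB by (simp add: distrib_right)
    then show "\<epsilon> / (M + 1) \<le> nrm X (y a \<ominus> y b)"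
      using M(1) unfolding d_def by (simp add: pos_divide_le_eq mult.commute)
  qed
qed

end

theorem jamison_of_circle_separated:
  assumes "circle_separated n \<epsilon>" "\<epsilon> > 0" shows "jamison_sequence TYPE('b) n"
  unfolding jamison_sequence_def separable_complex_banach_def
  using complex_normed_space.unimodular_eigenvalues_countable[OF _ _ _ _ assms] by blast

section \<open>Complex scalars and infinite matrices on bounded sequences\<close>

text \<open>Rational combinations of the spanning vectors.\<close>

lemma countable_dense_in_span:
  fixes S :: "'v::real_normed_vector set"
  assumes "countable S"
  obtains D where "countable D" "D \<subseteq> span S" "span S \<subseteq> closure D"
proof -
  define F where "F l = (\<Sum>(q, b)\<leftarrow>l. real_of_rat q *\<^sub>R b)" for l :: "(rat \<times> 'v) list"
  define D where "D = F ` lists (UNIV \<times> S)"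
  have "countable D" unfolding D_def using assms by (intro countable_image countable_lists) auto
  moreover have "D \<subseteq> span S"
  proof -
    have "F l \<in> span S" if "l \<in> lists (UNIV \<times> S)" for l
      using that unfolding F_def by (induction l) (auto intro: span_zero span_add span_scale span_base)
    then show ?thesis by (auto simp: D_def)
  qed
  moreover have "span S \<subseteq> closure D"
  proof (rule span_minimal)
    show "S \<subseteq> closure D"
    proof
      fix b assume "b \<in> S"
      then have "F [(1, b)] \<in> D" unfolding D_def by (intro imageI) auto
      then show "b \<in> closure D" using closure_subset by (auto simp: F_def)
    qed
    have D_add: "x + y \<in> D" if "x \<in> D" "y \<in> D" for x y
    proof -
      obtain l l' where l: "l \<in> lists (UNIV \<times> S)" "l' \<in> lists (UNIV \<times> S)" "x = F l" "y = F l'"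
        using \<open>x \<in> D\<close> \<open>y \<in> D\<close> by (auto simp: D_def)
      have "x + y = F (l @ l')" unfolding l F_def by simp
      then show ?thesis unfolding D_def using l by auto
    qed
    have D_scale: "real_of_rat q *\<^sub>R x \<in> D" if x: "x \<in> D" for q x
    proof -
      obtain l where l: "x = F l" "l \<in> lists (UNIV \<times> S)" using x unfolding D_def by (rule imageE)
      have "real_of_rat q *\<^sub>R F l = F (map (\<lambda>(p, b). (q * p, b)) l)"
        unfolding F_def by (induction l) (auto simp: scaleR_add_right of_rat_mult split_def)
      moreover have "map (\<lambda>(p, b). (q * p, b)) l \<in> lists (UNIV \<times> S)" using l(2) by (induction l) auto
      ultimately show ?thesis unfolding D_def l(1) by (intro image_eqI)
    qed
    show "subspace (closure D)"
      unfolding subspace_def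
    proof (intro conjI ballI allI)
      have "F [] \<in> D" unfolding D_def by (intro imageI) auto
      then show "0 \<in> closure D" using closure_subset by (auto simp: F_def)
    next
      fix x y assume "x \<in> closure D" "y \<in> closure D"
      then obtain f g where f: "\<forall>n. f n \<in> D" "f \<longlonglongrightarrow> x" and g: "\<forall>n. g n \<in> D" "g \<longlonglongrightarrow> y"
        unfolding closure_sequential by blast
      have "(\<lambda>n. f n + g n) \<longlonglongrightarrow> x + y" by (rule tendsto_add[OF f(2) g(2)])
      moreover have "\<forall>n. f n + g n \<in> D" using f(1) g(1) D_add by blast
      ultimately show "x + y \<in> closure D" unfolding closure_sequential by (intro exI[of _ "\<lambda>n. f n + g n"]) simp
    next
      fix c x assume "x \<in> closure D"
      then obtain f where f: "\<forall>n. f n \<in> D" "f \<longlonglongrightarrow> x" unfolding closure_sequential by blast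
      have "c \<in> closure (\<rat> :: real set)" by (simp add: Rats_closure_real)
      then obtain q where q: "\<forall>n. q n \<in> (\<rat> :: real set)" "q \<longlonglongrightarrow> c" unfolding closure_sequential by blast
      have "(\<lambda>n. q n *\<^sub>R f n) \<longlonglongrightarrow> c *\<^sub>R x" by (rule tendsto_scaleR[OF q(2) f(2)])
      moreover have "\<forall>n. q n *\<^sub>R f n \<in> D"
      proof
        fix n
        obtain p where "q n = real_of_rat p" using q(1) Rats_cases by metis
        then show "q n *\<^sub>R f n \<in> D" using D_scale f(1) by simp
      qed
      ultimately show "c *\<^sub>R x \<in> closure D" unfolding closure_sequential by (intro exI[of _ "\<lambda>n. q n *\<^sub>R f n"]) simp
    qed
  qed
  ultimately show thesis using that by blast
qed

lemma subspace_closure: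
  fixes S :: "'v::real_normed_vector set"
  assumes S: "subspace S" shows "subspace (closure S)"
  unfolding subspace_def
proof (intro conjI ballI allI)
  show "0 \<in> closure S" using subspace_0[OF S] closure_subset by blast
next
  fix x y assume "x \<in> closure S" "y \<in> closure S"
  then obtain f g where f: "\<forall>n. f n \<in> S" "f \<longlonglongrightarrow> x" and g: "\<forall>n. g n \<in> S" "g \<longlonglongrightarrow> y"
    unfolding closure_sequential by blast
  have "(\<lambda>n. f n + g n) \<longlonglongrightarrow> x + y" by (rule tendsto_add[OF f(2) g(2)])
  moreover have "\<forall>n. f n + g n \<in> S" using f(1) g(1) subspace_add[OF S] by blast
  ultimately show "x + y \<in> closure S" unfolding closure_sequential by (intro exI[of _ "\<lambda>n. f n + g n"]) simp
next
  fix c x assume "x \<in> closure S"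
  then obtain f where f: "\<forall>n. f n \<in> S" "f \<longlonglongrightarrow> x" unfolding closure_sequential by blast
  have "(\<lambda>n. c *\<^sub>R f n) \<longlonglongrightarrow> c *\<^sub>R x" by (intro tendsto_intros f(2))
  moreover have "\<forall>n. c *\<^sub>R f n \<in> S" using f(1) subspace_scale[OF S] by blast
  ultimately show "c *\<^sub>R x \<in> closure S" unfolding closure_sequential by (intro exI[of _ "\<lambda>n. c *\<^sub>R f n"]) simp
qed

lemma discrete_bcontfunI: "(\<And>i. norm (h i) \<le> b) \<Longrightarrow> (h :: nat \<Rightarrow> complex) \<in> bcontfun"
  by (rule bcontfun_normI) (simp_all add: continuous_on_discrete discrete_def open_discrete)

definition cmul :: "complex \<Rightarrow> (nat \<Rightarrow>\<^sub>C complex) \<Rightarrow> (nat \<Rightarrow>\<^sub>C complex)" where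
  "cmul c x = Bcontfun (\<lambda>i. c * apply_bcontfun x i)"

lemma apply_cmul [simp]: "apply_bcontfun (cmul c x) i = c * apply_bcontfun x i"
proof -
  have "(\<lambda>i. c * apply_bcontfun x i) \<in> bcontfun"
    by (rule discrete_bcontfunI[of _ "cmod c * norm x"]) (simp add: norm_mult mult_left_mono norm_bounded)
  then show ?thesis unfolding cmul_def by (simp add: Bcontfun_inverse)
qed

lemmas apply_bcontfun_simps = plus_bcontfun.rep_eq minus_bcontfun.rep_eq scaleR_bcontfun.rep_eq
  zero_bcontfun.rep_eq uminus_bcontfun.rep_eq

lemma cmul_simps:
  "cmul c (x + y) = cmul c x + cmul c y" "cmul (c + d) x = cmul c x + cmul d x"
  "cmul (c * d) x = cmul c (cmul d x)" "cmul 1 x = x" "cmul (of_real t) x = t *\<^sub>R x" "cmul 0 x = 0"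
  "cmul c (t *\<^sub>R x) = t *\<^sub>R cmul c x" "cmul (c - d) x = cmul c x - cmul d x"
  by (rule bcontfun_eqI; simp add: apply_bcontfun_simps algebra_simps scaleR_conv_of_real)+

lemma cmul_Re_Im: "cmul c x = Re c *\<^sub>R x + Im c *\<^sub>R cmul \<i> x"
  by (rule bcontfun_eqI) (simp add: apply_bcontfun_simps complex_eq_iff)

lemma norm_cmul_le: "norm (cmul c x) \<le> cmod c * norm x"
  by (rule norm_bound) (simp add: norm_mult mult_left_mono norm_bounded)

lemma norm_cmul: "norm (cmul c x) = cmod c * norm x"
proof (cases "c = 0")
  case False
  have "norm x = norm (cmul (inverse c) (cmul c x))" using False by (simp flip: cmul_simps(3) add: cmul_simps(4))
  also have "\<dots> \<le> cmod (inverse c) * norm (cmul c x)" by (rule norm_cmul_le)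
  finally have "cmod c * norm x \<le> cmod c * (cmod (inverse c) * norm (cmul c x))" by (rule mult_left_mono) simp
  also have "\<dots> = norm (cmul c x)" using False by (simp add: norm_inverse flip: mult.assoc)
  finally show ?thesis using norm_cmul_le[of c x] by simp
qed (simp add: cmul_simps(6))

lemma bounded_linear_cmul: "bounded_linear (cmul c)"
  by (rule bounded_linear_intro[where K = "cmod c"]) (simp_all add: cmul_simps norm_cmul)

lemma tendsto_cmul:
  assumes c: "c \<longlonglongrightarrow> d" and x: "x \<longlonglongrightarrow> y" shows "(\<lambda>i. cmul (c i) (x i)) \<longlonglongrightarrow> cmul d y"
proof -
  have "(\<lambda>i. cmul (c i - d) (x i)) \<longlonglongrightarrow> 0"
  proof (rule Lim_null_comparison)
    show "\<forall>\<^sub>F i in sequentially. norm (cmul (c i - d) (x i)) \<le> cmod (c i - d) * norm (x i)"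
      by (simp add: norm_cmul)
    have "(\<lambda>i. cmod (c i - d) * norm (x i)) \<longlonglongrightarrow> cmod (d - d) * norm y" by (intro tendsto_intros c x)
    then show "(\<lambda>i. cmod (c i - d) * norm (x i)) \<longlonglongrightarrow> 0" by simp
  qed
  moreover have "(\<lambda>i. cmul d (x i)) \<longlonglongrightarrow> cmul d y" by (rule bounded_linear.tendsto[OF bounded_linear_cmul x])
  ultimately have "(\<lambda>i. cmul (c i - d) (x i) + cmul d (x i)) \<longlonglongrightarrow> 0 + cmul d y" by (rule tendsto_add)
  then show ?thesis by (simp flip: cmul_simps(2))
qed

text \<open>An infinite matrix with uniformly bounded absolute row sums acts on bounded sequences.\<close>

definition mat_op :: "(nat \<Rightarrow> nat \<Rightarrow> complex) \<Rightarrow> (nat \<Rightarrow>\<^sub>C complex) \<Rightarrow> (nat \<Rightarrow>\<^sub>C complex)" where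
  "mat_op M x = Bcontfun (\<lambda>p. \<Sum>q. M p q * apply_bcontfun x q)"

context
  fixes M :: "nat \<Rightarrow> nat \<Rightarrow> complex" and K :: real
  assumes rows: "\<And>p. summable (\<lambda>q. cmod (M p q))" "\<And>p. (\<Sum>q. cmod (M p q)) \<le> K"
begin

lemma mat_summable: "summable (\<lambda>q. cmod (M p q * apply_bcontfun x q))"
proof (rule summable_comparison_test')
  show "summable (\<lambda>q. cmod (M p q) * norm x)" by (rule summable_mult2[OF rows(1)])
  show "norm (cmod (M p q * apply_bcontfun x q)) \<le> cmod (M p q) * norm x" for q
    by (simp add: norm_mult mult_left_mono norm_bounded)
qed

lemma mat_row_bound: "cmod (\<Sum>q. M p q * apply_bcontfun x q) \<le> K * norm x"
proof -
  have "cmod (\<Sum>q. M p q * apply_bcontfun x q) \<le> (\<Sum>q. cmod (M p q * apply_bcontfun x q))"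
    by (rule summable_norm[OF mat_summable])
  also have "\<dots> \<le> (\<Sum>q. cmod (M p q) * norm x)"
    by (intro suminf_le mat_summable summable_mult2 rows) (simp add: norm_mult mult_left_mono norm_bounded)
  also have "\<dots> = (\<Sum>q. cmod (M p q)) * norm x" by (rule suminf_mult2[OF rows(1), symmetric])
  also have "\<dots> \<le> K * norm x" by (intro mult_right_mono rows) simp
  finally show ?thesis .
qed

lemma apply_mat_op: "apply_bcontfun (mat_op M x) p = (\<Sum>q. M p q * apply_bcontfun x q)"
  unfolding mat_op_def using discrete_bcontfunI[of "\<lambda>p. \<Sum>q. M p q * apply_bcontfun x q" "K * norm x"] mat_row_bound
  by (simp add: Bcontfun_inverse)

lemma norm_mat_op: "norm (mat_op M x) \<le> K * norm x"
  by (rule norm_bound) (simp add: apply_mat_op mat_row_bound)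

lemma mat_op_cmul: "mat_op M (cmul c x) = cmul c (mat_op M x)"
proof (rule bcontfun_eqI)
  fix p
  have "(\<Sum>q. M p q * (c * apply_bcontfun x q)) = (\<Sum>q. c * (M p q * apply_bcontfun x q))" by (simp add: mult.left_commute)
  also have "\<dots> = c * (\<Sum>q. M p q * apply_bcontfun x q)" by (rule suminf_mult[OF summable_norm_cancel[OF mat_summable]])
  finally show "apply_bcontfun (mat_op M (cmul c x)) p = apply_bcontfun (cmul c (mat_op M x)) p" by (simp add: apply_mat_op)
qed

lemma mat_op_add: "mat_op M (x + y) = mat_op M x + mat_op M y"
proof (rule bcontfun_eqI)
  fix p
  show "apply_bcontfun (mat_op M (x + y)) p = apply_bcontfun (mat_op M x + mat_op M y) p"
    unfolding apply_mat_op apply_bcontfun_simps distrib_left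
    by (rule suminf_add[symmetric]; rule summable_norm_cancel[OF mat_summable])
qed

lemma bounded_linear_mat_op: "bounded_linear (mat_op M)"
proof (rule bounded_linear_intro[where K = K])
  show "mat_op M (t *\<^sub>R x) = t *\<^sub>R mat_op M x" for t x
    using mat_op_cmul[of "of_real t" x] by (simp add: cmul_simps)
qed (simp_all add: mat_op_add norm_mat_op mult.commute)

end

section \<open>Operators indexed by the binary tree\<close>

text \<open>The positive integers form a binary tree in which the parent of \<open>q\<close> is \<open>q
  div 2\<close> and the root is 1. Here \<open>p\<close> is an ancestor of \<open>q\<close> or
  equal to it.\<close>

definition ancestor :: "nat \<Rightarrow> nat \<Rightarrow> bool" where "ancestor p q \<longleftrightarrow> p \<ge> 1 \<and> (\<exists>j. q div 2 ^ j = p)"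

lemma ancestor_refl: "p \<ge> 1 \<Longrightarrow> ancestor p p"
  unfolding ancestor_def by (auto intro: exI[of _ 0])

lemma ancestor_le: "ancestor p q \<Longrightarrow> p \<le> q"
  unfolding ancestor_def by auto

lemma ancestor_trans: "ancestor p q \<Longrightarrow> ancestor q s \<Longrightarrow> ancestor p s"
  unfolding ancestor_def by (metis div_mult2_eq power_add)

lemma ancestor_iff: assumes "q \<ge> 1" shows "ancestor p q \<longleftrightarrow> p = q \<or> ancestor p (q div 2)"
proof
  assume "ancestor p q"
  then obtain j where j: "p \<ge> 1" "q div 2 ^ j = p" by (auto simp: ancestor_def)
  show "p = q \<or> ancestor p (q div 2)"
  proof (cases j)
    case (Suc i)
    then have "q div 2 div 2 ^ i = p" using j by (simp add: div_mult2_eq)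
    then show ?thesis using j(1) by (auto simp: ancestor_def)
  qed (use j in simp)
next
  assume "p = q \<or> ancestor p (q div 2)"
  then show "ancestor p q"
  proof
    assume "ancestor p (q div 2)"
    then obtain j where j: "p \<ge> 1" "q div 2 div 2 ^ j = p" by (auto simp: ancestor_def)
    then have "q div 2 ^ Suc j = p" by (simp add: div_mult2_eq)
    then show ?thesis using j(1) unfolding ancestor_def by blast
  qed (use assms ancestor_refl in simp)
qed

lemma telescope_path:
  fixes f :: "nat \<Rightarrow> complex"
  assumes "ancestor p q"
  shows "f p + (\<Sum>s\<in>{s. ancestor s q \<and> ancestor p s \<and> s \<noteq> p}. f s - f (s div 2)) = f q"
  using assms
proof (induction q rule: less_induct)
  case (less q)
  have q: "q \<ge> 1" using less.prems ancestor_le[OF less.prems] by (auto simp: ancestor_def)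
  show ?case
  proof (cases "p = q")
    case True
    have "s = p" if "ancestor s q" "ancestor p s" for s
      using ancestor_le[OF that(1)] ancestor_le[OF that(2)] True by simp
    then have "{s. ancestor s q \<and> ancestor p s \<and> s \<noteq> p} = {}" by blast
    then show ?thesis using True by (simp only: sum.empty add_0_right)
  next
    case False
    then have pq: "ancestor p (q div 2)" using ancestor_iff[OF q] less.prems by blast
    have "q div 2 < q" using q by simp
    define A where "A = {s. ancestor s (q div 2) \<and> ancestor p s \<and> s \<noteq> p}"
    have "finite A" unfolding A_def by (rule finite_subset[of _ "{..q div 2}"]) (auto dest: ancestor_le)
    have "q \<notin> A" unfolding A_def using ancestor_le[of q "q div 2"] \<open>q div 2 < q\<close> by auto
    have "{s. ancestor s q \<and> ancestor p s \<and> s \<noteq> p} = insert q A"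
      unfolding A_def using ancestor_iff[OF q] False less.prems by auto
    then have "(\<Sum>s\<in>{s. ancestor s q \<and> ancestor p s \<and> s \<noteq> p}. f s - f (s div 2)) = f q - f (q div 2) + (\<Sum>s\<in>A. f s - f (s div 2))"
      using \<open>finite A\<close> \<open>q \<notin> A\<close> by simp
    then have "f p + (\<Sum>s\<in>{s. ancestor s q \<and> ancestor p s \<and> s \<noteq> p}. f s - f (s div 2))
        = (f p + (\<Sum>s\<in>A. f s - f (s div 2))) + (f q - f (q div 2))" by simp
    also have "f p + (\<Sum>s\<in>A. f s - f (s div 2)) = f (q div 2)"
      unfolding A_def by (rule less.IH[OF \<open>q div 2 < q\<close> pq])
    finally show ?thesis by simp
  qed
qed

text \<open>The indicator of the path from the root to \<open>r\<close>, with weights that tend to 0. The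
  weights make the path vectors along an infinite branch converge.\<close>

definition path_vec :: "nat \<Rightarrow> (nat \<Rightarrow>\<^sub>C complex)" where
  "path_vec r = Bcontfun (\<lambda>p. if ancestor p r then 1 / of_nat (p + 1) else 0)"

lemma apply_path_vec: "apply_bcontfun (path_vec r) p = (if ancestor p r then 1 / of_nat (p + 1) else 0)"
proof -
  have "norm (if ancestor p r then 1 / of_nat (p + 1) else (0::complex)) \<le> 1" for p
    by (auto simp: norm_divide simp del: of_nat_Suc of_nat_add)
  then have "(\<lambda>p. if ancestor p r then 1 / of_nat (p + 1) else (0::complex)) \<in> bcontfun" by (rule discrete_bcontfunI)
  then show ?thesis unfolding path_vec_def by (simp add: Bcontfun_inverse)
qed

text \<open>A number \<open>f q\<close> for each node defines the operator that multiplies the unweighted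
  path vector of \<open>r\<close> by \<open>f r\<close>. In the basis of coordinates its
  entries are the increments \<open>f q - f (q div 2)\<close>, so powers of \<open>f\<close>
  give bounded operators as long as these increments are small compared with the weights.\<close>

definition tree_mat :: "(nat \<Rightarrow> complex) \<Rightarrow> nat \<Rightarrow> nat \<Rightarrow> complex" where
  "tree_mat f p q = (if p = q then f p else if ancestor p q then (f q - f (q div 2)) * (of_nat (q + 1) / of_nat (p + 1)) else 0)"

text \<open>The weights contribute a factor of at most \<open>q + 1\<close>, so a row is dominated by
  \<open>C / (q + 1) ^ 2\<close>.\<close>

lemma tree_rows:
  assumes f1: "\<And>q. cmod (f q) \<le> 1" and C: "C \<ge> 0"
    and f2: "\<And>q. q \<ge> 2 \<Longrightarrow> cmod (f q - f (q div 2)) \<le> C / of_nat (q + 1) ^ 3"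
  shows "summable (\<lambda>q. cmod (tree_mat f p q))" and "(\<Sum>q. cmod (tree_mat f p q)) \<le> 1 + C * (\<Sum>q. 1 / of_nat (Suc q) ^ 2)"
proof -
  \<comment> \<open>The diagonal entry is at most 1; all other entries obey the quadratic bound.\<close>
  define h where "h q = (if q = p then 1 else 0) + C * (1 / of_nat (Suc q) ^ 2)" for q :: nat
  have sq: "summable (\<lambda>q. 1 / of_nat (Suc q) ^ 2 :: real)"
    using inverse_power_summable[of 2, where 'a = real] summable_Suc_iff[of "\<lambda>q. inverse (of_nat q ^ 2) :: real"]
    by (simp add: divide_inverse)
  have s1: "(\<lambda>q. if q = p then 1 else 0 :: real) sums 1" using sums_single[of p "\<lambda>_. 1 :: real"] by simp
  have hs: "h sums (1 + C * (\<Sum>q. 1 / of_nat (Suc q) ^ 2))"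
    unfolding h_def by (intro sums_add s1 sums_mult summable_sums sq)
  have le: "cmod (tree_mat f p q) \<le> h q" for q
  proof (cases "p \<noteq> q \<and> ancestor p q")
    case True
    then have "p < q" "p \<ge> 1" using ancestor_le[of p q] by (auto simp: ancestor_def)
    then have "q \<ge> 2" by simp
    have "cmod (tree_mat f p q) = cmod (f q - f (q div 2)) * (of_nat (q + 1) / of_nat (p + 1))"
      using True by (simp add: tree_mat_def norm_mult norm_divide del: of_nat_Suc of_nat_add)
    also have "\<dots> \<le> C / of_nat (q + 1) ^ 3 * (of_nat (q + 1) / 1)"
      using C by (intro mult_mono f2 \<open>q \<ge> 2\<close> divide_left_mono) auto
    also have "\<dots> = C * (1 / of_nat (Suc q) ^ 2)" by (simp add: power2_eq_square power3_eq_cube del: of_nat_Suc)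
    also have "\<dots> \<le> h q" by (simp add: h_def)
    finally show ?thesis .
  next
    case False
    have "0 \<le> C * (1 / of_nat (Suc q) ^ 2)" using C by simp
    then show ?thesis using False f1[of p] by (auto simp: tree_mat_def h_def)
  qed
  show s: "summable (\<lambda>q. cmod (tree_mat f p q))"
    by (rule summable_comparison_test'[OF sums_summable[OF hs]]) (use le in simp)
  show "(\<Sum>q. cmod (tree_mat f p q)) \<le> 1 + C * (\<Sum>q. 1 / of_nat (Suc q) ^ 2)"
    using suminf_le[OF le s sums_summable[OF hs]] sums_unique[OF hs] by simp
qed

text \<open>At an ancestor \<open>p\<close> of \<open>r\<close> the increments of \<open>f\<close> along
  the path from \<open>p\<close> to \<open>r\<close> telescope to \<open>f r - f p\<close>.\<close>

lemma tree_mat_path_vec: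
  assumes f1: "\<And>q. cmod (f q) \<le> 1" and C: "C \<ge> 0"
    and f2: "\<And>q. q \<ge> 2 \<Longrightarrow> cmod (f q - f (q div 2)) \<le> C / of_nat (q + 1) ^ 3"
  shows "mat_op (tree_mat f) (path_vec r) = cmul (f r) (path_vec r)"
proof (rule bcontfun_eqI)
  fix p
  define A where "A = {s. ancestor s r \<and> ancestor p s \<and> s \<noteq> p}"
  have fin: "finite {s. ancestor s r}" by (rule finite_subset[of _ "{..r}"]) (auto dest: ancestor_le)
  have "apply_bcontfun (mat_op (tree_mat f) (path_vec r)) p = (\<Sum>q. tree_mat f p q * apply_bcontfun (path_vec r) q)"
    by (rule apply_mat_op) (rule tree_rows[OF f1 C f2]; assumption)+
  also have "\<dots> = (\<Sum>q\<in>{s. ancestor s r}. tree_mat f p q * apply_bcontfun (path_vec r) q)"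
    by (rule suminf_finite[OF fin]) (simp add: apply_path_vec)
  also have "\<dots> = f r * apply_bcontfun (path_vec r) p"
  proof (cases "ancestor p r")
    case True
    have "{s. ancestor s r} = insert p ({s. ancestor s r} - {p})" using True by auto
    then have "(\<Sum>q\<in>{s. ancestor s r}. tree_mat f p q * apply_bcontfun (path_vec r) q) =
        tree_mat f p p * apply_bcontfun (path_vec r) p + (\<Sum>q\<in>{s. ancestor s r} - {p}. tree_mat f p q * apply_bcontfun (path_vec r) q)"
      using fin by (metis (no_types, lifting) finite_Diff sum.insert_remove sum.remove True mem_Collect_eq)
    also have "(\<Sum>q\<in>{s. ancestor s r} - {p}. tree_mat f p q * apply_bcontfun (path_vec r) q) =
        (\<Sum>q\<in>A. (f q - f (q div 2)) / of_nat (p + 1))"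
    proof (rule sum.mono_neutral_cong_right)
      show "finite ({s. ancestor s r} - {p})" using fin by simp
      show "A \<subseteq> {s. ancestor s r} - {p}" by (auto simp: A_def)
      show "\<forall>i\<in>{s. ancestor s r} - {p} - A. tree_mat f p i * apply_bcontfun (path_vec r) i = 0"
        by (auto simp: A_def tree_mat_def)
      show "tree_mat f p q * apply_bcontfun (path_vec r) q = (f q - f (q div 2)) / of_nat (p + 1)" if "q \<in> A" for q
        using that by (auto simp: A_def tree_mat_def apply_path_vec simp del: of_nat_Suc of_nat_add)
    qed
    also have "tree_mat f p p * apply_bcontfun (path_vec r) p + (\<Sum>q\<in>A. (f q - f (q div 2)) / of_nat (p + 1))
      = (f p + (\<Sum>q\<in>A. f q - f (q div 2))) / of_nat (p + 1)"
      using True by (simp add: tree_mat_def apply_path_vec sum_divide_distrib add_divide_distrib del: of_nat_Suc of_nat_add)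
    also have "f p + (\<Sum>q\<in>A. f q - f (q div 2)) = f r" unfolding A_def by (rule telescope_path[OF True])
    finally show ?thesis using True by (simp add: apply_path_vec)
  next
    case False
    have "tree_mat f p q = 0" if "ancestor q r" for q
      using that False ancestor_trans unfolding tree_mat_def by auto
    then show ?thesis using False by (simp add: apply_path_vec)
  qed
  finally show "apply_bcontfun (mat_op (tree_mat f) (path_vec r)) p = apply_bcontfun (cmul (f r) (path_vec r)) p" by simp
qed

text \<open>Going to an odd child multiplies the value by a perturbation attached to the parent, going to
  an even child keeps it.\<close>

fun node_value :: "(nat \<Rightarrow> complex) \<Rightarrow> nat \<Rightarrow> complex" where
  "node_value \<mu> q = (if q \<le> 1 then 1 else node_value \<mu> (q div 2) * (if odd q then \<mu> (q div 2) else 1))"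

declare node_value.simps [simp del]

lemma node_value_le_1: "q \<le> 1 \<Longrightarrow> node_value \<mu> q = 1"
  by (simp add: node_value.simps)

lemma node_value_child: "q \<ge> 2 \<Longrightarrow> node_value \<mu> q = node_value \<mu> (q div 2) * (if odd q then \<mu> (q div 2) else 1)"
  by (subst node_value.simps) simp

fun branch :: "(nat \<Rightarrow> bool) \<Rightarrow> nat \<Rightarrow> nat" where
  "branch s 0 = 1"
| "branch s (Suc m) = 2 * branch s m + (if s m then 1 else 0)"

lemma branch_ge: "branch s m \<ge> 2 ^ m" by (induction m) auto

lemma branch_pos: "branch s m \<ge> 1" by (induction m) auto

lemma branch_div: "branch s (Suc m) div 2 = branch s m" by auto

lemma branch_mono: "branch s (m + i) \<ge> branch s m + i"
proof (induction i)
  case (Suc i)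
  have "branch s (m + Suc i) \<ge> 2 * branch s (m + i)" by simp
  then show ?case using Suc branch_pos[of s "m + i"] by linarith
qed simp

lemma ancestor_branch: "ancestor p (branch s (Suc m)) \<longleftrightarrow> p = branch s (Suc m) \<or> ancestor p (branch s m)"
  using ancestor_iff[OF branch_pos[of s "Suc m"], of p] unfolding branch_div .

lemma ancestor_1: "q \<ge> 1 \<Longrightarrow> ancestor 1 q"
proof (induction q rule: less_induct)
  case (less q)
  show ?case
  proof (cases "q = 1")
    case False
    then have "q div 2 < q" "q div 2 \<ge> 1" using less.prems by auto
    then show ?thesis using less ancestor_iff[OF less.prems] by blast
  qed (simp add: ancestor_refl)
qed

text \<open>Without separation there are points of the circle other than 1 all of whose powers \<open>n
  k\<close> are as close to 1 as desired. Choose them recursively: each must meet the cubic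
  bound needed for the operator, and must be so close to 1 compared with its predecessor that
  later perturbations cannot undo it.\<close>

lemma exists_perturbations:
  fixes n :: "nat \<Rightarrow> nat"
  assumes n0: "n 0 = 1" and not_sep: "\<And>\<epsilon>. \<epsilon> > 0 \<Longrightarrow> \<not> circle_separated n \<epsilon>"
  obtains \<mu> where "\<And>q. cmod (\<mu> q) = 1" "\<And>q. \<mu> q \<noteq> 1"
    "\<And>q k. cmod (\<mu> q ^ n k - 1) \<le> 1 / of_nat (2 * q + 2) ^ 3"
    "\<And>q. cmod (\<mu> (Suc q) - 1) \<le> cmod (\<mu> q - 1) / 4"
proof -
  have ex: "\<exists>z. cmod z = 1 \<and> z \<noteq> 1 \<and> (\<forall>k. cmod (z ^ n k - 1) \<le> \<epsilon>)" if "\<epsilon> > 0" for \<epsilon>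
    using not_sep[OF that] unfolding circle_separated_def by blast
  define P where "P q z \<longleftrightarrow> cmod z = 1 \<and> z \<noteq> 1 \<and> (\<forall>k. cmod (z ^ n k - 1) \<le> 1 / of_nat (2 * q + 2) ^ 3)" for q z
  have "\<exists>\<mu>. \<forall>q. P q (\<mu> q) \<and> cmod (\<mu> (Suc q) - 1) \<le> cmod (\<mu> q - 1) / 4"
  proof (rule dependent_nat_choice)
    show "\<exists>z. P 0 z" unfolding P_def by (rule ex) simp
    fix z q assume z: "P q z"
    define \<epsilon> where "\<epsilon> = min (1 / of_nat (2 * Suc q + 2) ^ 3) (cmod (z - 1) / 4)"
    have "\<epsilon> > 0" using z unfolding \<epsilon>_def P_def by (simp del: of_nat_Suc of_nat_add of_nat_mult)
    from ex[OF this] obtain w where w: "cmod w = 1" "w \<noteq> 1" "\<And>k. cmod (w ^ n k - 1) \<le> \<epsilon>" by blast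
    have "P (Suc q) w" unfolding P_def using w by (auto simp: \<epsilon>_def)
    moreover have "cmod (w - 1) \<le> cmod (z - 1) / 4" using w(3)[of 0] n0 by (simp add: \<epsilon>_def)
    ultimately show "\<exists>w. P (Suc q) w \<and> cmod (w - 1) \<le> cmod (z - 1) / 4" by blast
  qed
  then show thesis using that unfolding P_def by blast
qed

locale tree_operator =
  fixes n :: "nat \<Rightarrow> nat" and \<mu> :: "nat \<Rightarrow> complex"
  assumes n0: "n 0 = 1"
    and \<mu>1: "\<And>q. cmod (\<mu> q) = 1" and \<mu>_ne: "\<And>q. \<mu> q \<noteq> 1"
    and \<mu>_n: "\<And>q k. cmod (\<mu> q ^ n k - 1) \<le> 1 / of_nat (2 * q + 2) ^ 3"
    and \<mu>_Suc: "\<And>q. cmod (\<mu> (Suc q) - 1) \<le> cmod (\<mu> q - 1) / 4"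
begin

abbreviation "lam \<equiv> node_value \<mu>"

lemma lam1: "cmod (lam q) = 1"
proof (induction q rule: less_induct)
  case (less q)
  show ?case
  proof (cases "q \<ge> 2")
    case True
    then have "cmod (lam (q div 2)) = 1" by (intro less.IH) simp
    then show ?thesis using \<mu>1 by (simp add: node_value_child[OF True] norm_mult)
  qed (simp add: node_value_le_1)
qed

lemma lam_pow_step:
  assumes q: "q \<ge> 2" and b: "b \<ge> 0" and le: "odd q \<Longrightarrow> cmod (\<mu> (q div 2) ^ m - 1) \<le> b"
  shows "cmod (lam q ^ m - lam (q div 2) ^ m) \<le> b"
proof (cases "odd q")
  case True
  have "lam q ^ m - lam (q div 2) ^ m = lam (q div 2) ^ m * (\<mu> (q div 2) ^ m - 1)"
    using True by (simp add: node_value_child[OF q] power_mult_distrib algebra_simps)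
  then show ?thesis using le[OF True] by (simp add: norm_mult norm_power lam1)
qed (simp add: node_value_child[OF q] b)

lemma odd_index: "odd q \<Longrightarrow> real (2 * (q div 2) + 2) = real (q + 1)"
  by (elim oddE) simp

lemma lam_pow_step_n: "q \<ge> 2 \<Longrightarrow> cmod (lam q ^ n k - lam (q div 2) ^ n k) \<le> 1 / of_nat (q + 1) ^ 3"
proof (rule lam_pow_step)
  assume "odd q"
  show "cmod (\<mu> (q div 2) ^ n k - 1) \<le> 1 / of_nat (q + 1) ^ 3"
    using \<mu>_n[of "q div 2" k] unfolding odd_index[OF \<open>odd q\<close>] .
qed simp_all

text \<open>For the exponents outside the sequence there is only a bound that grows with \<open>m\<close>;
  it suffices for the matrix to define a bounded operator.\<close>

lemma lam_pow_step_general: "q \<ge> 2 \<Longrightarrow> cmod (lam q ^ m - lam (q div 2) ^ m) \<le> of_nat m / of_nat (q + 1) ^ 3"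
proof (rule lam_pow_step)
  assume "odd q"
  have "cmod (\<mu> (q div 2) ^ m - 1 ^ m) \<le> of_nat m * cmod (\<mu> (q div 2) - 1)"
    by (rule norm_power_diff) (simp_all add: \<mu>1)
  also have "\<dots> \<le> of_nat m * (1 / of_nat (q + 1) ^ 3)"
    using \<mu>_n[of "q div 2" 0] unfolding odd_index[OF \<open>odd q\<close>] n0 power_one_right
    by (rule mult_left_mono) simp
  finally show "cmod (\<mu> (q div 2) ^ m - 1) \<le> of_nat m / of_nat (q + 1) ^ 3" by simp
qed simp_all

text \<open>The power \<open>T ^ m\<close> of \<open>T = S 1\<close> agrees on the space \<open>X\<close>
  with the matrix \<open>S m\<close> of the numbers \<open>lam q ^ m\<close>. For \<open>m = n
  k\<close> this matrix is bounded independently of \<open>k\<close>.\<close>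

definition S :: "nat \<Rightarrow> (nat \<Rightarrow>\<^sub>C complex) \<Rightarrow> (nat \<Rightarrow>\<^sub>C complex)" where
  "S m = mat_op (tree_mat (\<lambda>q. lam q ^ m))"

abbreviation "K \<equiv> (\<Sum>q. 1 / of_nat (Suc q) ^ 2 :: real)"

lemma lam_pow_le: "cmod (lam q ^ m) \<le> 1" by (simp add: norm_power lam1)

lemmas rows = tree_rows[where f = "\<lambda>q. lam q ^ m" and C = "of_nat m",
    OF lam_pow_le of_nat_0_le_iff lam_pow_step_general] for m

lemmas rows_n = tree_rows[where f = "\<lambda>q. lam q ^ n k" and C = 1,
    OF lam_pow_le zero_le_one lam_pow_step_n] for k

lemma bounded_linear_S: "bounded_linear (S m)"
  unfolding S_def by (rule bounded_linear_mat_op[OF rows])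

lemma S_cmul: "S m (cmul c x) = cmul c (S m x)"
  unfolding S_def by (rule mat_op_cmul[OF rows])

lemma S_path_vec: "S m (path_vec r) = cmul (lam r ^ m) (path_vec r)"
  unfolding S_def
  by (rule tree_mat_path_vec[where C = "of_nat m", OF lam_pow_le of_nat_0_le_iff lam_pow_step_general])

lemma norm_S_n: "norm (S (n k) x) \<le> (1 + K) * norm x"
  using norm_mat_op[OF rows_n] by (simp add: S_def)

abbreviation T :: "(nat \<Rightarrow>\<^sub>C complex) \<Rightarrow> (nat \<Rightarrow>\<^sub>C complex)" where "T \<equiv> S 1"

text \<open>Real combinations of these vectors are the complex combinations of the path vectors.\<close>

definition generators :: "(nat \<Rightarrow>\<^sub>C complex) set" where
  "generators = range path_vec \<union> cmul \<i> ` range path_vec"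

definition X :: "(nat \<Rightarrow>\<^sub>C complex) set" where "X = closure (span generators)"

lemma closed_X: "closed X" by (simp add: X_def)

lemma subspace_X: "subspace X"
  unfolding X_def by (rule subspace_closure) (rule subspace_span)

lemma path_vec_X: "path_vec r \<in> X"
  unfolding X_def generators_def by (intro subsetD[OF closure_subset] span_base) auto

lemma bounded_linear_maps_X:
  assumes f: "bounded_linear f" and gen: "\<And>x. x \<in> generators \<Longrightarrow> f x \<in> X" and x: "x \<in> X"
  shows "f x \<in> X"
proof -
  have lin: "linear f" by (rule bounded_linear.linear[OF f])
  have "f y \<in> X" if "y \<in> span generators" for y
    using that
  proof (induction rule: span_induct_alt)
    case base
    then show ?case using linear_0[OF lin] subspace_0[OF subspace_X] by simp
  next
    case (step c a b)
    then show ?case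
      by (simp add: linear_add[OF lin] linear_scale[OF lin] gen subspace_add[OF subspace_X] subspace_scale[OF subspace_X])
  qed
  then have "f ` closure (span generators) \<subseteq> X"
    by (intro image_closure_subset closed_X linear_continuous_on f) auto
  then show ?thesis using x unfolding X_def by blast
qed

lemma generator_cases:
  assumes "x \<in> generators" obtains r d where "x = cmul d (path_vec r)"
proof -
  from assms have "x \<in> range path_vec \<or> x \<in> cmul \<i> ` range path_vec" by (simp add: generators_def)
  then show thesis
  proof
    assume "x \<in> range path_vec"
    then obtain r where "x = path_vec r" by (rule rangeE)
    then show thesis using that[of 1 r] by (simp add: cmul_simps)
  next
    assume "x \<in> cmul \<i> ` range path_vec"
    then obtain r where "x = cmul \<i> (path_vec r)" by blast
    then show thesis by (rule that)
  qed
qed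

lemma cmul_X: "x \<in> X \<Longrightarrow> cmul c x \<in> X"
proof (rule bounded_linear_maps_X[OF bounded_linear_cmul])
  fix x assume "x \<in> generators"
  then obtain r d where "x = cmul d (path_vec r)" by (rule generator_cases)
  then have "cmul c x = cmul (c * d) (path_vec r)" by (simp add: cmul_simps)
  also have "\<dots> = Re (c * d) *\<^sub>R path_vec r + Im (c * d) *\<^sub>R cmul \<i> (path_vec r)" by (rule cmul_Re_Im)
  also have "\<dots> \<in> span generators"
    unfolding generators_def by (intro span_add span_scale span_base) auto
  finally show "cmul c x \<in> X" unfolding X_def using closure_subset by blast
qed

lemma S_X: "x \<in> X \<Longrightarrow> S m x \<in> X"
proof (rule bounded_linear_maps_X[OF bounded_linear_S])
  fix x assume "x \<in> generators"
  then obtain r d where "x = cmul d (path_vec r)" by (rule generator_cases)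
  then have "S m x = cmul d (cmul (lam r ^ m) (path_vec r))" by (simp add: S_cmul S_path_vec)
  then show "S m x \<in> X" by (simp add: cmul_X path_vec_X)
qed

text \<open>Both sides are bounded linear and multiply each path vector by the same number.\<close>

lemma T_pow:
  assumes x: "x \<in> X" shows "(T ^^ m) x = S m x"
proof -
  have bl: "bounded_linear (T ^^ m)"
  proof (induction m)
    case 0
    then show ?case by (simp add: bounded_linear_ident id_def)
  next
    case (Suc m)
    then show ?case using bounded_linear_compose[OF bounded_linear_S Suc, of 1] by (simp add: o_def)
  qed
  define f where "f x = (T ^^ m) x - S m x" for x
  have blf: "bounded_linear f" unfolding f_def[abs_def] by (rule bounded_linear_sub[OF bl bounded_linear_S])
  have "f y = 0" if "y \<in> span generators" for y
    using that
  proof (rule linear_eq_0_on_span[OF bounded_linear.linear[OF blf], rotated])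
    fix x assume "x \<in> generators"
    then obtain r d where x: "x = cmul d (path_vec r)" by (rule generator_cases)
    have "(T ^^ m) x = cmul (lam r ^ m) x"
      by (induction m) (simp_all add: cmul_simps x S_cmul S_path_vec, simp flip: cmul_simps(3) add: mult_ac)
    then show "f x = 0" by (simp add: f_def x S_cmul S_path_vec flip: cmul_simps(3)) (simp add: mult.commute)
  qed
  then have "span generators \<subseteq> {y. f y = 0}" by blast
  then have "X \<subseteq> {y. f y = 0}" unfolding X_def
    by (rule closure_minimal) (intro closed_Collect_eq linear_continuous_on blf continuous_on_const)
  then show ?thesis using x by (auto simp: f_def)
qed

lemma \<mu>_decay: "cmod (\<mu> (q + i) - 1) \<le> (1/4) ^ i * cmod (\<mu> q - 1)"
proof (induction i)
  case (Suc i)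
  then show ?case using \<mu>_Suc[of "q + i"] by simp
qed simp

lemma \<mu>_decay_le: "q \<le> r \<Longrightarrow> cmod (\<mu> r - 1) \<le> cmod (\<mu> q - 1)"
proof (induction r rule: dec_induct)
  case (step r)
  then show ?case using \<mu>_Suc[of r] norm_ge_zero[of "\<mu> r - 1"] by linarith
qed simp

lemma lam_branch_step: "cmod (lam (branch s (Suc m)) - lam (branch s m)) \<le> cmod (\<mu> (branch s m) - 1)"
  using lam_pow_step[of "branch s (Suc m)" "cmod (\<mu> (branch s m) - 1)" 1] branch_pos[of s m]
  unfolding branch_div by simp

lemma lam_branch_tail:
  obtains l where "(\<lambda>m. lam (branch s m)) \<longlonglongrightarrow> l" "cmod (l - lam (branch s m)) \<le> 4/3 * cmod (\<mu> (branch s m) - 1)"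
proof -
  define Y where "Y i = lam (branch s (i + m))" for i
  have "norm (Y (Suc i) - Y i) \<le> cmod (\<mu> (branch s m) - 1) * (1/4) ^ i" for i
  proof -
    have "norm (Y (Suc i) - Y i) \<le> cmod (\<mu> (branch s (i + m)) - 1)"
      unfolding Y_def using lam_branch_step[of s "i + m"] by simp
    also have "\<dots> \<le> cmod (\<mu> (branch s m + i) - 1)"
      by (rule \<mu>_decay_le) (metis add.commute branch_mono)
    also have "\<dots> \<le> (1/4) ^ i * cmod (\<mu> (branch s m) - 1)" by (rule \<mu>_decay)
    finally show ?thesis by (simp add: mult.commute)
  qed
  then obtain l where l: "Y \<longlonglongrightarrow> l" "norm (l - Y 0) \<le> cmod (\<mu> (branch s m) - 1) / (1 - 1/4)"
    by (rule geometric_convergent) auto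
  have "(\<lambda>m. lam (branch s m)) \<longlonglongrightarrow> l" using l(1) unfolding Y_def[abs_def] by (rule LIMSEQ_offset)
  moreover have "cmod (l - lam (branch s m)) \<le> 4/3 * cmod (\<mu> (branch s m) - 1)" using l(2) by (simp add: Y_def)
  ultimately show thesis by (rule that)
qed

definition ev :: "(nat \<Rightarrow> bool) \<Rightarrow> complex" where "ev s = lim (\<lambda>m. lam (branch s m))"

lemma ev: "(\<lambda>m. lam (branch s m)) \<longlonglongrightarrow> ev s" "cmod (ev s - lam (branch s m)) \<le> 4/3 * cmod (\<mu> (branch s m) - 1)"
proof -
  obtain l where l: "(\<lambda>m. lam (branch s m)) \<longlonglongrightarrow> l" "cmod (l - lam (branch s m)) \<le> 4/3 * cmod (\<mu> (branch s m) - 1)"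
    by (rule lam_branch_tail)
  have "ev s = l" unfolding ev_def using l(1) by (rule limI)
  then show "(\<lambda>m. lam (branch s m)) \<longlonglongrightarrow> ev s" "cmod (ev s - lam (branch s m)) \<le> 4/3 * cmod (\<mu> (branch s m) - 1)"
    using l by simp_all
qed

lemma norm_ev: "cmod (ev s) = 1"
  using tendsto_norm[OF ev(1)[of s]] by (simp add: lam1 LIMSEQ_const_iff)

text \<open>Let \<open>q\<close> be the node where two branches separate and \<open>a\<close> the distance
  of \<open>\<mu> q\<close> from 1. At the next level the values differ by \<open>a\<close>,
  and along either branch all later changes add up to at most \<open>a/3\<close>.\<close>

lemma inj_ev: "inj ev"
proof (rule injI, rule ccontr)
  fix s t assume eq: "ev s = ev t" and "s \<noteq> t"
  then have "\<exists>m. s m \<noteq> t m" by blast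
  define m where "m = (LEAST m. s m \<noteq> t m)"
  have m: "s m \<noteq> t m" "\<And>i. i < m \<Longrightarrow> s i = t i"
    unfolding m_def using LeastI_ex[OF \<open>\<exists>m. s m \<noteq> t m\<close>] not_less_Least by blast+
  have "i \<le> m \<Longrightarrow> branch s i = branch t i" for i by (induction i) (use m(2) in auto)
  then have bm: "branch s m = branch t m" by simp
  define q where "q = branch s m"
  define a where "a = cmod (\<mu> q - 1)"
  have "a > 0" unfolding a_def using \<mu>_ne by simp
  have near: "cmod (ev u - lam (branch u (Suc m))) \<le> 1/3 * a" if "branch u m = q" for u
  proof -
    have "branch u (Suc m) \<ge> q + 1" using branch_mono[of u m 1] that by simp
    then have "cmod (\<mu> (branch u (Suc m)) - 1) \<le> cmod (\<mu> (q + 1) - 1)" by (rule \<mu>_decay_le)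
    also have "\<dots> \<le> 1/4 * a" using \<mu>_Suc[of q] by (simp add: a_def)
    finally show ?thesis using ev(2)[of u "Suc m"] by linarith
  qed
  have far: "cmod (lam (branch u (Suc m)) - lam (branch v (Suc m))) = a"
    if u: "u m" "branch u m = q" and v: "\<not> v m" "branch v m = q" for u v
  proof -
    have "q \<ge> 1" unfolding q_def by (rule branch_pos)
    then have "lam (branch u (Suc m)) - lam (branch v (Suc m)) = lam q * (\<mu> q - 1)"
      using u v node_value_child[of "branch u (Suc m)" \<mu>] node_value_child[of "branch v (Suc m)" \<mu>]
      by (simp add: algebra_simps)
    then show ?thesis by (simp add: norm_mult lam1 a_def)
  qed
  have bs: "branch s m = q" by (rule q_def[symmetric])
  have bt: "branch t m = q" unfolding bm[symmetric] by (rule bs)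
  define A where "A = lam (branch s (Suc m))"
  define A' where "A' = lam (branch t (Suc m))"
  \<comment> \<open>Exactly one of the two branches turns to the odd child of \<open>q\<close>.\<close>
  have "a = cmod (A - A')"
  proof (cases "s m")
    case True
    then have "\<not> t m" using m(1) by blast
    show ?thesis using far[OF True bs \<open>\<not> t m\<close> bt] unfolding A_def A'_def by (rule sym)
  next
    case False
    then have "t m" using m(1) by blast
    show ?thesis using far[OF \<open>t m\<close> bt False bs] unfolding A_def A'_def norm_minus_commute[of "lam (branch s (Suc m))"]
      by (rule sym)
  qed
  also have "A - A' = (ev t - A') - (ev s - A)" using eq by simp
  also have "cmod \<dots> \<le> cmod (ev t - A') + cmod (ev s - A)" by (rule norm_triangle_ineq4)
  also have "\<dots> \<le> 1/3 * a + 1/3 * a"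
    unfolding A_def A'_def by (rule add_mono[OF near[OF bt] near[OF bs]])
  finally show False using \<open>a > 0\<close> by simp
qed

text \<open>The path vectors of the nodes on a branch are eigenvectors of \<open>T\<close> that converge;
  the root coordinate of the limit is \<open>1/2\<close>.\<close>

lemma eigenvector_exists_ev:
  obtains x where "x \<in> X" "x \<noteq> 0" "T x = cmul (ev s) x"
proof -
  define Y where "Y m = path_vec (branch s m)" for m
  have "norm (Y (Suc m) - Y m) \<le> 1 * (1/2) ^ m" for m
  proof (rule norm_bound)
    fix p
    have "\<not> ancestor (branch s (Suc m)) (branch s m)"
      using ancestor_le[of "branch s (Suc m)" "branch s m"] branch_pos[of s m] by auto
    then have "apply_bcontfun (Y (Suc m) - Y m) p = (if p = branch s (Suc m) then 1 / of_nat (p + 1) else 0)"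
      unfolding Y_def by (auto simp: apply_bcontfun_simps apply_path_vec ancestor_branch simp del: branch.simps of_nat_Suc of_nat_add)
    moreover have "1 / real (branch s (Suc m) + 1) \<le> 1 / 2 ^ m"
    proof (intro divide_left_mono)
      have "(2::nat) ^ m \<le> 2 ^ Suc m" by simp
      also have "\<dots> \<le> branch s (Suc m) + 1" using branch_ge[of "Suc m" s] by linarith
      finally show "2 ^ m \<le> real (branch s (Suc m) + 1)" by (metis of_nat_le_iff of_nat_numeral of_nat_power)
    qed simp_all
    ultimately show "norm (apply_bcontfun (Y (Suc m) - Y m) p) \<le> 1 * (1/2) ^ m"
      by (auto simp: norm_divide power_divide simp del: branch.simps of_nat_Suc of_nat_add)
  qed
  then obtain x where x: "Y \<longlonglongrightarrow> x" by (rule geometric_convergent) auto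
  have "x \<in> X" by (rule closed_sequentially[OF closed_X _ x]) (simp add: Y_def path_vec_X)
  moreover have "T x = cmul (ev s) x"
  proof (rule LIMSEQ_unique)
    show "(\<lambda>m. T (Y m)) \<longlonglongrightarrow> T x" by (rule bounded_linear.tendsto[OF bounded_linear_S x])
    have "T (Y m) = cmul (lam (branch s m)) (Y m)" for m using S_path_vec[of 1] by (simp add: Y_def)
    then show "(\<lambda>m. T (Y m)) \<longlonglongrightarrow> cmul (ev s) x" using tendsto_cmul[OF ev(1) x] by simp
  qed
  moreover have "x \<noteq> 0"
  proof
    assume "x = 0"
    then have l: "(\<lambda>m. norm (Y m)) \<longlonglongrightarrow> 0" using tendsto_norm[OF x] by simp
    have "\<forall>\<^sub>F m in sequentially. norm (Y m) < 1/2" by (rule order_tendstoD(2)[OF l]) simp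
    then obtain m where "norm (Y m) < 1/2" using eventually_happens'[OF sequentially_bot] by blast
    moreover have "norm (apply_bcontfun (Y m) 1) = 1/2"
      unfolding Y_def using ancestor_1[OF branch_pos[of s m]] by (simp add: apply_path_vec norm_divide)
    ultimately show False using norm_bounded[of "Y m" 1] by simp
  qed
  ultimately show thesis using that by blast
qed

lemma countable_dense_X:
  obtains D where "countable D" "D \<subseteq> X" "X \<subseteq> closure D"
proof -
  have "countable generators" unfolding generators_def by auto
  then obtain D where D: "countable D" "D \<subseteq> span generators" "span generators \<subseteq> closure D"
    by (rule countable_dense_in_span)
  have "D \<subseteq> X" using D(2) closure_subset unfolding X_def by blast
  moreover have "X \<subseteq> closure D" unfolding X_def using D(3) by (rule closure_minimal) simp
  ultimately show thesis using that D(1) by blast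
qed

end

section \<open>Transport to an arbitrary type of continuum size\<close>

text \<open>Real numbers correspond to sets of natural numbers, so a sequence of reals can be coded by one
  set of pairs. Real and imaginary parts go to the even and odd places.\<close>

lemma complex_sequences_inj_real: "\<exists>F :: (nat \<Rightarrow> complex) \<Rightarrow> real. inj F"
proof -
  obtain b :: "real \<Rightarrow> nat set" where b: "inj b"
    using nat_sets_eqpoll_reals by (metis bij_betw_def eqpoll_def eqpoll_sym)
  obtain c :: "nat set \<Rightarrow> real" where c: "inj c"
    using nat_sets_eqpoll_reals by (metis bij_betw_def eqpoll_def)
  define A where "A h = {prod_encode (k, m) | k m. m \<in> b (h k)}" for h :: "nat \<Rightarrow> real"
  have A: "inj A"
  proof (rule injI)
    fix h h' assume eq: "A h = A h'"
    have mem: "m \<in> b (h k) \<longleftrightarrow> prod_encode (k, m) \<in> A h" for m k h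
      unfolding A_def by auto
    have "b (h k) = b (h' k)" for k using mem[of _ h k] mem[of _ h' k] eq by blast
    then show "h = h'" using b by (auto simp: fun_eq_iff inj_eq)
  qed
  define F where "F f = c (A (\<lambda>j. if even j then Re (f (j div 2)) else Im (f (j div 2))))" for f :: "nat \<Rightarrow> complex"
  have "inj F"
  proof (rule injI)
    fix f f' assume "F f = F f'"
    then have eq: "(\<lambda>j. if even j then Re (f (j div 2)) else Im (f (j div 2))) = (\<lambda>j. if even j then Re (f' (j div 2)) else Im (f' (j div 2)))"
      unfolding F_def using A c by (simp add: inj_eq)
    have "f k = f' k" for k
      using fun_cong[OF eq, of "2 * k"] fun_cong[OF eq, of "2 * k + 1"] by (simp add: complex_eq_iff)
    then show "f = f'" by blast
  qed
  then show ?thesis by blast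
qed

lemma cring_complex_ring: "cring complex_ring"
proof -
  have "\<exists>y. y + x = 0" for x :: complex by (rule exI[of _ "- x"]) simp
  then show ?thesis
    by (intro cringI abelian_groupI comm_monoidI) (auto simp: complex_ring_def algebra_simps)
qed

definition transported_module :: "((nat \<Rightarrow>\<^sub>C complex) \<Rightarrow> 'b) \<Rightarrow> (nat \<Rightarrow>\<^sub>C complex) set \<Rightarrow> 'b normed_module" where
  "transported_module h X = \<lparr>carrier = h ` X, monoid.mult = (\<lambda>x y. x), one = h 0, ring.zero = h 0,
     ring.add = (\<lambda>x y. h (inv_into UNIV h x + inv_into UNIV h y)),
     smult = (\<lambda>c x. h (cmul c (inv_into UNIV h x))), nrm = (\<lambda>x. norm (inv_into UNIV h x))\<rparr>"

locale module_copy =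
  fixes h :: "(nat \<Rightarrow>\<^sub>C complex) \<Rightarrow> 'b" and X :: "(nat \<Rightarrow>\<^sub>C complex) set"
  assumes inj_h: "inj h" and subsp: "subspace X" and closed: "closed X"
    and cmul_closed: "\<And>c x. x \<in> X \<Longrightarrow> cmul c x \<in> X"
begin

abbreviation "Y \<equiv> transported_module h X"
abbreviation "k \<equiv> inv_into UNIV h"

lemma kh: "k (h x) = x" using inj_h by simp

lemma h_eq: "h x = h y \<longleftrightarrow> x = y" using inj_h by (rule inj_eq)

lemma Y_simps:
  "carrier Y = h ` X" "x \<oplus>\<^bsub>Y\<^esub> y = h (k x + k y)" "\<zero>\<^bsub>Y\<^esub> = h 0" "c \<odot>\<^bsub>Y\<^esub> x = h (cmul c (k x))"
  "nrm Y x = norm (k x)"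
  by (simp_all add: transported_module_def)

lemma abelian_group_Y: "abelian_group Y"
proof (rule abelian_groupI)
  fix x assume "x \<in> carrier Y"
  then obtain u where u: "u \<in> X" "x = h u" by (auto simp: Y_simps)
  have "- u \<in> X" by (rule subspace_neg[OF subsp u(1)])
  then show "\<exists>y\<in>carrier Y. y \<oplus>\<^bsub>Y\<^esub> x = \<zero>\<^bsub>Y\<^esub>" by (intro bexI[of _ "h (- u)"]) (auto simp: Y_simps kh u)
qed (auto simp: Y_simps kh add_ac intro!: subspace_add[OF subsp] subspace_0[OF subsp])

lemma complex_normed_space_Y: "complex_normed_space Y"
proof (intro complex_normed_space.intro complex_normed_space_axioms.intro)
  show "Module.module complex_ring Y"
  proof (intro Module.module.intro module_axioms.intro cring_complex_ring abelian_group_Y)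
    show "c \<odot>\<^bsub>Y\<^esub> x \<in> carrier Y" if "x \<in> carrier Y" for c x using that by (auto simp: Y_simps kh cmul_closed)
  qed (auto simp: Y_simps kh cmul_simps complex_ring_def)
  show "0 \<le> nrm Y x" for x by (simp add: Y_simps)
  show "(nrm Y x = 0) = (x = \<zero>\<^bsub>Y\<^esub>)" if "x \<in> carrier Y" for x using that by (auto simp: Y_simps kh h_eq)
  show "nrm Y (c \<odot>\<^bsub>Y\<^esub> x) = cmod c * nrm Y x" for c x by (simp add: Y_simps kh norm_cmul)
  show "nrm Y (x \<oplus>\<^bsub>Y\<^esub> y) \<le> nrm Y x + nrm Y y" for x y by (simp add: Y_simps kh norm_triangle_ineq)
qed

lemma nrm_dist_Y:
  assumes "u \<in> X" "v \<in> X" shows "nrm_dist Y (h u) (h v) = norm (u - v)"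
proof -
  interpret Y: abelian_group Y by (rule abelian_group_Y)
  have "- v \<in> X" by (rule subspace_neg[OF subsp assms(2)])
  then have "\<ominus>\<^bsub>Y\<^esub> h v = h (- v)"
    using assms by (intro Y.minus_equality) (auto simp: Y_simps kh)
  then show ?thesis using assms by (simp add: nrm_dist_def a_minus_def Y_simps kh)
qed

lemma Metric_space_Y: "Metric_space (carrier Y) (nrm_dist Y)"
  by (rule complex_normed_space.Metric_space_nrm_dist[OF complex_normed_space_Y])

lemma mcomplete_Y: "Metric_space.mcomplete (carrier Y) (nrm_dist Y)"
proof -
  interpret MS: Metric_space "carrier Y" "nrm_dist Y" by (rule Metric_space_Y)
  show ?thesis unfolding MS.mcomplete_def
  proof (intro allI impI)
    fix \<sigma> assume \<sigma>: "MS.MCauchy \<sigma>"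
    have \<sigma>Y: "\<sigma> i \<in> carrier Y" for i using \<sigma> by (auto simp: MS.MCauchy_def)
    have "\<exists>u. u \<in> X \<and> \<sigma> i = h u" for i using \<sigma>Y[of i] by (auto simp: Y_simps)
    then obtain u where u: "\<And>i. u i \<in> X" "\<And>i. \<sigma> i = h (u i)" by metis
    have d: "nrm_dist Y (\<sigma> i) (\<sigma> j) = norm (u i - u j)" for i j by (simp add: u nrm_dist_Y)
    have "Cauchy u"
    proof (rule CauchyI)
      fix e :: real assume "e > 0"
      then obtain N where "\<And>i j. N \<le> i \<Longrightarrow> N \<le> j \<Longrightarrow> nrm_dist Y (\<sigma> i) (\<sigma> j) < e"
        using \<sigma> unfolding MS.MCauchy_def by blast
      then show "\<exists>N. \<forall>i\<ge>N. \<forall>j\<ge>N. norm (u i - u j) < e" unfolding d by blast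
    qed
    then obtain l where l: "u \<longlonglongrightarrow> l" using Cauchy_convergent_iff convergent_def by blast
    have lX: "l \<in> X" by (rule closed_sequentially[OF closed u(1) l])
    have "limitin MS.mtopology \<sigma> (h l) sequentially"
      unfolding MS.limit_metric_sequentially
    proof (intro conjI allI impI)
      show "h l \<in> carrier Y" using lX by (simp add: Y_simps)
      fix e :: real assume "e > 0"
      then obtain N where "\<forall>i\<ge>N. norm (u i - l) < e" using LIMSEQ_D[OF l] by blast
      then show "\<exists>N. \<forall>i\<ge>N. \<sigma> i \<in> carrier Y \<and> nrm_dist Y (\<sigma> i) (h l) < e"
        using \<sigma>Y by (intro exI[of _ N]) (simp add: u nrm_dist_Y lX)
    qed
    then show "\<exists>x. limitin MS.mtopology \<sigma> x sequentially" by blast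
  qed
qed

lemma separable_Y:
  assumes D: "countable D" "D \<subseteq> X" "X \<subseteq> closure D"
  shows "separable_space (Metric_space.mtopology (carrier Y) (nrm_dist Y))"
proof -
  interpret MS: Metric_space "carrier Y" "nrm_dist Y" by (rule Metric_space_Y)
  have "x \<in> MS.mtopology closure_of (h ` D)" if x: "x \<in> carrier Y" for x
    unfolding MS.metric_closure_of
  proof (intro CollectI conjI allI impI x)
    fix e :: real assume "e > 0"
    obtain u where u: "u \<in> X" "x = h u" using x by (auto simp: Y_simps)
    then obtain v where v: "v \<in> D" "dist v u < e" using D(3) \<open>e > 0\<close> closure_approachable by blast
    then have "v \<in> X" using D(2) by blast
    then have "h v \<in> MS.mball x e"
      unfolding MS.in_mball using u v by (simp add: nrm_dist_Y dist_norm norm_minus_commute Y_simps)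
    then show "\<exists>y\<in>h ` D. y \<in> MS.mball x e" using v(1) by blast
  qed
  then have "MS.mtopology closure_of (h ` D) = carrier Y"
    using closure_of_subset_topspace[of MS.mtopology "h ` D"] by auto
  moreover have "h ` D \<subseteq> carrier Y" using D(2) by (auto simp: Y_simps)
  ultimately show ?thesis
    unfolding separable_space_def MS.topspace_mtopology using D(1) by (intro exI[of _ "h ` D"]) simp
qed

end

text \<open>The tree operator on the closed span of the path vectors has bounded powers along
  \<open>n\<close> and one unimodular eigenvalue for each infinite branch, and different
  branches have different eigenvalues.\<close>

theorem not_jamison:
  assumes cont: "has_continuum TYPE('b)" and n0: "n 0 = 1"
    and not_sep: "\<And>\<epsilon>. \<epsilon> > 0 \<Longrightarrow> \<not> circle_separated n \<epsilon>"
  shows "\<not> jamison_sequence TYPE('b) n"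
proof
  assume jam: "jamison_sequence TYPE('b) n"
  obtain \<mu> where \<mu>: "\<And>q. cmod (\<mu> q) = 1" "\<And>q. \<mu> q \<noteq> 1"
    "\<And>q k. cmod (\<mu> q ^ n k - 1) \<le> 1 / of_nat (2 * q + 2) ^ 3"
    "\<And>q. cmod (\<mu> (Suc q) - 1) \<le> cmod (\<mu> q - 1) / 4"
    using exists_perturbations[OF n0 not_sep] by blast
  interpret tree_operator n \<mu> by unfold_locales (rule n0 \<mu>)+
  obtain F :: "(nat \<Rightarrow> complex) \<Rightarrow> real" where F: "inj F" using complex_sequences_inj_real by blast
  obtain g :: "real \<Rightarrow> 'b" where g: "inj g" using cont by (auto simp: has_continuum_def)
  define h where "h x = g (F (apply_bcontfun x))" for x :: "nat \<Rightarrow>\<^sub>C complex"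
  have inj_h: "inj h"
    unfolding h_def by (rule injI) (use F g in \<open>auto simp: inj_eq intro: bcontfun_eqI dest: fun_cong\<close>)
  define U where "U = transported_module h X"
  have ctx: "module_copy h X" by (rule module_copy.intro[OF inj_h subspace_X closed_X cmul_X])
  note U_simps = module_copy.Y_simps[OF ctx, folded U_def]
  note kh = module_copy.kh[OF ctx]
  define T' where "T' x = h (T (inv_into UNIV h x))" for x
  have T'_pow: "(T' ^^ m) (h x) = h ((T ^^ m) x)" for m x
    by (induction m) (simp_all add: T'_def kh)
  obtain D where D: "countable D" "D \<subseteq> X" "X \<subseteq> closure D" by (rule countable_dense_X)
  have "separable_complex_banach U"
    unfolding separable_complex_banach_def U_def
    using module_copy.complex_normed_space_Y[OF ctx] module_copy.mcomplete_Y[OF ctx] module_copy.separable_Y[OF ctx D] by blast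
  moreover have "bounded_operator U T'"
    unfolding bounded_operator_def
  proof (intro conjI ballI allI)
    show "T' \<in> carrier U \<rightarrow> carrier U" by (auto simp: U_simps T'_def kh S_X)
    show "T' (x \<oplus>\<^bsub>U\<^esub> y) = T' x \<oplus>\<^bsub>U\<^esub> T' y" for x y
      by (simp add: U_simps T'_def kh linear_add[OF bounded_linear.linear[OF bounded_linear_S]])
    show "T' (c \<odot>\<^bsub>U\<^esub> x) = c \<odot>\<^bsub>U\<^esub> T' x" for c x by (simp add: U_simps T'_def kh S_cmul)
    have "norm (T x) \<le> (1 + K) * norm x" for x using norm_S_n[of 0 x] n0 by simp
    then show "\<exists>C. \<forall>x\<in>carrier U. nrm U (T' x) \<le> C * nrm U x"
      by (intro exI[of _ "1 + K"]) (simp add: U_simps T'_def kh)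
  qed
  moreover have "bdd_above (range (\<lambda>k. operator_norm U (T' ^^ n k)))"
  proof (rule bdd_aboveI2)
    fix k
    show "operator_norm U (T' ^^ n k) \<le> \<bar>1 + K\<bar>"
      unfolding operator_norm_def
    proof (rule cSUP_least)
      have "h 0 \<in> {x \<in> carrier U. nrm U x \<le> 1}" using subspace_0[OF subspace_X] by (simp add: U_simps kh)
      then show "{x \<in> carrier U. nrm U x \<le> 1} \<noteq> {}" by blast
      fix x assume "x \<in> {x \<in> carrier U. nrm U x \<le> 1}"
      then obtain u where u: "u \<in> X" "x = h u" "norm u \<le> 1" by (auto simp: U_simps kh)
      have "nrm U ((T' ^^ n k) x) = norm (S (n k) u)" using T_pow[OF u(1)] by (simp add: u(2) T'_pow U_simps kh)
      also have "\<dots> \<le> (1 + K) * norm u" by (rule norm_S_n)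
      also have "\<dots> \<le> \<bar>1 + K\<bar> * norm u" by (intro mult_right_mono) simp_all
      also have "\<dots> \<le> \<bar>1 + K\<bar> * 1" using u(3) by (rule mult_left_mono) simp
      finally show "nrm U ((T' ^^ n k) x) \<le> \<bar>1 + K\<bar>" by simp
    qed
  qed
  ultimately have "countable {c \<in> eigenvalues U T'. cmod c = 1}"
    using jam unfolding jamison_sequence_def by blast
  moreover have "range ev \<subseteq> {c \<in> eigenvalues U T'. cmod c = 1}"
  proof
    fix c assume "c \<in> range ev"
    then obtain s where s: "c = ev s" by blast
    obtain x where x: "x \<in> X" "x \<noteq> 0" "T x = cmul (ev s) x" by (rule eigenvector_exists_ev)
    have "h x \<in> carrier U" "h x \<noteq> \<zero>\<^bsub>U\<^esub>" "T' (h x) = c \<odot>\<^bsub>U\<^esub> h x"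
      using x by (auto simp: U_simps T'_def kh module_copy.h_eq[OF ctx] s)
    then show "c \<in> {c \<in> eigenvalues U T'. cmod c = 1}" using norm_ev s unfolding eigenvalues_def by blast
  qed
  ultimately have "countable (range ev)" by (rule countable_subset[rotated])
  then have "countable (UNIV :: (nat \<Rightarrow> bool) set)" by (rule countable_image_inj_on[OF _ inj_ev])
  then have "countable (range (\<lambda>A :: nat set. \<lambda>m. m \<in> A))" by (rule countable_subset[OF subset_UNIV])
  moreover have "inj (\<lambda>A :: nat set. \<lambda>m. m \<in> A)" by (rule injI) (auto simp: fun_eq_iff)
  ultimately have "countable (UNIV :: nat set set)" by (rule countable_image_inj_on)
  then show False
    using nat_sets_eqpoll_reals uncountable_UNIV_real countable_eqpoll eqpoll_sym by blast
qed

theorem theorem2p2: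
  fixes n :: "nat \<Rightarrow> nat"
  assumes "strict_mono n" and "n 0 = 1"
    and "has_continuum TYPE('a)" and "has_continuum TYPE('b)"
  shows "(nss_for_class (lie_groups :: 'a topgroup set) n \<longleftrightarrow> nss circle_group n) \<and>
         (nss circle_group n \<longleftrightarrow> jamison_sequence TYPE('b) n)"
proof (intro conjI iffI)
  assume "nss_for_class (lie_groups :: 'a topgroup set) n"
  obtain F :: "(nat \<Rightarrow> complex) \<Rightarrow> real" where F: "inj F" using complex_sequences_inj_real by blast
  obtain g :: "real \<Rightarrow> 'a" where g: "inj g" using assms(3) by (auto simp: has_continuum_def)
  \<comment> \<open>Complex numbers are coded as constant sequences.\<close>
  have "inj (\<lambda>z. g (F (\<lambda>_. z)))"
    by (rule injI) (use F g in \<open>auto simp: inj_eq dest: fun_cong\<close>)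
  then interpret units_copy "\<lambda>z. g (F (\<lambda>_. z))" by unfold_locales
  have "nss (transported_units (\<lambda>z. g (F (\<lambda>_. z)))) n"
    using \<open>nss_for_class lie_groups n\<close> lie_group_G unfolding nss_for_class_def lie_groups_def by blast
  then show "nss circle_group n" by (rule nss_circle_of_units)
next
  assume "nss circle_group n"
  then obtain \<epsilon> where \<epsilon>: "circle_separated n \<epsilon>" "\<epsilon> > 0" unfolding nss_circle_iff by blast
  show "nss_for_class (lie_groups :: 'a topgroup set) n"
    unfolding nss_for_class_def
  proof
    fix G :: "'a topgroup"
    assume "G \<in> lie_groups"
    then consider "lie_group TYPE(real) G" | "lie_group TYPE(complex) G" unfolding lie_groups_def by blast
    then show "nss G n" by cases (rule lie_group_nss[OF _ assms(1,2) \<epsilon>]; assumption)+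
  qed
next
  assume "nss circle_group n"
  then show "jamison_sequence TYPE('b) n"
    unfolding nss_circle_iff using jamison_of_circle_separated by blast
next
  assume "jamison_sequence TYPE('b) n"
  then show "nss circle_group n"
    unfolding nss_circle_iff using not_jamison[where n = n, OF assms(4,2)] by blast
qed

end
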